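(* Let $d\ge 1$ be an integer and $m\neq 0$ a real number, and let $\mu_m$ be the Gaussian measure of mean zero on $\mathcal S'(\mathbb R^d)$ with covariance $(f,g)_m=\frac12\int_{\mathbb R^d} f\,(m^2-\Delta)^{-1/2}g\,d^dx$, $f,g\in\mathcal S(\mathbb R^d)$. Let $\alpha>d/4$ and $\beta>(d-1)/4$. Then $\mu_m$ is supported on the set $$(m^2-\Delta)^{\beta}(1+x^2)^{\alpha}L^2(\mathbb R^d),$$ that is, for $\mu_m$-almost every $\phi\in\mathcal S'(\mathbb R^d)$ one has $(1+x^2)^{-\alpha}(m^2-\Delta)^{-\beta}\phi\in L^2(\mathbb R^d)$.
   Context: $\mathcal S(\mathbb R^d)$ is the nuclear space of real Schwartz functions and $\mathcal S'(\mathbb R^d)$ its topological dual (real tempered distributions). $\Delta$ is the Laplacian; for real $s$, $(m^2-\Delta)^{s}$ is the operator acting on tempered distributions as multiplication of the Fourier transform by $(m^2+p^2)^{s}$, where $p^2=|p|^2$. $(1+x^2)^{s}$ denotes multiplication by the function $x\mapsto(1+|x|^2)^{s}$. The Gaussian measure of mean zero with covariance $(\cdot,\cdot)_m$ is the unique probability measure $\mu_m$ on $\mathcal S'(\mathbb R^d)$ (with the $\sigma$-algebra generated by the evaluations $\phi\mapsto\phi(f)$, $f\in\mathcal S(\mathbb R^d)$) such that $\int e^{i\phi(f)}\,d\mu_m(\phi)=e^{-\frac12 (f,f)_m}$ for all $f\in\mathcal S(\mathbb R^d)$. "For $\mu_m$-almost every $\phi$" means that the exceptional set is contained in a measurable set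 of $\mu_m$-measure zero. *)

theory Defs
  imports "HOL-Probability.Probability"
begin

text \<open>Euclidean space \<open>\<real>\<^sup>d\<close> is an arbitrary type of class \<^class>\<open>euclidean_space\<close>, with
  \<open>d = DIM('a)\<close>.\<close>

section \<open>Schwartz functions and tempered distributions\<close>

text \<open>A multi-index is given as a list of basis vectors, one entry per differentiation.\<close>

primrec partial_deriv :: "'a list \<Rightarrow> ('a::euclidean_space \<Rightarrow> 'b::real_normed_vector) \<Rightarrow> 'a \<Rightarrow> 'b"
  where
    "partial_deriv [] f = f"
  | "partial_deriv (b # bs) f = (\<lambda>x. frechet_derivative (partial_deriv bs f) (at x) b)"

definition smooth :: "('a::euclidean_space \<Rightarrow> 'b::real_normed_vector) \<Rightarrow> bool"
  where "smooth f \<longleftrightarrow> (\<forall>bs\<in>lists Basis. \<forall>x. partial_deriv bs f differentiable (at x))"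

definition schwartz :: "('a::euclidean_space \<Rightarrow> 'b::real_normed_vector) set"
  where "schwartz = {f. smooth f \<and>
    (\<forall>k. \<forall>bs\<in>lists Basis. bounded (range (\<lambda>x. norm x ^ k *\<^sub>R partial_deriv bs f x)))}"

definition schwartz_seminorm ::
    "nat \<Rightarrow> 'a list \<Rightarrow> ('a::euclidean_space \<Rightarrow> 'b::real_normed_vector) \<Rightarrow> real"
  where "schwartz_seminorm k bs f = (SUP x. norm x ^ k * norm (partial_deriv bs f x))"

definition schwartz_topology :: "('a::euclidean_space \<Rightarrow> 'b::real_normed_vector) topology"
  where "schwartz_topology = topology_generated_by
    {{g \<in> schwartz. schwartz_seminorm k bs (\<lambda>x. g x - f x) < r} | k bs f r.
       bs \<in> lists Basis \<and> f \<in> schwartz \<and> 0 < r}"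

text \<open>The dual of the space of real Schwartz functions.  Functionals are \<^const>\<open>undefined\<close>
  off \<^const>\<open>schwartz\<close>, so that equality of functionals is equality on Schwartz functions.\<close>

definition tempered_distributions :: "(('a::euclidean_space \<Rightarrow> real) \<Rightarrow> real) set"
  where "tempered_distributions = {\<phi> \<in> extensional schwartz.
    (\<forall>f\<in>schwartz. \<forall>g\<in>schwartz. \<phi> (\<lambda>x. f x + g x) = \<phi> f + \<phi> g) \<and>
    (\<forall>c. \<forall>f\<in>schwartz. \<phi> (\<lambda>x. c * f x) = c * \<phi> f) \<and>
    continuous_map schwartz_topology euclideanreal \<phi>}"

definition tempered_algebra :: "(('a::euclidean_space \<Rightarrow> real) \<Rightarrow> real) measure"
  where "tempered_algebra = sigma tempered_distributions
    {{\<phi> \<in> tempered_distributions. \<phi> f \<in> B} | f B. f \<in> schwartz \<and> B \<in> sets borel}"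

section \<open>Fourier transform\<close>

text \<open>The frequency variable is angular, so that \<open>-\<Delta>\<close> corresponds to multiplication
  by \<open>p\<^sup>2\<close> without factors of \<open>2\<pi>\<close>.\<close>

definition fourier :: "('a::euclidean_space \<Rightarrow> complex) \<Rightarrow> 'a \<Rightarrow> complex"
  where "fourier f p = of_real ((2 * pi) powr (- real DIM('a) / 2)) *
    (\<integral>x. exp (- \<i> * of_real (p \<bullet> x)) * f x \<partial>lborel)"

definition inv_fourier :: "('a::euclidean_space \<Rightarrow> complex) \<Rightarrow> 'a \<Rightarrow> complex"
  where "inv_fourier f x = of_real ((2 * pi) powr (- real DIM('a) / 2)) *
    (\<integral>p. exp (\<i> * of_real (p \<bullet> x)) * f p \<partial>lborel)"

section \<open>Operators on distributions\<close>

text \<open>Operators involving the Fourier transform act on complex-linear functionals on complex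
  Schwartz functions; real distributions are embedded by complex-linear extension.\<close>

type_synonym 'a cdist = "('a \<Rightarrow> complex) \<Rightarrow> complex"

definition complexify :: "(('a::euclidean_space \<Rightarrow> real) \<Rightarrow> real) \<Rightarrow> 'a cdist"
  where "complexify \<phi> = (\<lambda>g\<in>schwartz. Complex (\<phi> (\<lambda>x. Re (g x))) (\<phi> (\<lambda>x. Im (g x))))"

definition dist_of_fun :: "('a::euclidean_space \<Rightarrow> real) \<Rightarrow> 'a cdist"
  where "dist_of_fun h = (\<lambda>g\<in>schwartz. \<integral>x. of_real (h x) * g x \<partial>lborel)"

definition dist_mult :: "('a::euclidean_space \<Rightarrow> real) \<Rightarrow> 'a cdist \<Rightarrow> 'a cdist"
  where "dist_mult a T = (\<lambda>g\<in>schwartz. T (\<lambda>x. of_real (a x) * g x))"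

definition dist_fourier :: "'a::euclidean_space cdist \<Rightarrow> 'a cdist"
  where "dist_fourier T = (\<lambda>g\<in>schwartz. T (fourier g))"

definition dist_inv_fourier :: "'a::euclidean_space cdist \<Rightarrow> 'a cdist"
  where "dist_inv_fourier T = (\<lambda>g\<in>schwartz. T (inv_fourier g))"

definition bessel_symbol :: "real \<Rightarrow> real \<Rightarrow> 'a::euclidean_space \<Rightarrow> real"
  where "bessel_symbol m s p = (m\<^sup>2 + (norm p)\<^sup>2) powr s"

text \<open>The operator \<open>(m\<^sup>2 - \<Delta>)\<^sup>s\<close> on distributions and on functions.\<close>

definition dist_bessel :: "real \<Rightarrow> real \<Rightarrow> 'a::euclidean_space cdist \<Rightarrow> 'a cdist"
  where "dist_bessel m s T = dist_inv_fourier (dist_mult (bessel_symbol m s) (dist_fourier T))"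

definition fun_bessel :: "real \<Rightarrow> real \<Rightarrow> ('a::euclidean_space \<Rightarrow> complex) \<Rightarrow> 'a \<Rightarrow> complex"
  where "fun_bessel m s f = inv_fourier (\<lambda>p. of_real (bessel_symbol m s p) * fourier f p)"

definition weight :: "real \<Rightarrow> 'a::euclidean_space \<Rightarrow> real"
  where "weight s x = (1 + (norm x)\<^sup>2) powr s"

definition L2 :: "('a::euclidean_space \<Rightarrow> real) set"
  where "L2 = {h \<in> borel_measurable lborel. integrable lborel (\<lambda>x. (h x)\<^sup>2)}"

text \<open>The set \<open>(m\<^sup>2 - \<Delta>)\<^sup>\<beta> (1 + x\<^sup>2)\<^sup>\<alpha> L\<^sup>2\<close> of real tempered distributions.\<close>

definition weighted_bessel_image ::
    "real \<Rightarrow> real \<Rightarrow> real \<Rightarrow> (('a::euclidean_space \<Rightarrow> real) \<Rightarrow> real) set"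
  where "weighted_bessel_image m \<beta> \<alpha> = {\<phi> \<in> tempered_distributions.
    complexify \<phi> \<in> (\<lambda>h. dist_bessel m \<beta> (dist_mult (weight \<alpha>) (dist_of_fun h))) ` L2}"

section \<open>Gaussian measures\<close>

text \<open>For real \<open>g\<close> the function \<open>(m\<^sup>2 - \<Delta>)\<^sup>s g\<close> is real, its symbol being real and even;
  \<^const>\<open>Re\<close> only adjusts the type.\<close>

definition covariance :: "real \<Rightarrow> ('a::euclidean_space \<Rightarrow> real) \<Rightarrow> ('a \<Rightarrow> real) \<Rightarrow> real"
  where "covariance m f g =
    1/2 * (\<integral>x. f x * Re (fun_bessel m (-1/2) (\<lambda>y. of_real (g y)) x) \<partial>lborel)"

definition centered_gaussian_measure ::
    "(('a::euclidean_space \<Rightarrow> real) \<Rightarrow> ('a \<Rightarrow> real) \<Rightarrow> real) \<Rightarrow>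
     (('a \<Rightarrow> real) \<Rightarrow> real) measure \<Rightarrow> bool"
  where "centered_gaussian_measure C \<mu> \<longleftrightarrow>
    prob_space \<mu> \<and> space \<mu> = tempered_distributions \<and> sets \<mu> = sets tempered_algebra \<and>
    (\<forall>f\<in>schwartz. (\<integral>\<phi>. exp (\<i> * of_real (\<phi> f)) \<partial>\<mu>) = complex_of_real (exp (- (1/2) * C f f)))"

end

theory Submission
  imports Defs
begin

text \<open>
  For a Schwartz function \<open>g\<close> put \<open>A g = (m\<^sup>2 - \<Delta>)\<^bsup>-\<beta>\<^esup> (1 + x\<^sup>2)\<^bsup>-\<alpha>\<^esup> g\<close>.  The variance of
  \<open>\<phi> (A g)\<close> is \<open>1/2\<close> times the square of the \<open>L\<^sup>2\<close> norm of
  \<open>(m\<^sup>2 - \<Delta>)\<^bsup>-1/4-\<beta>\<^esup> (1 + x\<^sup>2)\<^bsup>-\<alpha>\<^esup> g\<close>, and this operator is Hilbert-Schmidt, because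
  \<open>1 + 4\<beta> > d\<close> and \<open>4\<alpha> > d\<close>.  Hence \<open>\<Sum>\<^sub>n (\<phi> (A e\<^sub>n))\<^sup>2\<close> has finite expectation for every \<open>L\<^sup>2\<close>-orthonormal
  sequence of Schwartz functions.  Take for \<open>e\<close> the Gram-Schmidt vectors of a countable set \<open>D\<close> of
  Schwartz functions which is dense in the graph topology of \<open>A\<close>: almost surely the series
  converges, the Riesz-Fischer theorem gives \<open>h \<in> L\<^sup>2\<close> with \<open>\<phi> (A g) = \<integral> h g\<close> for \<open>g \<in> D\<close>, and
  since each \<open>\<phi>\<close> is continuous this persists for all \<open>g\<close>.
\<close>

section \<open>Schwartz functions\<close>

text \<open>Formally \<open>h = (1+x^2)^(-\<alpha>) (m^2-\<Delta>)^(-\<beta>) \<phi>\<close>, and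
  \<open>A\<close> is the transpose of the operator applied to \<phi> here. So
  \<open>\<phi> (A g)\<close> is the pairing of \<open>h\<close> with \<open>g\<close>, and the sum
  over an orthonormal basis is the squared L2 norm of \<open>h\<close>. The obstacle is that a
  statement about \<open>\<phi> (A g)\<close> holds outside a null set that may depend on
  \<open>g\<close>, whereas one \<open>h\<close> has to serve all \<open>g\<close>. Countably many
  test functions remove this dependence if they determine every single \<phi>. The neighbourhoods
  witnessing the continuity of \<phi> vary with \<phi>, so \<open>D\<close> must approximate in
  every finite family of seminorms: at \<open>g\<close>, which carries the L2 pairing along, and at
  \<open>A g\<close>, which carries \<phi> along, by one and the same element. Extracting
  \<open>e\<close> from \<open>D\<close> keeps the vectors in the Schwartz space, where
  \<open>\<phi> (A e)\<close> makes sense, and makes them span \<open>D\<close>. The measure is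
  given by the characteristic functions of single evaluations, so the second moments have to be
  derived; they enter as upper bounds. Finally, Fourier inversion on the Schwartz space inverts
  \<open>A\<close>, and this turns the identity for \<open>\<phi> (A g)\<close> into membership of
  \<phi> in the image of L2.\<close>

lemma partial_deriv_append: "partial_deriv (bs @ cs) f = partial_deriv bs (partial_deriv cs f)"
  by (induction bs) simp_all

text \<open>A coinduction principle: a class that is closed under the basis derivatives and whose
  members all decay rapidly consists of Schwartz functions. Exhibiting such a class replaces every
  computation of iterated derivatives, for multipliers, bounded linear images and Fourier transforms
  alike.\<close>

lemma schwartz_family:
  fixes F :: "('a::euclidean_space \<Rightarrow> 'b::real_normed_vector) set"
  assumes "f \<in> F"
    and der: "\<And>f. f \<in> F \<Longrightarrow>
      \<exists>f'. (\<forall>x. (f has_derivative f' x) (at x)) \<and> (\<forall>b\<in>Basis. (\<lambda>x. f' x b) \<in> F)"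
    and bdd: "\<And>f k. f \<in> F \<Longrightarrow> \<exists>C. \<forall>x. norm x ^ k * norm (f x) \<le> C"
  shows "f \<in> schwartz"
proof -
  have *: "partial_deriv bs f \<in> F" if "bs \<in> lists Basis" for bs
    using that
  proof (induction bs)
    case Nil
    then show ?case using \<open>f \<in> F\<close> by simp
  next
    case (Cons b bs)
    then obtain f' where f': "\<And>x. (partial_deriv bs f has_derivative f' x) (at x)"
      "\<forall>b\<in>Basis. (\<lambda>x. f' x b) \<in> F"
      using der by (metis in_lists_conv_set list.set_intros(1) listsE)
    have "partial_deriv (b # bs) f = (\<lambda>x. f' x b)"
      using frechet_derivative_at[OF f'(1)] by (metis partial_deriv.simps(2))
    then show ?case using f'(2) Cons by auto
  qed
  have "smooth f"
    unfolding smooth_def using * der by (meson differentiable_def)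
  moreover have "bounded (range (\<lambda>x. norm x ^ k *\<^sub>R partial_deriv bs f x))"
    if "bs \<in> lists Basis" for k bs
    using bdd[OF *[OF that], of k] by (auto simp: bounded_iff)
  ultimately show ?thesis
    unfolding schwartz_def by blast
qed

lemma schwartz_has_derivative:
  "f \<in> schwartz \<Longrightarrow> (f has_derivative frechet_derivative f (at x)) (at x)"
  unfolding schwartz_def smooth_def
  using frechet_derivative_works by (metis (mono_tags, lifting) lists.Nil mem_Collect_eq partial_deriv.simps(1))

lemma schwartz_partial_deriv:
  assumes "f \<in> schwartz" "cs \<in> lists Basis"
  shows "partial_deriv cs f \<in> schwartz"
  using assms unfolding schwartz_def smooth_def
  by (auto simp flip: partial_deriv_append)

lemma schwartz_frechet_derivative:
  "f \<in> schwartz \<Longrightarrow> b \<in> Basis \<Longrightarrow> (\<lambda>x. frechet_derivative f (at x) b) \<in> schwartz"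
  using schwartz_partial_deriv[of f "[b]"] by simp

lemma schwartz_continuous: "f \<in> schwartz \<Longrightarrow> continuous_on S f"
  by (meson continuous_at_imp_continuous_on has_derivative_continuous schwartz_has_derivative)

lemma schwartz_measurable:
  fixes f :: "'a::euclidean_space \<Rightarrow> 'b::{real_normed_vector, second_countable_topology}"
  shows "f \<in> schwartz \<Longrightarrow> f \<in> borel_measurable borel"
  by (simp add: borel_measurable_continuous_onI schwartz_continuous)

lemma schwartz_bound_norm:
  assumes "f \<in> schwartz"
  shows "\<exists>C. \<forall>x. norm x ^ k * norm (f x) \<le> C"
proof -
  have "bounded (range (\<lambda>x. norm x ^ k *\<^sub>R partial_deriv [] f x))"
    using assms unfolding schwartz_def by blast
  then show ?thesis by (auto simp: bounded_iff)
qed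

lemma one_plus_power_le:
  fixes t :: real
  assumes "t \<ge> 0"
  shows "(1 + t) ^ n \<le> 2 ^ n * (1 + t ^ n)"
proof -
  have "(1 + t) ^ n \<le> (2 * max 1 t) ^ n"
    using assms by (intro power_mono) auto
  also have "\<dots> = 2 ^ n * max 1 t ^ n"
    by (simp add: power_mult_distrib)
  also have "max 1 t ^ n \<le> 1 + t ^ n"
    using assms by (auto simp: max_def)
  finally show ?thesis by simp
qed

lemma schwartz_bound:
  assumes "f \<in> schwartz"
  obtains C where "C > 0" "\<And>x. (1 + norm x) ^ n * norm (f x) \<le> C"
proof -
  obtain C0 where C0: "\<And>x. norm x ^ 0 * norm (f x) \<le> C0"
    using schwartz_bound_norm[OF assms] by blast
  obtain C1 where C1: "\<And>x. norm x ^ n * norm (f x) \<le> C1"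
    using schwartz_bound_norm[OF assms] by blast
  have "(1 + norm x) ^ n * norm (f x) \<le> 2 ^ n * (C0 + C1)" for x
  proof -
    have "(1 + norm x) ^ n * norm (f x) \<le> 2 ^ n * (1 + norm x ^ n) * norm (f x)"
      by (intro mult_right_mono one_plus_power_le) auto
    also have "\<dots> = 2 ^ n * (norm (f x) + norm x ^ n * norm (f x))"
      by (simp add: algebra_simps)
    also have "\<dots> \<le> 2 ^ n * (C0 + C1)"
      using C0[of x] C1[of x] by simp
    finally show ?thesis .
  qed
  then have "(1 + norm x) ^ n * norm (f x) \<le> max 1 (2 ^ n * (C0 + C1))" for x
    by (simp add: le_max_iff_disj)
  then show ?thesis using that[of "max 1 (2 ^ n * (C0 + C1))"] by auto
qed

text \<open>Multipliers of polynomial growth, generated just richly enough to be closed under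
  differentiation: the derivative of \<open>bessel_symbol m s\<close> in direction \<open>b\<close>
  is a constant times \<open>bessel_symbol m (s - 1)\<close> times the coordinate
  \<open>x \<bullet> b\<close>, and sums and products follow the Leibniz rule.\<close>

inductive_set moderate :: "('a::euclidean_space \<Rightarrow> real) set" where
  const: "(\<lambda>x. c) \<in> moderate"
| coord: "(\<lambda>x. x \<bullet> b) \<in> moderate"
| symbol: "m \<noteq> 0 \<Longrightarrow> bessel_symbol m s \<in> moderate"
| add: "f \<in> moderate \<Longrightarrow> g \<in> moderate \<Longrightarrow> (\<lambda>x. f x + g x) \<in> moderate"
| mult: "f \<in> moderate \<Longrightarrow> g \<in> moderate \<Longrightarrow> (\<lambda>x. f x * g x) \<in> moderate"

lemma symbol_base_pos: "m \<noteq> 0 \<Longrightarrow> m\<^sup>2 + (norm x)\<^sup>2 > (0::real)"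
  by (simp add: add_pos_nonneg)

lemma has_derivative_bessel_symbol:
  fixes x :: "'a::euclidean_space"
  assumes "m \<noteq> 0"
  shows "(bessel_symbol m s has_derivative
    (\<lambda>h. s * bessel_symbol m (s - 1) x * (2 * (x \<bullet> h)))) (at x)"
proof -
  have 1: "((\<lambda>x::'a. m\<^sup>2 + (norm x)\<^sup>2) has_derivative (\<lambda>h. 2 * (x \<bullet> h))) (at x)"
    unfolding power2_norm_eq_inner
    by (auto intro!: derivative_eq_intros simp: inner_commute)
  have 2: "((\<lambda>y. y powr s) has_field_derivative s * bessel_symbol m (s - 1) x)
      (at (m\<^sup>2 + (norm x)\<^sup>2))"
    unfolding bessel_symbol_def
    by (rule has_real_derivative_powr) (rule symbol_base_pos[OF assms])
  show ?thesis
    using DERIV_compose_FDERIV[OF 2 1]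
    by (simp add: bessel_symbol_def[abs_def] mult_ac)
qed

lemma moderate_derivative:
  assumes "a \<in> moderate"
  shows "\<exists>a'. (\<forall>x. (a has_derivative a' x) (at x)) \<and> (\<forall>b\<in>Basis. (\<lambda>x. a' x b) \<in> moderate)"
  using assms
proof induction
  case (const c)
  then show ?case
    by (intro exI[of _ "\<lambda>x h. 0"]) (auto intro: moderate.const)
next
  case (coord b)
  then show ?case
    by (intro exI[of _ "\<lambda>x h. h \<bullet> b"]) (auto intro!: moderate.const derivative_eq_intros)
next
  case (symbol m s)
  then show ?case
    by (intro exI[of _ "\<lambda>x h. s * bessel_symbol m (s - 1) x * (2 * (x \<bullet> h))"] conjI allI ballI
        has_derivative_bessel_symbol moderate.mult moderate.symbol moderate.const moderate.coord)
next
  case (add f g)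
  then obtain f' g' where *: "\<forall>x. (f has_derivative f' x) (at x)" "\<forall>b\<in>Basis. (\<lambda>x. f' x b) \<in> moderate"
    "\<forall>x. (g has_derivative g' x) (at x)" "\<forall>b\<in>Basis. (\<lambda>x. g' x b) \<in> moderate" by blast
  show ?case
    using * by (intro exI[of _ "\<lambda>x h. f' x h + g' x h"]) (auto intro!: moderate.add has_derivative_add)
next
  case (mult f g)
  then obtain f' g' where *: "\<forall>x. (f has_derivative f' x) (at x)" "\<forall>b\<in>Basis. (\<lambda>x. f' x b) \<in> moderate"
    "\<forall>x. (g has_derivative g' x) (at x)" "\<forall>b\<in>Basis. (\<lambda>x. g' x b) \<in> moderate" by blast
  show ?case
    using * mult.hyps
    by (intro exI[of _ "\<lambda>x h. f x * g' x h + f' x h * g x"])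
      (auto intro!: moderate.add moderate.mult has_derivative_mult)
qed

text \<open>For \<open>s \<ge> 0\<close> the base is at most the square of
  \<open>(\<bar>m\<bar> + 1) * (1 + norm x)\<close>, and the real exponent is rounded up to a
  natural number. For \<open>s < 0\<close> the symbol is largest at the origin, where
  \<open>m \<noteq> 0\<close> keeps it finite.\<close>

lemma bessel_symbol_growth:
  assumes "m \<noteq> 0"
  shows "\<exists>C n. \<forall>x::'a::euclidean_space. \<bar>bessel_symbol m s x\<bar> \<le> C * (1 + norm x) ^ n"
proof (cases "s \<ge> 0")
  case True
  obtain n :: nat where n: "2 * s \<le> n" by (meson real_arch_simple)
  have "\<bar>bessel_symbol m s x\<bar> \<le> ((\<bar>m\<bar> + 1) powr (2 * s)) * (1 + norm x) ^ n" for x :: 'a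
  proof -
    have "m\<^sup>2 + (norm x)\<^sup>2 \<le> ((\<bar>m\<bar> + 1) * (1 + norm x))\<^sup>2"
    proof -
      have "m\<^sup>2 + (norm x)\<^sup>2 = \<bar>m\<bar>\<^sup>2 + (norm x)\<^sup>2" by simp
      also have "\<dots> \<le> (\<bar>m\<bar> + norm x)\<^sup>2" by (simp add: power2_sum)
      also have "\<dots> \<le> ((\<bar>m\<bar> + 1) * (1 + norm x))\<^sup>2"
        by (intro power_mono) (auto simp: algebra_simps)
      finally show ?thesis .
    qed
    then have "\<bar>bessel_symbol m s x\<bar> \<le> (((\<bar>m\<bar> + 1) * (1 + norm x))\<^sup>2) powr s"
      unfolding bessel_symbol_def using True by (auto intro!: powr_mono2)
    also have "\<dots> = ((\<bar>m\<bar> + 1) * (1 + norm x)) powr (2 * s)"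
    proof -
      have sq: "(y\<^sup>2) powr s = y powr (2 * s)" if "y > 0" for y :: real
        using powr_powr[of y 2 s] that by simp
      show ?thesis by (rule sq) (intro mult_pos_pos add_nonneg_pos add_pos_nonneg; simp)
    qed
    also have "\<dots> = (\<bar>m\<bar> + 1) powr (2 * s) * (1 + norm x) powr (2 * s)"
      by (simp add: powr_mult)
    also have "(1 + norm x) powr (2 * s) \<le> (1 + norm x) powr n"
      using n by (intro powr_mono) auto
    also have "(1 + norm x) powr n = (1 + norm x) ^ n"
      by (simp add: powr_realpow add_pos_nonneg)
    finally show ?thesis by (simp add: mult_left_mono)
  qed
  then show ?thesis by blast
next
  case False
  have "\<bar>bessel_symbol m s x\<bar> \<le> (m\<^sup>2) powr s * (1 + norm x) ^ 0" for x :: 'a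
    using False assms unfolding bessel_symbol_def by (auto intro!: powr_mono2')
  then show ?thesis by blast
qed

lemma moderate_growth:
  assumes "a \<in> moderate"
  shows "\<exists>C n. \<forall>x. \<bar>a x\<bar> \<le> C * (1 + norm x) ^ n"
  using assms
proof induction
  case (const c)
  show ?case by (intro exI[of _ "\<bar>c\<bar>"] exI[of _ 0]) simp
next
  case (coord b)
  have "\<bar>x \<bullet> b\<bar> \<le> norm b * (1 + norm x) ^ 1" for x
    using Cauchy_Schwarz_ineq2[of x b] by (simp add: algebra_simps add_increasing)
  then show ?case by blast
next
  case (symbol m s)
  then show ?case using bessel_symbol_growth by blast
next
  case (add f g)
  then obtain C n D k where *: "\<And>x. \<bar>f x\<bar> \<le> C * (1 + norm x) ^ n" "\<And>x. \<bar>g x\<bar> \<le> D * (1 + norm x) ^ k"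
    by blast
  have C: "C \<ge> 0" "D \<ge> 0" using *(1)[of 0] *(2)[of 0] by auto
  have "\<bar>f x + g x\<bar> \<le> (C + D) * (1 + norm x) ^ (n + k)" for x
  proof -
    have "\<bar>f x + g x\<bar> \<le> C * (1 + norm x) ^ n + D * (1 + norm x) ^ k"
      using *[of x] by linarith
    also have "\<dots> \<le> C * (1 + norm x) ^ (n + k) + D * (1 + norm x) ^ (n + k)"
      using C by (intro add_mono mult_left_mono power_increasing) auto
    finally show ?thesis by (simp add: algebra_simps)
  qed
  then show ?case by blast
next
  case (mult f g)
  then obtain C n D k where *: "\<And>x. \<bar>f x\<bar> \<le> C * (1 + norm x) ^ n" "\<And>x. \<bar>g x\<bar> \<le> D * (1 + norm x) ^ k"
    by blast
  have "\<bar>f x * g x\<bar> \<le> (C * D) * (1 + norm x) ^ (n + k)" for x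
    using mult_mono'[OF *[of x]] by (simp add: abs_mult power_add mult_ac)
  then show ?case by blast
qed

text \<open>Single products are not closed under differentiation, since the Leibniz rule yields two
  terms; closing under sums gives a class to which \<open>schwartz_family\<close> applies.\<close>

inductive_set moderate_schwartz :: "('a::euclidean_space \<Rightarrow> 'b::real_normed_vector) set" where
  prod: "a \<in> moderate \<Longrightarrow> f \<in> schwartz \<Longrightarrow> (\<lambda>x. a x *\<^sub>R f x) \<in> moderate_schwartz"
| add: "f \<in> moderate_schwartz \<Longrightarrow> g \<in> moderate_schwartz \<Longrightarrow> (\<lambda>x. f x + g x) \<in> moderate_schwartz"

lemma moderate_schwartz_subset:
  assumes "f \<in> moderate_schwartz"
  shows "f \<in> schwartz"
proof (rule schwartz_family[OF assms])
  fix f :: "'a \<Rightarrow> 'b"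
  assume "f \<in> moderate_schwartz"
  then show "\<exists>f'. (\<forall>x. (f has_derivative f' x) (at x)) \<and> (\<forall>b\<in>Basis. (\<lambda>x. f' x b) \<in> moderate_schwartz)"
  proof induction
    case (prod a f)
    obtain a' where a': "\<forall>x. (a has_derivative a' x) (at x)" "\<forall>b\<in>Basis. (\<lambda>x. a' x b) \<in> moderate"
      using moderate_derivative[OF prod(1)] by blast
    let ?f' = "\<lambda>x. frechet_derivative f (at x)"
    have "(\<lambda>x. a x *\<^sub>R ?f' x b + a' x b *\<^sub>R f x) \<in> moderate_schwartz" if "b \<in> Basis" for b
      using a' that prod by (intro moderate_schwartz.intros schwartz_frechet_derivative) auto
    moreover have "((\<lambda>x. a x *\<^sub>R f x) has_derivative (\<lambda>b. a x *\<^sub>R ?f' x b + a' x b *\<^sub>R f x)) (at x)" for x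
      using a' schwartz_has_derivative[OF prod(2)] by (intro has_derivative_scaleR) auto
    ultimately show ?case
      by (intro exI[of _ "\<lambda>x b. a x *\<^sub>R ?f' x b + a' x b *\<^sub>R f x"]) blast
  next
    case (add f g)
    then obtain f' g' where *: "\<forall>x. (f has_derivative f' x) (at x)" "\<forall>b\<in>Basis. (\<lambda>x. f' x b) \<in> moderate_schwartz"
      "\<forall>x. (g has_derivative g' x) (at x)" "\<forall>b\<in>Basis. (\<lambda>x. g' x b) \<in> moderate_schwartz" by blast
    show ?case
      using * by (intro exI[of _ "\<lambda>x h. f' x h + g' x h"])
        (auto intro!: moderate_schwartz.add has_derivative_add)
  qed
next
  fix f :: "'a \<Rightarrow> 'b" and k
  assume "f \<in> moderate_schwartz"
  then show "\<exists>C. \<forall>x. norm x ^ k * norm (f x) \<le> C"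
  proof induction
    case (prod a f)
    obtain C n where C: "\<And>x. \<bar>a x\<bar> \<le> C * (1 + norm x) ^ n"
      using moderate_growth[OF prod(1)] by blast
    \<comment> \<open>Of the \<open>k + n\<close> powers, \<open>n\<close> absorb the growth of the
      multiplier and \<open>k\<close> are left for the decay to be shown.\<close>
    obtain D where D: "\<And>x. (1 + norm x) ^ (k + n) * norm (f x) \<le> D"
      using schwartz_bound[OF prod(2)] by metis
    have "\<bar>a 0\<bar> \<le> C * (1 + norm (0::'a)) ^ n" by (rule C)
    then have C0: "C \<ge> 0" by simp
    have "norm x ^ k * norm (a x *\<^sub>R f x) \<le> C * D" for x
    proof -
      have "norm x ^ k * norm (a x *\<^sub>R f x) \<le> (1 + norm x) ^ k * (C * (1 + norm x) ^ n * norm (f x))"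
        using C[of x] C0 by (auto intro!: mult_mono power_mono mult_nonneg_nonneg)
      also have "\<dots> = C * ((1 + norm x) ^ (k + n) * norm (f x))"
        by (simp add: power_add)
      also have "\<dots> \<le> C * D"
        using C0 D by (intro mult_left_mono) auto
      finally show ?thesis .
    qed
    then show ?case by blast
  next
    case (add f g)
    then obtain C D where *: "\<And>x. norm x ^ k * norm (f x) \<le> C" "\<And>x. norm x ^ k * norm (g x) \<le> D"
      by blast
    have "norm x ^ k * norm (f x + g x) \<le> C + D" for x
    proof -
      have "norm x ^ k * norm (f x + g x) \<le> norm x ^ k * (norm (f x) + norm (g x))"
        by (intro mult_left_mono norm_triangle_ineq) auto
      also have "\<dots> \<le> C + D" using *[of x] by (simp add: algebra_simps)
      finally show ?thesis .
    qed
    then show ?case by blast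
  qed
qed

section \<open>Closure properties of the Schwartz space\<close>

lemma schwartz_moderate_scaleR:
  "a \<in> moderate \<Longrightarrow> f \<in> schwartz \<Longrightarrow> (\<lambda>x. a x *\<^sub>R f x) \<in> schwartz"
  by (rule moderate_schwartz_subset) (rule moderate_schwartz.prod)

lemma schwartz_scaleR: "f \<in> schwartz \<Longrightarrow> (\<lambda>x. c *\<^sub>R f x) \<in> schwartz"
  by (intro schwartz_moderate_scaleR moderate.const)

lemma schwartz_add:
  assumes "f \<in> schwartz" "g \<in> schwartz"
  shows "(\<lambda>x. f x + g x) \<in> schwartz"
proof -
  have "(\<lambda>x. 1 *\<^sub>R f x + 1 *\<^sub>R g x) \<in> schwartz"
    by (rule moderate_schwartz_subset) (intro moderate_schwartz.intros moderate.const assms)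
  then show ?thesis by simp
qed

lemma schwartz_diff:
  assumes "f \<in> schwartz" "g \<in> schwartz"
  shows "(\<lambda>x. f x - g x) \<in> schwartz"
  using schwartz_add[OF assms(1) schwartz_scaleR[OF assms(2), of "-1"]] by simp

lemma schwartz_zero: "(\<lambda>x. 0) \<in> schwartz"
  by (rule schwartz_family[where F = "{\<lambda>x. 0}"])
    (auto intro!: exI[of _ "\<lambda>x h. 0"] exI[of _ 0])

lemma schwartz_mult_real:
  fixes f :: "'a::euclidean_space \<Rightarrow> real"
  shows "f \<in> schwartz \<Longrightarrow> (\<lambda>x. c * f x) \<in> schwartz"
  using schwartz_scaleR[of f c] by simp

lemma schwartz_sum:
  "finite I \<Longrightarrow> (\<And>i. i \<in> I \<Longrightarrow> f i \<in> schwartz) \<Longrightarrow> (\<lambda>x. \<Sum>i\<in>I. f i x) \<in> schwartz"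
  by (induction rule: finite_induct) (auto intro: schwartz_zero schwartz_add)

lemma schwartz_bounded_linear:
  assumes L: "bounded_linear L" and f: "f \<in> schwartz"
  shows "(\<lambda>x. L (f x)) \<in> schwartz"
proof (rule schwartz_family[where F = "(\<lambda>f x. L (f x)) ` schwartz"])
  show "(\<lambda>x. L (f x)) \<in> (\<lambda>f x. L (f x)) ` schwartz" using f by blast
next
  fix g assume "g \<in> (\<lambda>f x. L (f x)) ` schwartz"
  then obtain f where g: "g = (\<lambda>x. L (f x))" and f: "f \<in> schwartz" by blast
  show "\<exists>f'. (\<forall>x. (g has_derivative f' x) (at x)) \<and> (\<forall>b\<in>Basis. (\<lambda>x. f' x b) \<in> (\<lambda>f x. L (f x)) ` schwartz)"
  proof (intro exI[of _ "\<lambda>x h. L (frechet_derivative f (at x) h)"] conjI allI ballI)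
    show "(g has_derivative (\<lambda>h. L (frechet_derivative f (at x) h))) (at x)" for x
      unfolding g by (rule bounded_linear.has_derivative[OF L schwartz_has_derivative[OF f]])
    show "(\<lambda>x. L (frechet_derivative f (at x) b)) \<in> (\<lambda>f x. L (f x)) ` schwartz" if "b \<in> Basis" for b
      by (rule image_eqI[where x = "\<lambda>x. frechet_derivative f (at x) b"])
        (simp_all add: schwartz_frechet_derivative[OF f that])
  qed
  fix k
  obtain K where K: "\<And>y. norm (L y) \<le> norm y * K" "K > 0"
    using bounded_linear.pos_bounded[OF L] by blast
  obtain C where C: "\<And>x. norm x ^ k * norm (f x) \<le> C"
    using schwartz_bound_norm[OF f] by blast
  have "norm x ^ k * norm (L (f x)) \<le> C * K" for x
  proof -
    have "norm x ^ k * norm (L (f x)) \<le> norm x ^ k * (norm (f x) * K)"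
      using K by (intro mult_left_mono) auto
    also have "\<dots> \<le> C * K" using C[of x] K(2) by (simp flip: mult.assoc)
    finally show ?thesis .
  qed
  then show "\<exists>C. \<forall>x. norm x ^ k * norm (g x) \<le> C" unfolding g by blast
qed

lemma schwartz_Re: "f \<in> schwartz \<Longrightarrow> (\<lambda>x. Re (f x)) \<in> schwartz"
  by (rule schwartz_bounded_linear[OF bounded_linear_Re])

lemma schwartz_Im: "f \<in> schwartz \<Longrightarrow> (\<lambda>x. Im (f x)) \<in> schwartz"
  by (rule schwartz_bounded_linear[OF bounded_linear_Im])

lemma schwartz_cnj: "f \<in> schwartz \<Longrightarrow> (\<lambda>x. cnj (f x)) \<in> schwartz"
  by (rule schwartz_bounded_linear[OF bounded_linear_cnj])

lemma schwartz_of_real: "f \<in> schwartz \<Longrightarrow> (\<lambda>x. complex_of_real (f x)) \<in> schwartz"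
  by (rule schwartz_bounded_linear[OF bounded_linear_of_real])

lemma schwartz_mult_complex:
  fixes f :: "'a::euclidean_space \<Rightarrow> complex"
  shows "f \<in> schwartz \<Longrightarrow> (\<lambda>x. c * f x) \<in> schwartz"
  by (rule schwartz_bounded_linear[OF bounded_linear_mult_right])

lemma schwartz_moderate_mult:
  "a \<in> moderate \<Longrightarrow> f \<in> schwartz \<Longrightarrow> (\<lambda>x. complex_of_real (a x) * f x) \<in> schwartz"
  using schwartz_moderate_scaleR[of a f] by (simp add: scaleR_conv_of_real)

lemma schwartz_bessel_symbol:
  "m \<noteq> 0 \<Longrightarrow> f \<in> schwartz \<Longrightarrow> (\<lambda>x. complex_of_real (bessel_symbol m s x) * f x) \<in> schwartz"
  by (intro schwartz_moderate_mult moderate.symbol)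

text \<open>The position weight is the frequency symbol of mass 1, so smoothness, growth and the
  exponent law are proved once for both.\<close>

lemma weight_eq_bessel_symbol: "weight s = bessel_symbol 1 s"
  by (simp add: weight_def bessel_symbol_def fun_eq_iff)

lemma schwartz_weight: "f \<in> schwartz \<Longrightarrow> (\<lambda>x. complex_of_real (weight s x) * f x) \<in> schwartz"
  unfolding weight_eq_bessel_symbol by (rule schwartz_bessel_symbol) simp

lemma bessel_symbol_measurable: "bessel_symbol m s \<in> borel_measurable borel"
  unfolding bessel_symbol_def[abs_def] by measurable

lemma weight_measurable: "weight s \<in> borel_measurable borel"
  unfolding weight_eq_bessel_symbol by (rule bessel_symbol_measurable)

subsection \<open>Integrability\<close>

text \<open>Dyadic decomposition: on the shell between radii \<open>2^(k-1)\<close> and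
  \<open>2^k\<close> the weight is at most \<open>c k\<close>, while the ball of radius
  \<open>2^k\<close> has volume proportional to \<open>2^(d*k)\<close>. The products form a
  geometric series of ratio \<open>2 powr (d - 2*s)\<close>, which is below 1 exactly for
  \<open>s > d/2\<close>.\<close>

lemma nn_integral_weight_finite:
  assumes s: "s > real DIM('a::euclidean_space) / 2"
  shows "(\<integral>\<^sup>+(x::'a). ennreal (weight (- s) x) \<partial>lborel) < \<infinity>"
proof -
  define d where "d = real DIM('a)"
  define c where "c k = 4 powr s * 4 powr (- s * real k)" for k
  have s0: "s > 0" using s DIM_positive[where 'a='a]
    by (smt (verit) divide_nonneg_nonneg of_nat_0_le_iff)
  have le: "ennreal (weight (- s) x) \<le> (\<Sum>k. ennreal (c k) * indicator (ball 0 (2 ^ k)) x)" for x :: 'a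
  proof -
    obtain k0 :: nat where "norm x < 2 ^ k0"
      using real_arch_pow[of 2 "norm x"] by auto
    \<comment> \<open>Minimality of \<open>k\<close> supplies the lower bound
      \<open>2^(k-1) \<le> norm x\<close>, which makes the weight small.\<close>
    define k where "k = (LEAST k. norm x < 2 ^ k)"
    have k: "norm x < 2 ^ k"
      unfolding k_def by (rule LeastI[of "\<lambda>k. norm x < 2 ^ k"]) fact
    have "weight (- s) x \<le> c k"
    proof (cases k)
      case 0
      have "weight (- s) x \<le> 1 powr (- s)"
        unfolding weight_def using s0 by (intro powr_mono2') auto
      also have "\<dots> \<le> 4 powr s" using s0 by (simp add: ge_one_powr_ge_zero)
      finally show ?thesis by (simp add: c_def 0)
    next
      case (Suc j)
      have "\<not> norm x < 2 ^ j"
        using not_less_Least[of j "\<lambda>k. norm x < 2 ^ k"] Suc k_def by auto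
      then have "(2 ^ j)\<^sup>2 \<le> (norm x)\<^sup>2" by (intro power_mono) auto
      then have "4 ^ j \<le> 1 + (norm x)\<^sup>2"
        by (simp add: power2_eq_square flip: power_mult_distrib)
      then have "weight (- s) x \<le> (4 ^ j) powr (- s)"
        unfolding weight_def using s0 by (intro powr_mono2') auto
      also have "\<dots> = c k"
      proof -
        have "((4::real) ^ j) powr (- s) = (4 powr j) powr (- s)" by (subst powr_realpow) auto
        also have "\<dots> = 4 powr (j * (- s))" by (simp only: powr_powr)
        also have "j * (- s) = s + - s * real (Suc j)" by (simp add: algebra_simps)
        finally show ?thesis unfolding c_def Suc by (simp only: powr_add)
      qed
      finally show ?thesis .
    qed
    then have "ennreal (weight (- s) x) \<le> ennreal (c k) * indicator (ball 0 (2 ^ k)) x"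
      using k by (simp add: ennreal_leI)
    also have "\<dots> = sum (\<lambda>i. ennreal (c i) * indicator (ball 0 (2 ^ i)) x) {k}"
      by (subst sum.insert) (simp_all only: finite.emptyI empty_iff not_False_eq_True sum.empty add_0_right)
    also have "\<dots> \<le> (\<Sum>k. ennreal (c k) * indicator (ball 0 (2 ^ k)) x)"
      by (rule sum_le_suminf) auto
    finally show ?thesis .
  qed
  have "(\<integral>\<^sup>+(x::'a). ennreal (weight (- s) x) \<partial>lborel)
      \<le> (\<integral>\<^sup>+(x::'a). (\<Sum>k. ennreal (c k) * indicator (ball 0 (2 ^ k)) x) \<partial>lborel)"
    by (intro nn_integral_mono le)
  also have "\<dots> = (\<Sum>k. ennreal (c k) * emeasure lborel (ball (0::'a) (2 ^ k)))"
  proof -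
    have "(\<lambda>x. ennreal (c i) * indicator (ball (0::'a) (2 ^ i)) x) \<in> borel_measurable lborel" for i
      by (intro borel_measurable_times_ennreal borel_measurable_indicator) auto
    then show ?thesis
      by (subst nn_integral_suminf) (auto simp: nn_integral_cmult_indicator)
  qed
  also have "\<dots> = (\<Sum>k. ennreal (4 powr s * unit_ball_vol d * (2 powr (d - 2 * s)) ^ k))"
  proof (rule suminf_cong)
    fix k
    have "c k * (unit_ball_vol d * (2 ^ k) ^ DIM('a)) = 4 powr s * unit_ball_vol d * (2 powr (d - 2 * s)) ^ k"
    proof -
      have "(4::real) powr (- s * real k) = (2 powr 2) powr (- s * real k)" by simp
      also have "\<dots> = 2 powr (2 * (- s * real k))" by (simp only: powr_powr)
      finally have 1: "(4::real) powr (- s * real k) = 2 powr (2 * (- s * real k))" .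
      have 2: "((2::real) ^ k) ^ DIM('a) = 2 powr (d * real k)"
        by (simp add: d_def powr_realpow[symmetric] powr_powr mult_ac)
      have 3: "((2::real) powr (d - 2 * s)) ^ k = 2 powr ((d - 2 * s) * real k)"
        by (simp add: powr_realpow[symmetric] powr_powr)
      have "(2::real) powr (2 * (- s * real k)) * 2 powr (d * real k) = 2 powr ((d - 2 * s) * real k)"
        by (simp add: powr_add[symmetric] algebra_simps)
      then show ?thesis unfolding c_def 1 2 3 by (simp add: mult_ac)
    qed
    then show "ennreal (c k) * emeasure lborel (ball (0::'a) (2 ^ k))
        = ennreal (4 powr s * unit_ball_vol d * (2 powr (d - 2 * s)) ^ k)"
      by (subst emeasure_ball) (auto simp: d_def c_def simp flip: ennreal_mult)
  qed
  also have "\<dots> < \<infinity>"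
  proof -
    have "2 powr (d - 2 * s) < (1::real)"
      using s by (simp add: d_def powr_less_one)
    then have "summable (\<lambda>k. 4 powr s * unit_ball_vol d * (2 powr (d - 2 * s)) ^ k)"
      by (intro summable_mult summable_geometric) auto
    then show ?thesis
      by (subst suminf_ennreal2) (auto simp: d_def)
  qed
  finally show ?thesis .
qed

lemma integrable_weight:
  assumes s: "s > real DIM('a::euclidean_space) / 2"
  shows "integrable lborel (weight (- s) :: 'a \<Rightarrow> real)"
proof (rule integrableI_nonneg)
  show "(\<integral>\<^sup>+(x::'a). ennreal (weight (- s) x) \<partial>lborel) < \<infinity>"
    by (rule nn_integral_weight_finite[OF s])
qed (auto simp: weight_measurable weight_def)

text \<open>Puts rapid decay into the form of the majorants used under integrals:
  \<open>weight (- real n)\<close> is integrable as soon as \<open>n > d/2\<close>, and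
  \<open>n = d\<close> is always enough.\<close>

lemma schwartz_weight_bound:
  fixes f :: "'a::euclidean_space \<Rightarrow> 'b::real_normed_vector"
  assumes "f \<in> schwartz"
  obtains C where "C > 0" "\<And>x. norm (f x) \<le> C * weight (- real n) x"
proof -
  obtain C where C: "C > 0" "\<And>x. (1 + norm x) ^ (2 * n) * norm (f x) \<le> C"
    using schwartz_bound[OF assms] by metis
  have "norm (f x) \<le> C * weight (- real n) x" for x
  proof -
    have pos: "0 < (1 + (norm x)\<^sup>2) ^ n" by (simp add: add_pos_nonneg)
    have "1 + (norm x)\<^sup>2 \<le> (1 + norm x)\<^sup>2" by (simp add: power2_sum)
    then have "(1 + (norm x)\<^sup>2) ^ n \<le> ((1 + norm x)\<^sup>2) ^ n" by (intro power_mono) auto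
    then have "(1 + (norm x)\<^sup>2) ^ n * norm (f x) \<le> (1 + norm x) ^ (2 * n) * norm (f x)"
      by (intro mult_right_mono) (auto simp: power_mult)
    then have "(1 + (norm x)\<^sup>2) ^ n * norm (f x) \<le> C" using C(2)[of x] by linarith
    then have "norm (f x) \<le> C / (1 + (norm x)\<^sup>2) ^ n"
      using pos by (simp add: field_simps)
    also have "\<dots> = C * weight (- real n) x"
      unfolding weight_def by (simp add: powr_minus powr_realpow add_pos_nonneg divide_inverse)
    finally show ?thesis .
  qed
  then show ?thesis using that C(1) by blast
qed

lemma schwartz_integrable:
  fixes f :: "'a::euclidean_space \<Rightarrow> 'b::{banach, second_countable_topology}"
  assumes "f \<in> schwartz"
  shows "integrable lborel f"
proof -
  obtain C where C: "C > 0" "\<And>x. norm (f x) \<le> C * weight (- real DIM('a)) x"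
    using schwartz_weight_bound[OF assms] by metis
  have "integrable lborel (\<lambda>x::'a. C * weight (- real DIM('a)) x)"
    by (intro integrable_mult_right integrable_weight) auto
  then show ?thesis
    by (rule Bochner_Integration.integrable_bound)
      (use C schwartz_measurable[OF assms] in \<open>auto intro!: order_trans[OF C(2) abs_ge_self]\<close>)
qed

subsection \<open>Gradient bounds\<close>

lemma weight_pos: "weight s x > 0"
  unfolding weight_def using add_pos_nonneg[of 1 "(norm x)\<^sup>2"] by simp

lemma weight_neg_le_one: "s \<ge> 0 \<Longrightarrow> weight (- s) x \<le> 1"
  unfolding weight_def using powr_mono2'[of "- s" 1 "1 + (norm x)\<^sup>2"] by simp

text \<open>A local form of Peetre's inequality: at distance at most 1 one has
  \<open>1 + |x|^2 \<le> 3 * (1 + |y|^2)\<close>, so weights at neighbouring points are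
  comparable.\<close>

lemma weight_shift:
  assumes "norm (y - x) \<le> 1"
  shows "weight (- real n) y \<le> 3 ^ n * weight (- real n) x"
proof -
  have "norm x \<le> norm y + 1" using assms norm_triangle_ineq3[of x y] norm_minus_commute[of x y] by linarith
  then have "(norm x)\<^sup>2 \<le> (norm y + 1)\<^sup>2" by (intro power_mono) auto
  also have "\<dots> \<le> 2 * (norm y)\<^sup>2 + 2"
    using zero_le_power2[of "norm y - 1"] by (simp add: power2_sum power2_diff)
  finally have "(norm x)\<^sup>2 \<le> 2 * (norm y)\<^sup>2 + 2" .
  then have "1 + (norm x)\<^sup>2 \<le> 3 * (1 + (norm y)\<^sup>2)"
  proof -
    have "1 + a \<le> 3 * (1 + b)" if "a \<le> 2 * b + 2" "0 \<le> b" for a b :: real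
      using that unfolding distrib_left by linarith
    then show ?thesis using \<open>(norm x)\<^sup>2 \<le> 2 * (norm y)\<^sup>2 + 2\<close> zero_le_power2 by blast
  qed
  then have "(1 + (norm x)\<^sup>2) ^ n \<le> 3 ^ n * (1 + (norm y)\<^sup>2) ^ n"
    by (metis add_nonneg_nonneg power_mono power_mult_distrib zero_le_one zero_le_power2)
  moreover have "(1 + (norm x)\<^sup>2) ^ n > 0" "(1 + (norm y)\<^sup>2) ^ n > 0" by (simp_all add: add_pos_nonneg)
  ultimately have "1 / (1 + (norm y)\<^sup>2) ^ n \<le> 3 ^ n * (1 / (1 + (norm x)\<^sup>2) ^ n)"
    by (simp add: field_simps)
  then show ?thesis
    unfolding weight_def by (simp add: powr_minus powr_realpow add_pos_nonneg divide_inverse)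
qed

lemma schwartz_gradient_bound:
  fixes f :: "'a::euclidean_space \<Rightarrow> 'b::real_normed_vector"
  assumes f: "f \<in> schwartz"
  obtains C where "C > 0"
    "\<And>x h. norm (frechet_derivative f (at x) h) \<le> C * weight (- real n) x * norm h"
proof -
  have "\<forall>b\<in>Basis. \<exists>C>0. \<forall>x. norm (frechet_derivative f (at x) b) \<le> C * weight (- real n) x"
    using schwartz_weight_bound[OF schwartz_frechet_derivative[OF f]] by metis
  then obtain C where C: "\<And>b. b \<in> Basis \<Longrightarrow> C b > 0"
    "\<And>b x. b \<in> Basis \<Longrightarrow> norm (frechet_derivative f (at x) b) \<le> C b * weight (- real n) x"
    by metis
  have "norm (frechet_derivative f (at x) h) \<le> (\<Sum>b\<in>Basis. C b) * weight (- real n) x * norm h" for x h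
  proof -
    have lin: "linear (frechet_derivative f (at x))"
      using schwartz_has_derivative[OF f] has_derivative_linear by blast
    have "frechet_derivative f (at x) h = frechet_derivative f (at x) (\<Sum>b\<in>Basis. (h \<bullet> b) *\<^sub>R b)"
      by (simp add: euclidean_representation)
    also have "\<dots> = (\<Sum>b\<in>Basis. (h \<bullet> b) *\<^sub>R frechet_derivative f (at x) b)"
      by (simp add: linear_sum[OF lin] linear_cmul[OF lin])
    also have "norm \<dots> \<le> (\<Sum>b\<in>Basis. norm h * (C b * weight (- real n) x))"
      by (intro sum_norm_le) (auto intro!: mult_mono C(2) Basis_le_norm)
    finally show ?thesis by (simp add: sum_distrib_left sum_distrib_right mult_ac)
  qed
  moreover have "(\<Sum>b\<in>Basis. C b) > 0" by (intro sum_pos C) auto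
  ultimately show ?thesis using that by blast
qed

text \<open>Mean value inequality with the gradient bound of weight exponent 0. The global Lipschitz
  constant gives the equicontinuity needed for the countable covers below.\<close>

lemma schwartz_lipschitz:
  fixes f :: "'a::euclidean_space \<Rightarrow> 'b::real_normed_vector"
  assumes f: "f \<in> schwartz"
  obtains C where "C > 0" "\<And>x y. norm (f x - f y) \<le> C * norm (x - y)"
proof -
  obtain C where C: "C > 0"
    "\<And>x h. norm (frechet_derivative f (at x) h) \<le> C * weight (- real 0) x * norm h"
    using schwartz_gradient_bound[OF f] by blast
  have "onorm (frechet_derivative f (at x)) \<le> C" for x
  proof (rule onorm_le)
    fix h
    have "norm (frechet_derivative f (at x) h) \<le> C * weight (- real 0) x * norm h" by (rule C)
    also have "\<dots> \<le> C * 1 * norm h"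
      using C(1) by (intro mult_right_mono mult_left_mono weight_neg_le_one) auto
    finally show "norm (frechet_derivative f (at x) h) \<le> C * norm h" by simp
  qed
  then have "norm (f x - f y) \<le> C * norm (x - y)" for x y
    using schwartz_has_derivative[OF f]
    by (intro differentiable_bound[of UNIV f "\<lambda>x. frechet_derivative f (at x)"]) auto
  then show ?thesis using that C(1) by blast
qed

text \<open>The mean value inequality on the unit ball around \<open>x\<close>, with
  \<open>weight_shift\<close> moving the gradient bound back to the centre. Divided by
  \<open>norm h\<close>, the right-hand side is an integrable majorant for all small difference
  quotients at once.\<close>

lemma schwartz_increment_bound:
  fixes f :: "'a::euclidean_space \<Rightarrow> 'b::real_normed_vector"
  assumes f: "f \<in> schwartz"
  obtains C where "C > 0"
    "\<And>x h. norm h \<le> 1 \<Longrightarrow> norm (f (x + h) - f x) \<le> norm h * (C * weight (- real n) x)"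
proof -
  obtain C where C: "C > 0"
    "\<And>x h. norm (frechet_derivative f (at x) h) \<le> C * weight (- real n) x * norm h"
    using schwartz_gradient_bound[OF f] by blast
  have "norm (f (x + h) - f x) \<le> norm h * ((C * 3 ^ n) * weight (- real n) x)" if h: "norm h \<le> 1" for x h
  proof -
    have "onorm (frechet_derivative f (at y)) \<le> (C * 3 ^ n) * weight (- real n) x" if y: "y \<in> cball x 1" for y
    proof (rule onorm_le)
      fix v
      have "norm (frechet_derivative f (at y) v) \<le> C * weight (- real n) y * norm v" by (rule C)
      also have "\<dots> \<le> C * (3 ^ n * weight (- real n) x) * norm v"
        using y C(1) by (intro mult_right_mono mult_left_mono weight_shift) (auto simp: dist_norm norm_minus_commute)
      finally show "norm (frechet_derivative f (at y) v) \<le> (C * 3 ^ n) * weight (- real n) x * norm v"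
        by (simp add: mult_ac)
    qed
    then have "norm (f (x + h) - f x) \<le> ((C * 3 ^ n) * weight (- real n) x) * norm ((x + h) - x)"
      using h schwartz_has_derivative[OF f]
      by (intro differentiable_bound[of "cball x 1" f "\<lambda>x. frechet_derivative f (at x)"])
        (auto simp: dist_norm has_derivative_at_withinI)
    then show ?thesis by (simp add: mult_ac)
  qed
  then show ?thesis using that[of "C * 3 ^ n"] C(1) by simp
qed

section \<open>The Fourier transform on Schwartz functions\<close>

lemma exp_minus_ii_mult:
  "exp (- \<i> * of_real a) * exp (- \<i> * of_real b) = exp (- \<i> * complex_of_real (a + b))"
  by (simp add: distrib_left flip: exp_add)

lemma integrable_exp_mult:
  fixes f :: "'a::euclidean_space \<Rightarrow> complex"
  assumes "integrable lborel f"
  shows "integrable lborel (\<lambda>x. exp (- \<i> * of_real (p \<bullet> x)) * f x)"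
  by (rule Bochner_Integration.integrable_bound[OF assms]) (use assms in \<open>auto simp: norm_mult\<close>)

lemma fourier_bound:
  fixes f :: "'a::euclidean_space \<Rightarrow> complex"
  shows "norm (fourier f p) \<le> (2 * pi) powr (- real DIM('a) / 2) * (\<integral>x. norm (f x) \<partial>lborel)"
proof -
  have "norm (\<integral>x. exp (- \<i> * of_real (p \<bullet> x)) * f x \<partial>lborel)
      \<le> (\<integral>x. norm (exp (- \<i> * of_real (p \<bullet> x)) * f x) \<partial>lborel)"
    by (rule integral_norm_bound)
  also have "\<dots> = (\<integral>x. norm (f x) \<partial>lborel)" by (simp add: norm_mult)
  finally show ?thesis
    unfolding fourier_def by (simp add: norm_mult mult_left_mono)
qed

lemma fourier_add:
  fixes f :: "'a::euclidean_space \<Rightarrow> complex"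
  assumes "integrable lborel f" "integrable lborel g"
  shows "fourier (\<lambda>x. f x + g x) p = fourier f p + fourier g p"
  unfolding fourier_def using integrable_exp_mult[OF assms(1), of p] integrable_exp_mult[OF assms(2), of p]
  by (simp add: distrib_left)

lemma fourier_cmult:
  fixes f :: "'a::euclidean_space \<Rightarrow> complex"
  shows "fourier (\<lambda>x. c * f x) p = c * fourier f p"
proof -
  have "(\<integral>x. exp (- \<i> * of_real (p \<bullet> x)) * (c * f x) \<partial>lborel) =
      (\<integral>x. c * (exp (- \<i> * of_real (p \<bullet> x)) * f x) \<partial>lborel)"
    by (simp only: mult.left_commute)
  then show ?thesis unfolding fourier_def by simp
qed

lemma fourier_diff:
  fixes f :: "'a::euclidean_space \<Rightarrow> complex"
  assumes "integrable lborel f" "integrable lborel g"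
  shows "fourier (\<lambda>x. f x - g x) p = fourier f p - fourier g p"
  using fourier_add[OF assms(1) integrable_mult_right[OF assms(2), of "-1"]] fourier_cmult[of "-1" g p]
  by simp

text \<open>Conjugation here and reflection in the next lemma are two routes from the transform to
  its inverse; facts about \<open>fourier\<close> pass to \<open>inv_fourier\<close> through
  whichever is more convenient.\<close>

lemma inv_fourier_conv_cnj: "inv_fourier f x = cnj (fourier (\<lambda>x. cnj (f x)) x)"
proof -
  have "(\<lambda>p. exp (\<i> * of_real (p \<bullet> x)) * f p) = (\<lambda>p. cnj (exp (- \<i> * of_real (x \<bullet> p)) * cnj (f p)))"
    by (auto simp: fun_eq_iff inner_commute exp_cnj)
  then have "(\<integral>p. exp (\<i> * of_real (p \<bullet> x)) * f p \<partial>lborel)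
      = cnj (\<integral>p. exp (- \<i> * of_real (x \<bullet> p)) * cnj (f p) \<partial>lborel)"
    by (simp only: Bochner_Integration.integral_cnj)
  then show ?thesis unfolding fourier_def inv_fourier_def by simp
qed

lemma inv_fourier_conv_uminus: "inv_fourier f x = fourier f (- x)"
proof -
  have "(\<lambda>p. exp (\<i> * of_real (p \<bullet> x)) * f p) = (\<lambda>p. exp (- \<i> * of_real (- x \<bullet> p)) * f p)"
    by (auto simp: fun_eq_iff inner_commute)
  then show ?thesis unfolding fourier_def inv_fourier_def by simp
qed

lemma iexp_approx_linear: "norm (exp (- \<i> * of_real t) - 1 + \<i> * of_real t) \<le> t\<^sup>2"
proof -
  have "norm (iexp (- t) - (\<Sum>k \<le> 1. (\<i> * of_real (- t)) ^ k / fact k)) \<le> \<bar>- t\<bar> ^ Suc 1 / fact (Suc 1)"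
    by (rule iexp_approx1)
  also have "\<dots> \<le> t\<^sup>2" by (simp add: power2_eq_square)
  finally show ?thesis by (simp add: algebra_simps)
qed

lemma schwartz_coord_mult:
  fixes f :: "'a::euclidean_space \<Rightarrow> complex"
  assumes "f \<in> schwartz"
  shows "(\<lambda>x. - \<i> * of_real (x \<bullet> h) * f x) \<in> schwartz"
  using schwartz_mult_complex[OF schwartz_moderate_mult[OF moderate.coord[of h] assms], of "- \<i>"]
  by (simp add: mult.assoc)

text \<open>Differentiation under the integral with an explicit remainder: the second-order bound
  for the exponential leaves an error of order \<open>norm (q - p)\<close> squared, whose constant
  is the integral of \<open>(1 + |x|^2) * norm (f x)\<close>.\<close>

lemma fourier_has_derivative:
  fixes f :: "'a::euclidean_space \<Rightarrow> complex"
  assumes f: "f \<in> schwartz"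
  shows "(fourier f has_derivative (\<lambda>h. fourier (\<lambda>x. - \<i> * of_real (x \<bullet> h) * f x) p)) (at p)"
proof -
  define g where "g h x = - \<i> * of_real (x \<bullet> h) * f x" for h x
  have g: "integrable lborel (g h)" for h
    unfolding g_def by (intro schwartz_integrable schwartz_coord_mult f)
  have fi: "integrable lborel f" by (rule schwartz_integrable[OF f])
  have "linear (\<lambda>h. fourier (g h) p)"
  proof (rule linearI)
    fix h k
    have "g (h + k) = (\<lambda>x. g h x + g k x)" unfolding g_def by (auto simp: inner_add_right algebra_simps)
    then show "fourier (g (h + k)) p = fourier (g h) p + fourier (g k) p"
      using fourier_add[OF g g] by simp
  next
    fix c :: real and h
    have "g (c *\<^sub>R h) = (\<lambda>x. of_real c * g h x)" unfolding g_def by auto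
    then show "fourier (g (c *\<^sub>R h)) p = c *\<^sub>R fourier (g h) p"
      using fourier_cmult[of "of_real c" "g h" p] by (simp add: scaleR_conv_of_real)
  qed
  then have bl: "bounded_linear (\<lambda>h. fourier (g h) p)"
    by (simp add: linear_conv_bounded_linear)
  \<comment> \<open>The weight dominates the factor \<open>(norm x)^2\<close> that Cauchy-Schwarz
    extracts from the Taylor remainder of the phase.\<close>
  define F where "F x = complex_of_real (weight 1 x) * f x" for x
  have Fi: "integrable lborel F"
    unfolding F_def by (intro schwartz_integrable schwartz_weight f)
  define K where "K = (2 * pi) powr (- real DIM('a) / 2) * (\<integral>x. norm (F x) \<partial>lborel)"
  have bound: "norm (fourier f q - fourier f p - fourier (g (q - p)) p) \<le> K * (norm (q - p))\<^sup>2" for q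
  proof -
    define G where "G x = (exp (- \<i> * of_real ((q - p) \<bullet> x)) - 1 + \<i> * of_real ((q - p) \<bullet> x)) * f x" for x
    have Ge: "G = (\<lambda>x. exp (- \<i> * of_real ((q - p) \<bullet> x)) * f x - f x - g (q - p) x)"
      unfolding G_def g_def by (auto simp: algebra_simps inner_commute)
    have e: "fourier (\<lambda>x. exp (- \<i> * of_real ((q - p) \<bullet> x)) * f x) p = fourier f q"
    proof -
      have "exp (- \<i> * of_real (p \<bullet> x)) * (exp (- \<i> * of_real ((q - p) \<bullet> x)) * f x)
          = exp (- \<i> * of_real (q \<bullet> x)) * f x" for x
        unfolding mult.assoc[symmetric] exp_minus_ii_mult by (simp add: inner_diff_left)
      then show ?thesis unfolding fourier_def by (simp only:)
    qed
    have "fourier f q - fourier f p - fourier (g (q - p)) p = fourier G p"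
      unfolding Ge
      by (simp only: e fourier_diff integrable_exp_mult fi g Bochner_Integration.integrable_diff)
    then have "norm (fourier f q - fourier f p - fourier (g (q - p)) p)
        \<le> (2 * pi) powr (- real DIM('a) / 2) * (\<integral>x. norm (G x) \<partial>lborel)"
      using fourier_bound[of G p] by simp
    also have "(\<integral>x. norm (G x) \<partial>lborel) \<le> (\<integral>x. (norm (q - p))\<^sup>2 * norm (F x) \<partial>lborel)"
    proof (rule integral_mono)
      show "integrable lborel (\<lambda>x. norm (G x))"
        unfolding Ge by (intro integrable_norm Bochner_Integration.integrable_diff integrable_exp_mult fi g)
      show "integrable lborel (\<lambda>x. (norm (q - p))\<^sup>2 * norm (F x))"
        using Fi by auto
      fix x
      have "norm (G x) \<le> ((q - p) \<bullet> x)\<^sup>2 * norm (f x)"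
        unfolding G_def norm_mult by (intro mult_right_mono iexp_approx_linear) auto
      also have "\<dots> \<le> (norm (q - p) * norm x)\<^sup>2 * norm (f x)"
        using Cauchy_Schwarz_ineq2[of "q - p" x] by (intro mult_right_mono abs_le_square_iff[THEN iffD1]) auto
      also have "\<dots> \<le> (norm (q - p))\<^sup>2 * norm (F x)"
      proof -
        have "norm (F x) = (1 + (norm x)\<^sup>2) * norm (f x)"
          unfolding F_def norm_mult norm_of_real abs_of_pos[OF weight_pos] by (simp add: weight_def)
        then show ?thesis
          by (simp add: power_mult_distrib mult.assoc mult_left_mono mult_right_mono)
      qed
      finally show "norm (G x) \<le> (norm (q - p))\<^sup>2 * norm (F x)" .
    qed
    also have "(\<integral>x. (norm (q - p))\<^sup>2 * norm (F x) \<partial>lborel) = (norm (q - p))\<^sup>2 * (\<integral>x. norm (F x) \<partial>lborel)"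
      by simp
    finally show ?thesis unfolding K_def by (simp add: mult_ac mult_left_mono)
  qed
  have "(fourier f has_derivative (\<lambda>h. fourier (g h) p)) (at p)"
  proof (rule has_derivativeI_sandwich[where e = 1 and H = "\<lambda>y. K * norm (y - p)"])
    show "((\<lambda>y. K * norm (y - p)) \<longlongrightarrow> 0) (at p)"
      by (rule tendsto_eq_intros refl | simp)+
    show "norm (fourier f q - fourier f p - fourier (g (q - p)) p) / norm (q - p) \<le> K * norm (q - p)"
      if "q \<noteq> p" for q
      using bound[of q] that by (simp add: divide_le_eq power2_eq_square mult_ac)
  qed (use bl in auto)
  then show ?thesis unfolding g_def .
qed

lemma lborel_integral_affine:
  fixes f :: "'a::euclidean_space \<Rightarrow> 'b::{banach, second_countable_topology}"
  assumes "c \<noteq> 0" "f \<in> borel_measurable borel"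
  shows "(\<integral>x. f x \<partial>lborel) = \<bar>c\<bar> ^ DIM('a) *\<^sub>R (\<integral>x. f (t + c *\<^sub>R x) \<partial>lborel)"
  by (subst lborel_affine[OF assms(1), of t]) (use assms in \<open>simp add: integral_density integral_distr\<close>)

lemma lborel_integrable_affine:
  fixes f :: "'a::euclidean_space \<Rightarrow> 'b::{banach, second_countable_topology}"
  assumes "c \<noteq> 0" "integrable lborel f"
  shows "integrable lborel (\<lambda>x. f (t + c *\<^sub>R x))"
proof -
  have [measurable]: "f \<in> borel_measurable borel" using assms(2) by auto
  have "integrable (density (distr lborel borel (\<lambda>x. t + c *\<^sub>R x)) (\<lambda>_. ennreal (\<bar>c\<bar> ^ DIM('a)))) f"
    using assms(2) lborel_affine[OF assms(1), of t] by simp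
  then have "integrable lborel (\<lambda>x. \<bar>c\<bar> ^ DIM('a) *\<^sub>R f (t + c *\<^sub>R x))"
    using assms(1) by (simp add: integrable_density integrable_distr_eq)
  from integrable_scaleR_right[OF this, of "inverse (\<bar>c\<bar> ^ DIM('a))"] show ?thesis
    using assms(1) by simp
qed

lemma fourier_translate:
  fixes f :: "'a::euclidean_space \<Rightarrow> complex"
  assumes [measurable]: "f \<in> borel_measurable borel"
  shows "fourier (\<lambda>x. f (x + a)) p = exp (\<i> * of_real (p \<bullet> a)) * fourier f p"
proof -
  have "(\<integral>x. exp (- \<i> * of_real (p \<bullet> x)) * f x \<partial>lborel) =
      (\<integral>x. exp (- \<i> * of_real (p \<bullet> (a + 1 *\<^sub>R x))) * f (a + 1 *\<^sub>R x) \<partial>lborel)"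
    by (subst lborel_integral_affine[where c = 1 and t = a]) auto
  also have "\<dots> = (\<integral>x. exp (- \<i> * of_real (p \<bullet> a)) * (exp (- \<i> * of_real (p \<bullet> x)) * f (x + a)) \<partial>lborel)"
    by (intro Bochner_Integration.integral_cong)
      (simp_all only: mult.assoc[symmetric] exp_minus_ii_mult inner_add_right scaleR_one add.commute)
  also have "\<dots> = exp (- \<i> * of_real (p \<bullet> a)) * (\<integral>x. exp (- \<i> * of_real (p \<bullet> x)) * f (x + a) \<partial>lborel)"
    by (rule integral_mult_right_zero)
  finally have "fourier f p = exp (- \<i> * of_real (p \<bullet> a)) * fourier (\<lambda>x. f (x + a)) p"
    unfolding fourier_def by (simp only: mult.left_commute)
  then show ?thesis using exp_minus_inverse[of "\<i> * of_real (p \<bullet> a)"]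
    by (simp add: mult.assoc[symmetric])
qed

text \<open>Integration by parts, from the translation covariance of the Fourier transform.\<close>

lemma fourier_partial:
  fixes f :: "'a::euclidean_space \<Rightarrow> complex"
  assumes f: "f \<in> schwartz" and b: "b \<in> Basis"
  shows "fourier (\<lambda>x. frechet_derivative f (at x) b) p = \<i> * of_real (p \<bullet> b) * fourier f p"
proof -
  \<comment> \<open>Positive steps of length at most 1, the range in which the increment bound
    holds, so that one majorant serves all difference quotients \<open>D n\<close>.\<close>
  define t where "t n = inverse (real (Suc n))" for n
  have t: "t n > 0" "t n \<le> 1" for n unfolding t_def by (auto simp: field_simps)
  have t0: "t \<longlonglongrightarrow> 0" unfolding t_def by (rule LIMSEQ_inverse_real_of_nat)
  define D where "D n x = of_real (inverse (t n)) * (f (x + t n *\<^sub>R b) - f x)" for n x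
  have fm [measurable]: "f \<in> borel_measurable borel" by (rule schwartz_measurable[OF f])
  have fi: "integrable lborel f" by (rule schwartz_integrable[OF f])
  have fti: "integrable lborel (\<lambda>x. f (x + a))" for a
    using lborel_integrable_affine[of 1 f a] fi by (simp add: add.commute)
  have FD: "fourier (D n) p = of_real (inverse (t n)) * (exp (\<i> * of_real (t n * (p \<bullet> b))) - 1) * fourier f p" for n
    unfolding D_def fourier_cmult fourier_diff[OF fti fi] fourier_translate[OF fm]
    by (simp add: algebra_simps)
  obtain C where C: "C > 0" "\<And>x h. norm h \<le> 1 \<Longrightarrow>
      norm (f (x + h) - f x) \<le> norm h * (C * weight (- real DIM('a)) x)"
    using schwartz_increment_bound[OF f] by blast
  have "(\<lambda>n. \<integral>x. exp (- \<i> * of_real (p \<bullet> x)) * D n x \<partial>lborel) \<longlonglongrightarrow>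
      (\<integral>x. exp (- \<i> * of_real (p \<bullet> x)) * frechet_derivative f (at x) b \<partial>lborel)"
  proof (rule integral_dominated_convergence[where w = "\<lambda>x. C * weight (- real DIM('a)) x"])
    show "(\<lambda>x. exp (- \<i> * of_real (p \<bullet> x)) * frechet_derivative f (at x) b) \<in> borel_measurable lborel"
      by (intro borel_measurable_integrable integrable_exp_mult schwartz_integrable
          schwartz_frechet_derivative f b)
    show "(\<lambda>x. exp (- \<i> * of_real (p \<bullet> x)) * D n x) \<in> borel_measurable lborel" for n
      unfolding D_def
      by (intro borel_measurable_integrable integrable_exp_mult integrable_mult_right
          Bochner_Integration.integrable_diff fti fi)
    show "integrable lborel (\<lambda>x::'a. C * weight (- real DIM('a)) x)"
      by (intro integrable_mult_right integrable_weight) auto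
    show "AE x in lborel. norm (exp (- \<i> * of_real (p \<bullet> x)) * D n x) \<le> C * weight (- real DIM('a)) x" for n
    proof (rule AE_I2)
      fix x
      have "norm (f (x + t n *\<^sub>R b) - f x) \<le> t n * (C * weight (- real DIM('a)) x)"
        using C(2)[of "t n *\<^sub>R b" x] t[of n] b by simp
      then have "inverse (t n) * norm (f (x + t n *\<^sub>R b) - f x)
          \<le> inverse (t n) * (t n * (C * weight (- real DIM('a)) x))"
        using t(1)[of n] by (intro mult_left_mono) auto
      also have "\<dots> = C * weight (- real DIM('a)) x" using t(1)[of n] by simp
      finally show "norm (exp (- \<i> * of_real (p \<bullet> x)) * D n x) \<le> C * weight (- real DIM('a)) x"
        unfolding D_def norm_mult norm_of_real using t(1)[of n] by simp
    qed
    show "AE x in lborel. (\<lambda>n. exp (- \<i> * of_real (p \<bullet> x)) * D n x)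
        \<longlonglongrightarrow> exp (- \<i> * of_real (p \<bullet> x)) * frechet_derivative f (at x) b"
    proof (intro AE_I2 tendsto_mult_left)
      fix x
      have der: "((\<lambda>h. norm (f (x + h) - f x - frechet_derivative f (at x) h) / norm h) \<longlongrightarrow> 0) (at 0)"
        using schwartz_has_derivative[OF f, of x] by (simp add: has_derivative_at)
      have "filterlim (\<lambda>n. t n *\<^sub>R b) (at 0) sequentially"
      proof (rule filterlim_atI)
        show "(\<lambda>n. t n *\<^sub>R b) \<longlonglongrightarrow> 0"
          using tendsto_scaleR[OF t0 tendsto_const[of b]] by simp
        have "t n *\<^sub>R b \<noteq> 0" for n
          using t(1)[of n] nonzero_Basis[OF b] by simp
        then show "\<forall>\<^sub>F n in sequentially. t n *\<^sub>R b \<noteq> 0" by simp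
      qed
      from filterlim_compose[OF der this]
      have "(\<lambda>n. norm (f (x + t n *\<^sub>R b) - f x - frechet_derivative f (at x) (t n *\<^sub>R b)) / norm (t n *\<^sub>R b)) \<longlonglongrightarrow> 0" .
      moreover have "norm (f (x + t n *\<^sub>R b) - f x - frechet_derivative f (at x) (t n *\<^sub>R b)) / norm (t n *\<^sub>R b)
          = norm (D n x - frechet_derivative f (at x) b)" for n
      proof -
        have "frechet_derivative f (at x) (t n *\<^sub>R b) = of_real (t n) * frechet_derivative f (at x) b"
          using linear_cmul[OF has_derivative_linear[OF schwartz_has_derivative[OF f]]]
          by (simp add: scaleR_conv_of_real)
        then have "f (x + t n *\<^sub>R b) - f x - frechet_derivative f (at x) (t n *\<^sub>R b)
            = of_real (t n) * (D n x - frechet_derivative f (at x) b)"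
          unfolding D_def using t(1)[of n] by (simp add: algebra_simps)
        then show ?thesis using t(1)[of n] b by (simp add: norm_mult)
      qed
      ultimately have "(\<lambda>n. norm (D n x - frechet_derivative f (at x) b)) \<longlonglongrightarrow> 0" by simp
      then show "(\<lambda>n. D n x) \<longlonglongrightarrow> frechet_derivative f (at x) b"
        by (simp add: tendsto_norm_zero_iff LIM_zero_iff)
    qed
  qed
  then have "(\<lambda>n. fourier (D n) p) \<longlonglongrightarrow> fourier (\<lambda>x. frechet_derivative f (at x) b) p"
    unfolding fourier_def by (rule tendsto_mult_left)
  \<comment> \<open>The same limit on the frequency side: translation multiplies by a phase, and the
    difference quotient of that phase differs from \<open>\<i> * (p \<bullet> b)\<close> by at most
    \<open>t n * (p \<bullet> b)^2\<close>.\<close>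
  moreover have "(\<lambda>n. fourier (D n) p) \<longlonglongrightarrow> \<i> * of_real (p \<bullet> b) * fourier f p"
    unfolding FD
  proof (intro tendsto_mult_right)
    let ?a = "p \<bullet> b"
    have "norm (of_real (inverse (t n)) * (exp (\<i> * of_real (t n * ?a)) - 1) - \<i> * of_real ?a) \<le> t n * ?a\<^sup>2" for n
    proof -
      define E where "E = exp (\<i> * of_real (t n * ?a))"
      have "norm (E - 1 - \<i> * of_real (t n * ?a)) \<le> (t n * ?a)\<^sup>2"
        using iexp_approx_linear[of "- (t n * ?a)"] by (simp add: E_def)
      moreover have "E - 1 - \<i> * of_real (t n * ?a) = of_real (t n) * (of_real (inverse (t n)) * (E - 1) - \<i> * of_real ?a)"
      proof -
        have "complex_of_real (t n) * of_real (inverse (t n)) = 1"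
          using t(1)[of n] by (simp flip: of_real_mult)
        then show ?thesis by (simp add: right_diff_distrib mult.assoc[symmetric] del: of_real_inverse)
      qed
      ultimately have "t n * norm (of_real (inverse (t n)) * (E - 1) - \<i> * of_real ?a) \<le> (t n * ?a)\<^sup>2"
        using t(1)[of n] by (metis abs_of_pos norm_mult norm_of_real)
      also have "(t n * ?a)\<^sup>2 = t n * (t n * ?a\<^sup>2)" by (simp add: power2_eq_square)
      finally show ?thesis
        unfolding E_def using t(1)[of n] by (simp only: mult_le_cancel_left_pos)
    qed
    then have ev: "\<forall>\<^sub>F n in sequentially.
        norm (of_real (inverse (t n)) * (exp (\<i> * of_real (t n * ?a)) - 1) - \<i> * of_real ?a) \<le> t n * ?a\<^sup>2"
      by (intro always_eventually allI)
    have "(\<lambda>n. t n * ?a\<^sup>2) \<longlonglongrightarrow> 0"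
      using tendsto_mult_right[OF t0, of "?a\<^sup>2"] by simp
    from Lim_null_comparison[OF ev this]
    have "(\<lambda>n. of_real (inverse (t n)) * (exp (\<i> * of_real (t n * ?a)) - 1) - \<i> * of_real ?a) \<longlonglongrightarrow> 0" .
    then show "(\<lambda>n. of_real (inverse (t n)) * (exp (\<i> * of_real (t n * ?a)) - 1)) \<longlonglongrightarrow> \<i> * of_real ?a"
      by (simp add: LIM_zero_iff)
  qed
  ultimately show ?thesis by (rule LIMSEQ_unique)
qed

text \<open>Each power of \<open>norm p\<close> is bounded by the sum of the coordinates
  \<open>\<bar>p \<bullet> b\<bar>\<close>, and a coordinate becomes a derivative of
  \<open>f\<close>. The induction therefore has to range over all Schwartz functions.\<close>

lemma fourier_rapid_decay:
  fixes f :: "'a::euclidean_space \<Rightarrow> complex"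
  assumes "f \<in> schwartz"
  shows "\<exists>C. \<forall>p. norm p ^ k * norm (fourier f p) \<le> C"
  using assms
proof (induction k arbitrary: f)
  case 0
  then show ?case using fourier_bound[of f] by auto
next
  case (Suc k)
  have "\<forall>b\<in>Basis. \<exists>C. \<forall>p. norm p ^ k * norm (fourier (\<lambda>x. frechet_derivative f (at x) b) p) \<le> C"
    using Suc schwartz_frechet_derivative by blast
  then obtain C where C: "\<And>b p. b \<in> Basis \<Longrightarrow>
      norm p ^ k * norm (fourier (\<lambda>x. frechet_derivative f (at x) b) p) \<le> C b"
    by metis
  have "norm p ^ Suc k * norm (fourier f p) \<le> (\<Sum>b\<in>Basis. C b)" for p :: 'a
  proof -
    have "norm p ^ Suc k * norm (fourier f p) = norm p * (norm p ^ k * norm (fourier f p))" by simp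
    also have "\<dots> \<le> (\<Sum>b\<in>Basis. \<bar>p \<bullet> b\<bar>) * (norm p ^ k * norm (fourier f p))"
      by (intro mult_right_mono norm_le_l1) auto
    also have "\<dots> = (\<Sum>b\<in>Basis. norm p ^ k * norm (fourier (\<lambda>x. frechet_derivative f (at x) b) p))"
      unfolding sum_distrib_right
      by (intro sum.cong refl) (simp add: fourier_partial[OF Suc.prems] norm_mult)
    also have "\<dots> \<le> (\<Sum>b\<in>Basis. C b)" by (intro sum_mono C)
    finally show ?thesis .
  qed
  then show ?case by blast
qed

text \<open>The set of all transforms of Schwartz functions is itself a class as in
  \<open>schwartz_family\<close>: differentiating a transform gives the transform of a coordinate
  multiple.\<close>

lemma fourier_schwartz:
  assumes "f \<in> schwartz"
  shows "fourier f \<in> schwartz"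
proof (rule schwartz_family[where F = "fourier ` schwartz"])
  fix g :: "'a \<Rightarrow> complex" assume "g \<in> fourier ` schwartz"
  then obtain f where g: "g = fourier f" and f: "f \<in> schwartz" by blast
  show "\<exists>f'. (\<forall>x. (g has_derivative f' x) (at x)) \<and> (\<forall>b\<in>Basis. (\<lambda>x. f' x b) \<in> fourier ` schwartz)"
  proof (intro exI[of _ "\<lambda>p h. fourier (\<lambda>x. - \<i> * of_real (x \<bullet> h) * f x) p"] conjI allI ballI)
    show "(g has_derivative (\<lambda>h. fourier (\<lambda>x. - \<i> * of_real (x \<bullet> h) * f x) p)) (at p)" for p
      unfolding g by (rule fourier_has_derivative[OF f])
    show "fourier (\<lambda>x. - \<i> * of_real (x \<bullet> b) * f x) \<in> fourier ` schwartz" for b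
      by (intro imageI schwartz_coord_mult f)
  qed
  show "\<exists>C. \<forall>x. norm x ^ k * norm (g x) \<le> C" for k
    unfolding g by (rule fourier_rapid_decay[OF f])
qed (use assms in auto)

lemma inv_fourier_schwartz: "f \<in> schwartz \<Longrightarrow> inv_fourier f \<in> schwartz"
  using schwartz_cnj[OF fourier_schwartz[OF schwartz_cnj[of f]]]
  by (simp add: inv_fourier_conv_cnj[abs_def])

subsection \<open>Fourier inversion\<close>

lemma fourier_measurable:
  fixes f :: "'a::euclidean_space \<Rightarrow> complex"
  assumes [measurable]: "f \<in> borel_measurable borel"
  shows "fourier f \<in> borel_measurable borel"
  unfolding fourier_def[abs_def] by measurable

text \<open>Fubini for a kernel symmetric in \<open>x\<close> and \<open>p\<close>. The phase has
  modulus 1, so absolute integrability reduces to that of a product of a function of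
  \<open>x\<close> and a function of \<open>p\<close>.\<close>

lemma fourier_mult_formula:
  fixes f g :: "'a::euclidean_space \<Rightarrow> complex"
  assumes f: "integrable lborel f" and g: "integrable lborel g"
  shows "(\<integral>p. fourier f p * g p \<partial>lborel) = (\<integral>x. f x * fourier g x \<partial>lborel)"
proof -
  define H where "H x p = exp (- \<i> * of_real (p \<bullet> x)) * f x * g p" for x p
  define c where "c = complex_of_real ((2 * pi) powr (- real DIM('a) / 2))"
  have [measurable]: "f \<in> borel_measurable borel" "g \<in> borel_measurable borel"
    using f g by auto
  have nH: "norm (H x p) = norm (f x) * norm (g p)" for x p
    unfolding H_def by (simp add: norm_mult)
  have int: "integrable (lborel \<Otimes>\<^sub>M lborel) (case_prod H)"
  proof (rule lborel_pair.Fubini_integrable)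
    show "case_prod H \<in> borel_measurable (lborel \<Otimes>\<^sub>M lborel)"
      unfolding H_def by measurable
    show "integrable lborel (\<lambda>x. \<integral>y. norm (case (x, y) of (x, y) \<Rightarrow> H x y) \<partial>lborel)"
      using f g by (simp add: nH)
    show "AE x in lborel. integrable lborel (\<lambda>y. case (x, y) of (x, y) \<Rightarrow> H x y)"
    proof (rule AE_I2)
      fix x
      have "integrable lborel (\<lambda>y. norm (f x) * norm (g y))" using g by auto
      then show "integrable lborel (\<lambda>y. case (x, y) of (x, y) \<Rightarrow> H x y)"
        by (rule Bochner_Integration.integrable_bound) (auto simp: nH, auto simp: H_def)
    qed
  qed
  have "(\<integral>p. fourier f p * g p \<partial>lborel) = (\<integral>p. c * (\<integral>x. H x p \<partial>lborel) \<partial>lborel)"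
  proof (rule Bochner_Integration.integral_cong[OF refl])
    fix p
    have "(\<integral>x. H x p \<partial>lborel) = (\<integral>x. exp (- \<i> * of_real (p \<bullet> x)) * f x \<partial>lborel) * g p"
      unfolding H_def by (rule integral_mult_left_zero)
    then show "fourier f p * g p = c * (\<integral>x. H x p \<partial>lborel)"
      unfolding fourier_def c_def by simp
  qed
  also have "\<dots> = c * (\<integral>p. (\<integral>x. H x p \<partial>lborel) \<partial>lborel)" by simp
  also have "\<dots> = c * (\<integral>x. (\<integral>p. H x p \<partial>lborel) \<partial>lborel)"
    by (simp add: lborel_pair.Fubini_integral[OF int])
  also have "\<dots> = (\<integral>x. c * (\<integral>p. H x p \<partial>lborel) \<partial>lborel)" by simp
  also have "\<dots> = (\<integral>x. f x * fourier g x \<partial>lborel)"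
  proof (rule Bochner_Integration.integral_cong[OF refl])
    fix x
    have "(\<integral>p. H x p \<partial>lborel) = (\<integral>p. f x * (exp (- \<i> * of_real (x \<bullet> p)) * g p) \<partial>lborel)"
      by (simp only: H_def inner_commute[of x] mult.assoc mult.left_commute[of "f x"])
    then show "c * (\<integral>p. H x p \<partial>lborel) = f x * fourier g x"
      unfolding fourier_def c_def by simp
  qed
  finally show ?thesis .
qed

section \<open>Gaussian integrals\<close>

definition gauss :: "'a::euclidean_space \<Rightarrow> complex"
  where "gauss y = of_real (exp (- (norm y)\<^sup>2 / 2))"

text \<open>The one-dimensional integral is read off from the characteristic function of the
  standard normal distribution; the factor \<open>sqrt (2 * pi)\<close> undoes the normalisation of
  the density.\<close>

lemma gauss_real:
  fixes t :: real
  shows "integrable lborel (\<lambda>x::real. exp (- \<i> * of_real (t * x)) * of_real (exp (- x\<^sup>2 / 2)))" (is ?I)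
    and "(\<integral>x. exp (- \<i> * of_real (t * x)) * of_real (exp (- x\<^sup>2 / 2)) \<partial>lborel)
      = complex_of_real (sqrt (2 * pi) * exp (- t\<^sup>2 / 2))" (is ?E)
proof -
  have e: "exp (- x\<^sup>2 / 2) = sqrt (2 * pi) * std_normal_density x" for x :: real
    by (simp add: std_normal_density_def)
  have "integrable lborel (\<lambda>x. of_real (std_normal_density x) :: complex)"
    by (intro integrable_of_real integrable_normal_density) simp
  then have i: "integrable lborel (\<lambda>x. exp (- \<i> * of_real (t * x)) * (of_real (std_normal_density x) :: complex))"
    using integrable_exp_mult[where 'a=real, of "\<lambda>x. of_real (std_normal_density x)" t] by simp
  from integrable_mult_right[OF i, of "of_real (sqrt (2 * pi))"]
  show ?I unfolding e by (simp add: mult_ac)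
  have "complex_of_real (exp (- (- t)\<^sup>2 / 2)) = char std_normal_distribution (- t)"
    by (simp add: char_std_normal_distribution)
  also have "\<dots> = (\<integral>x. std_normal_density x *\<^sub>R exp (\<i> * of_real (- t * x)) \<partial>lborel)"
    unfolding char_def by (subst integral_density) auto
  also have "\<dots> = (\<integral>x. exp (- \<i> * of_real (t * x)) * of_real (std_normal_density x) \<partial>lborel)"
    by (simp add: scaleR_conv_of_real mult.commute)
  finally have "(\<integral>x. exp (- \<i> * of_real (t * x)) * of_real (std_normal_density x) \<partial>lborel) =
    complex_of_real (exp (- t\<^sup>2 / 2))" by simp
  then have "of_real (sqrt (2 * pi)) * (\<integral>x. exp (- \<i> * of_real (t * x)) * of_real (std_normal_density x) \<partial>lborel)
    = complex_of_real (sqrt (2 * pi) * exp (- t\<^sup>2 / 2))" by simp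
  moreover have "of_real (sqrt (2 * pi)) * (\<integral>x. exp (- \<i> * of_real (t * x)) * of_real (std_normal_density x) \<partial>lborel)
    = (\<integral>x. of_real (sqrt (2 * pi)) * (exp (- \<i> * of_real (t * x)) * of_real (std_normal_density x)) \<partial>lborel)"
    by (rule integral_mult_right_zero[symmetric])
  moreover have "\<dots> = (\<integral>x. exp (- \<i> * of_real (t * x)) * of_real (exp (- x\<^sup>2 / 2)) \<partial>lborel)"
    unfolding e by (simp only: of_real_mult mult.left_commute)
  ultimately show ?E by simp
qed

text \<open>Both the Gaussian and the phase factor over the coordinates, and Lebesgue measure is the
  image of a product measure, so the integral is a product of one-dimensional ones.\<close>

lemma gauss_integral:
  fixes p :: "'a::euclidean_space"
  shows "integrable lborel (\<lambda>y::'a. exp (- \<i> * of_real (p \<bullet> y)) * gauss y)" (is ?I)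
    and "(\<integral>y. exp (- \<i> * of_real (p \<bullet> y)) * gauss y \<partial>lborel)
      = of_real ((2 * pi) powr (real DIM('a) / 2)) * gauss p" (is ?E)
proof -
  interpret product_sigma_finite "\<lambda>_::'a. lborel::real measure" by standard
  define h where "h b t = exp (- \<i> * of_real ((p \<bullet> b) * t)) * complex_of_real (exp (- t\<^sup>2 / 2))" for b :: 'a and t
  have norm2: "(norm y)\<^sup>2 = (\<Sum>b\<in>Basis. (y \<bullet> b)\<^sup>2)" for y :: 'a
    unfolding power2_norm_eq_inner by (subst euclidean_inner) (simp add: power2_eq_square)
  have prod: "exp (- \<i> * of_real (p \<bullet> y)) * gauss y = (\<Prod>b\<in>Basis. h b (y \<bullet> b))" for y :: 'a
  proof -
    have "- \<i> * of_real (p \<bullet> y) = (\<Sum>b\<in>Basis. - \<i> * of_real ((p \<bullet> b) * (y \<bullet> b)))"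
      by (subst euclidean_inner) (simp add: sum_distrib_left sum_negf)
    then have 1: "exp (- \<i> * of_real (p \<bullet> y)) = (\<Prod>b\<in>Basis. exp (- \<i> * of_real ((p \<bullet> b) * (y \<bullet> b))))"
      by (simp only: exp_sum[OF finite_Basis])
    have "- (norm y)\<^sup>2 / 2 = (\<Sum>b\<in>Basis. - (y \<bullet> b)\<^sup>2 / 2)"
      unfolding norm2 by (simp add: sum_divide_distrib sum_negf)
    then have "exp (- (norm y)\<^sup>2 / 2) = (\<Prod>b\<in>Basis. exp (- (y \<bullet> b)\<^sup>2 / 2))"
      by (simp only: exp_sum[OF finite_Basis])
    then have 2: "gauss y = (\<Prod>b\<in>Basis. of_real (exp (- (y \<bullet> b)\<^sup>2 / 2)))"
      unfolding gauss_def by (simp only: of_real_prod)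
    show ?thesis unfolding 1 2 h_def by (simp only: prod.distrib)
  qed
  have hi: "integrable lborel (h b)" for b unfolding h_def[abs_def] by (rule gauss_real)
  have hI: "(\<integral>t. h b t \<partial>lborel) = of_real (sqrt (2 * pi) * exp (- (p \<bullet> b)\<^sup>2 / 2))" for b
    unfolding h_def by (rule gauss_real)
  have [measurable]: "h b \<in> borel_measurable borel" for b using hi[of b] by auto
  have m: "(\<lambda>y::'a. \<Prod>b\<in>Basis. h b (y \<bullet> b)) \<in> borel_measurable borel"
    by measurable
  have m2: "(\<lambda>f. \<Sum>b\<in>Basis. f b *\<^sub>R b) \<in> measurable (Pi\<^sub>M Basis (\<lambda>_. lborel)) (borel :: 'a measure)"
    by measurable
  have pi: "integrable (Pi\<^sub>M Basis (\<lambda>_. lborel)) (\<lambda>f. \<Prod>b\<in>Basis. h b (f b))"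
    by (rule product_integrable_prod) (auto simp: hi)
  have simp': "(\<Prod>b\<in>Basis. h b ((\<Sum>b'\<in>Basis. f b' *\<^sub>R b') \<bullet> b)) = (\<Prod>b\<in>Basis. h b (f b))" for f
    by (intro prod.cong refl) simp
  have "integrable (distr (Pi\<^sub>M Basis (\<lambda>_. lborel)) borel (\<lambda>f. \<Sum>b\<in>Basis. f b *\<^sub>R b))
      (\<lambda>y::'a. \<Prod>b\<in>Basis. h b (y \<bullet> b))"
    unfolding integrable_distr_eq[OF m2 m] simp' by (rule pi)
  then show ?I unfolding prod by (subst lborel_eq)
  have "(\<integral>y. (\<Prod>b\<in>Basis. h b (y \<bullet> b)) \<partial>distr (Pi\<^sub>M Basis (\<lambda>_. lborel)) borel (\<lambda>f. \<Sum>b\<in>Basis. f b *\<^sub>R b))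
      = (\<integral>f. (\<Prod>b\<in>Basis. h b (f b)) \<partial>Pi\<^sub>M Basis (\<lambda>_. lborel))"
    by (subst integral_distr[OF m2 m]) (simp only: simp')
  also have "\<dots> = (\<Prod>b\<in>Basis. (\<integral>t. h b t \<partial>lborel))"
    by (rule product_integral_prod) (auto simp: hi)
  also have "\<dots> = of_real (\<Prod>b\<in>Basis. sqrt (2 * pi) * exp (- (p \<bullet> b)\<^sup>2 / 2))"
    by (simp only: hI of_real_prod)
  also have "(\<Prod>b\<in>Basis. sqrt (2 * pi) * exp (- (p \<bullet> b)\<^sup>2 / 2)) = sqrt (2 * pi) ^ DIM('a) * exp (- (norm p)\<^sup>2 / 2)"
  proof -
    have "(\<Prod>b\<in>Basis. exp (- (p \<bullet> b)\<^sup>2 / 2)) = exp (\<Sum>b\<in>Basis. - (p \<bullet> b)\<^sup>2 / 2)"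
      by (rule exp_sum[OF finite_Basis, symmetric])
    also have "(\<Sum>b\<in>Basis. - (p \<bullet> b)\<^sup>2 / 2) = - (norm p)\<^sup>2 / 2"
      by (simp add: norm2 sum_negf sum_divide_distrib)
    finally show ?thesis unfolding prod.distrib by simp
  qed
  also have "sqrt (2 * pi) ^ DIM('a) = (2 * pi) powr (real DIM('a) / 2)"
    by (simp add: powr_half_sqrt[symmetric] powr_powr flip: powr_realpow)
  finally show ?E
    unfolding lborel_eq[symmetric] prod[symmetric] by (simp only: gauss_def of_real_mult)
qed

lemma fourier_gauss: "fourier gauss p = gauss p"
proof -
  have "(2 * pi) powr (- real DIM('a) / 2) * (2 * pi) powr (real DIM('a) / 2) = 1"
    by (simp flip: powr_add)
  then show ?thesis
    unfolding fourier_def gauss_integral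
    by (metis mult.assoc mult.left_neutral of_real_1 of_real_mult)
qed

lemma gauss_integrable: "integrable lborel gauss"
  using gauss_integral(1)[of 0] by simp

lemma gauss_total: "(\<integral>(y::'a::euclidean_space). gauss y \<partial>lborel) = of_real ((2 * pi) powr (real DIM('a) / 2))"
  using gauss_integral(2)[of "0::'a"] by (simp add: gauss_def)

lemma gauss_continuous: "continuous_on S gauss"
  unfolding gauss_def by (intro continuous_intros) auto

text \<open>Regularise the inversion integral by a Gaussian of width \<open>\<epsilon>\<close> on the frequency side,
  move the Fourier transform to the Gaussian, and let \<open>\<epsilon>\<close> tend to zero.\<close>

lemma inv_fourier_fourier:
  fixes f :: "'a::euclidean_space \<Rightarrow> complex"
  assumes f: "f \<in> schwartz"
  shows "inv_fourier (fourier f) x = f x"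
proof -
  define t where "t n = inverse (real (Suc n))" for n
  have t: "t n > 0" for n unfolding t_def by simp
  have t0: "t \<longlonglongrightarrow> 0" unfolding t_def by (rule LIMSEQ_inverse_real_of_nat)
  \<comment> \<open>The function \<open>f\<close> blown up around \<open>x\<close>, in the variable
    \<open>z = (y - x) / t n\<close>. It converges pointwise to the constant
    \<open>f x\<close>.\<close>
  define g where "g n z = f (x + t n *\<^sub>R z)" for n z
  have fm: "f \<in> borel_measurable borel" by (rule schwartz_measurable[OF f])
  have fi: "integrable lborel f" by (rule schwartz_integrable[OF f])
  have gi: "integrable lborel (g n)" for n
    unfolding g_def[abs_def] using t[of n] by (intro lborel_integrable_affine fi) simp
  have gm: "g n \<in> borel_measurable borel" for n using gi[of n] by auto
  have ffi: "integrable lborel (fourier f)" by (intro schwartz_integrable fourier_schwartz f)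
  have gaussm: "(gauss :: 'a \<Rightarrow> complex) \<in> borel_measurable borel"
    using borel_measurable_integrable[OF gauss_integrable] by simp
  \<comment> \<open>Substituting \<open>y = x + t n *\<^sub>R z\<close> produces a Jacobian and the
    phase that cancels the inversion kernel at \<open>x\<close>.\<close>
  have scale: "exp (\<i> * of_real (p \<bullet> x)) * fourier f p = t n ^ DIM('a) *\<^sub>R fourier (g n) (t n *\<^sub>R p)" for n p
  proof -
    have "(\<integral>y. exp (- \<i> * of_real (p \<bullet> y)) * f y \<partial>lborel) =
        \<bar>t n\<bar> ^ DIM('a) *\<^sub>R (\<integral>z. exp (- \<i> * of_real (p \<bullet> (x + t n *\<^sub>R z))) * f (x + t n *\<^sub>R z) \<partial>lborel)"
      using t[of n] borel_measurable_integrable[OF integrable_exp_mult[OF fi, of p]]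
      by (intro lborel_integral_affine) auto
    also have "(\<integral>z. exp (- \<i> * of_real (p \<bullet> (x + t n *\<^sub>R z))) * f (x + t n *\<^sub>R z) \<partial>lborel)
        = (\<integral>z. exp (- \<i> * of_real (p \<bullet> x)) * (exp (- \<i> * of_real ((t n *\<^sub>R p) \<bullet> z)) * g n z) \<partial>lborel)"
    proof (intro Bochner_Integration.integral_cong refl)
      fix z
      have "p \<bullet> (x + t n *\<^sub>R z) = p \<bullet> x + (t n *\<^sub>R p) \<bullet> z" by (simp add: inner_add_right)
      then show "exp (- \<i> * of_real (p \<bullet> (x + t n *\<^sub>R z))) * f (x + t n *\<^sub>R z)
        = exp (- \<i> * of_real (p \<bullet> x)) * (exp (- \<i> * of_real ((t n *\<^sub>R p) \<bullet> z)) * g n z)"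
        by (simp only: mult.assoc[symmetric] exp_minus_ii_mult g_def)
    qed
    also have "\<dots> = exp (- \<i> * of_real (p \<bullet> x)) * (\<integral>z. exp (- \<i> * of_real ((t n *\<^sub>R p) \<bullet> z)) * g n z \<partial>lborel)"
      by (rule integral_mult_right_zero)
    finally have "fourier f p = t n ^ DIM('a) *\<^sub>R (exp (- \<i> * of_real (p \<bullet> x)) * fourier (g n) (t n *\<^sub>R p))"
      unfolding fourier_def using t[of n] by (simp add: scaleR_conv_of_real mult.left_commute)
    then show ?thesis using exp_minus_inverse[of "\<i> * of_real (p \<bullet> x)"]
      by (simp add: mult.assoc[symmetric])
  qed
  \<comment> \<open>Rescaling the frequency by \<open>q = t n *\<^sub>R p\<close> consumes the
    Jacobian. The multiplication formula then moves the transform to \<open>gauss\<close>, which is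
    its own transform.\<close>
  have key: "(\<integral>p. exp (\<i> * of_real (p \<bullet> x)) * fourier f p * gauss (t n *\<^sub>R p) \<partial>lborel)
      = (\<integral>z. g n z * gauss z \<partial>lborel)" for n
  proof -
    have "(\<integral>p. exp (\<i> * of_real (p \<bullet> x)) * fourier f p * gauss (t n *\<^sub>R p) \<partial>lborel)
        = t n ^ DIM('a) *\<^sub>R (\<integral>p. fourier (g n) (t n *\<^sub>R p) * gauss (t n *\<^sub>R p) \<partial>lborel)"
      unfolding scale[of _ n] by simp
    also have "\<dots> = (\<integral>q. fourier (g n) q * gauss q \<partial>lborel)"
      using lborel_integral_affine[of "t n" "\<lambda>q. fourier (g n) q * gauss q" 0] t[of n]
        borel_measurable_times[OF fourier_measurable[OF gm[of n]] gaussm]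
      by simp
    also have "\<dots> = (\<integral>z. g n z * fourier gauss z \<partial>lborel)"
      by (rule fourier_mult_formula[OF gi gauss_integrable])
    finally show ?thesis by (simp add: fourier_gauss)
  qed
  have tz: "(\<lambda>n. t n *\<^sub>R z) \<longlonglongrightarrow> 0" for z :: 'a
    using tendsto_scaleR[OF t0 tendsto_const[of z]] by simp
  \<comment> \<open>As \<open>t n\<close> tends to 0 the regularising factor tends to 1 and stays
    below 1; the transform of \<open>f\<close> is the majorant, being a Schwartz function.\<close>
  have lhs: "(\<lambda>n. \<integral>p. exp (\<i> * of_real (p \<bullet> x)) * fourier f p * gauss (t n *\<^sub>R p) \<partial>lborel)
      \<longlonglongrightarrow> (\<integral>p. exp (\<i> * of_real (p \<bullet> x)) * fourier f p * 1 \<partial>lborel)"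
  proof (rule integral_dominated_convergence[where w = "\<lambda>p. norm (fourier f p)"])
    have em: "(\<lambda>p. exp (\<i> * of_real (p \<bullet> x)) * fourier f p) \<in> borel_measurable borel"
      using fourier_measurable[OF fm]
      by (intro borel_measurable_times) (auto intro!: borel_measurable_continuous_onI continuous_intros)
    then show "(\<lambda>p. exp (\<i> * of_real (p \<bullet> x)) * fourier f p * 1) \<in> borel_measurable lborel" by simp
    show "(\<lambda>p. exp (\<i> * of_real (p \<bullet> x)) * fourier f p * gauss (t n *\<^sub>R p)) \<in> borel_measurable lborel" for n
    proof -
      have "(\<lambda>p::'a. gauss (t n *\<^sub>R p)) \<in> borel_measurable borel"
        using gaussm by measurable
      then show ?thesis using borel_measurable_times[OF em] by simp
    qed
    show "AE p in lborel. (\<lambda>n. exp (\<i> * of_real (p \<bullet> x)) * fourier f p * gauss (t n *\<^sub>R p))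
        \<longlonglongrightarrow> exp (\<i> * of_real (p \<bullet> x)) * fourier f p * 1"
    proof (rule AE_I2, rule tendsto_mult_left)
      fix p :: 'a
      have "(\<lambda>n. gauss (t n *\<^sub>R p)) \<longlonglongrightarrow> gauss (0::'a)"
        using gauss_continuous[of "UNIV :: 'a set"] tz[of p]
        by (intro isCont_tendsto_compose[of 0 gauss]) (simp_all add: continuous_on_eq_continuous_at)
      then show "(\<lambda>n. gauss (t n *\<^sub>R p)) \<longlonglongrightarrow> 1" by (simp add: gauss_def)
    qed
    show "AE p in lborel. norm (exp (\<i> * of_real (p \<bullet> x)) * fourier f p * gauss (t n *\<^sub>R p)) \<le> norm (fourier f p)" for n
      by (intro AE_I2) (simp add: norm_mult gauss_def mult_left_le)
  qed (use ffi in auto)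
  obtain B where B: "\<And>z. norm (f z) \<le> B"
    using schwartz_bound_norm[OF f, of 0] by auto
  \<comment> \<open>Continuity of \<open>f\<close> at \<open>x\<close> gives the limit and
    boundedness of \<open>f\<close> the majorant. The total mass of the Gaussian then cancels the
    normalising constant.\<close>
  have rhs: "(\<lambda>n. \<integral>z. g n z * gauss z \<partial>lborel) \<longlonglongrightarrow> (\<integral>(z::'a). f x * gauss z \<partial>lborel)"
  proof (rule integral_dominated_convergence[where w = "\<lambda>z. B * norm (gauss z)"])
    show "AE z in lborel. (\<lambda>n. g n z * gauss z) \<longlonglongrightarrow> f x * gauss z"
    proof (rule AE_I2, rule tendsto_mult_right)
      fix z
      have "(\<lambda>n. x + t n *\<^sub>R z) \<longlonglongrightarrow> x"
        using tendsto_add[OF tendsto_const[of x] tz[of z]] by simp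
      then show "(\<lambda>n. g n z) \<longlonglongrightarrow> f x"
        unfolding g_def using schwartz_continuous[OF f, of UNIV]
        by (intro isCont_tendsto_compose[of x f]) (simp_all add: continuous_on_eq_continuous_at)
    qed
    show "AE z in lborel. norm (g n z * gauss z) \<le> B * norm (gauss z)" for n
      by (intro AE_I2) (simp add: norm_mult g_def B mult_right_mono)
  qed (use gauss_integrable gm gaussm in auto)
  have "(\<integral>p. exp (\<i> * of_real (p \<bullet> x)) * fourier f p * 1 \<partial>lborel) = (\<integral>(z::'a). f x * gauss z \<partial>lborel)"
    using LIMSEQ_unique[OF lhs[unfolded key] rhs] .
  then have "inv_fourier (fourier f) x = of_real ((2 * pi) powr (- real DIM('a) / 2)) *
      (f x * of_real ((2 * pi) powr (real DIM('a) / 2)))"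
    unfolding inv_fourier_def by (simp add: gauss_total)
  also have "\<dots> = f x * of_real ((2 * pi) powr (- real DIM('a) / 2) * (2 * pi) powr (real DIM('a) / 2))"
    by (simp only: of_real_mult mult_ac)
  also have "(2 * pi) powr (- real DIM('a) / 2) * (2 * pi) powr (real DIM('a) / 2) = 1"
    by (simp flip: powr_add)
  finally show ?thesis by simp
qed

text \<open>The conjugate of the other inversion formula, applied to the conjugate function.\<close>

lemma fourier_inv_fourier:
  fixes f :: "'a::euclidean_space \<Rightarrow> complex"
  assumes "f \<in> schwartz"
  shows "fourier (inv_fourier f) x = f x"
proof -
  have "cnj (f x) = inv_fourier (fourier (\<lambda>y. cnj (f y))) x"
    by (rule inv_fourier_fourier[OF schwartz_cnj[OF assms], symmetric])
  also have "\<dots> = cnj (fourier (inv_fourier f) x)"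
    unfolding inv_fourier_conv_cnj[abs_def] ..
  finally show ?thesis by (simp only: complex_cnj_cancel_iff)
qed

section \<open>Powers of \<open>m\<^sup>2 - \<Delta>\<close> on Schwartz functions\<close>

lemma inv_fourier_add:
  fixes f :: "'a::euclidean_space \<Rightarrow> complex"
  shows "integrable lborel f \<Longrightarrow> integrable lborel g \<Longrightarrow>
    inv_fourier (\<lambda>x. f x + g x) p = inv_fourier f p + inv_fourier g p"
  unfolding inv_fourier_conv_uminus by (rule fourier_add)

lemma inv_fourier_cmult:
  fixes f :: "'a::euclidean_space \<Rightarrow> complex"
  shows "inv_fourier (\<lambda>x. c * f x) p = c * inv_fourier f p"
  unfolding inv_fourier_conv_uminus by (rule fourier_cmult)

lemma fourier_reflect:
  fixes f :: "'a::euclidean_space \<Rightarrow> complex"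
  assumes [measurable]: "f \<in> borel_measurable borel"
  shows "fourier (\<lambda>x. f (- x)) p = fourier f (- p)"
proof -
  have m: "(\<lambda>x. exp (- \<i> * of_real (- p \<bullet> x)) * f x) \<in> borel_measurable borel"
    by measurable
  have "(\<integral>x. exp (- \<i> * of_real (- p \<bullet> x)) * f x \<partial>lborel) =
      \<bar>- 1\<bar> ^ DIM('a) *\<^sub>R (\<integral>x. exp (- \<i> * of_real (- p \<bullet> (0 + - 1 *\<^sub>R x))) * f (0 + - 1 *\<^sub>R x) \<partial>lborel)"
    by (rule lborel_integral_affine[OF _ m]) simp
  then show ?thesis unfolding fourier_def by simp
qed

lemma bessel_symbol_uminus: "bessel_symbol m s (- p) = bessel_symbol m s p"
  by (simp add: bessel_symbol_def)

lemma bessel_symbol_mult: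
  "m \<noteq> 0 \<Longrightarrow> bessel_symbol m s p * bessel_symbol m r p = bessel_symbol m (s + r) p"
  by (simp add: bessel_symbol_def powr_add)

lemma bessel_symbol_zero: "m \<noteq> 0 \<Longrightarrow> bessel_symbol m 0 p = 1"
  using symbol_base_pos[of m p] by (simp add: bessel_symbol_def)

lemma bessel_symbol_nonneg: "bessel_symbol m s p \<ge> 0"
  by (simp add: bessel_symbol_def)

text \<open>The transpose of \<open>(m\<^sup>2 - \<Delta>)\<^sup>s\<close>; by \<open>bessel_op_conv_inv\<close> it agrees with the operator itself.\<close>

definition bessel_op :: "real \<Rightarrow> real \<Rightarrow> ('a::euclidean_space \<Rightarrow> complex) \<Rightarrow> 'a \<Rightarrow> complex"
  where "bessel_op m s f = fourier (\<lambda>p. of_real (bessel_symbol m s p) * inv_fourier f p)"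

lemma bessel_op_schwartz: "m \<noteq> 0 \<Longrightarrow> f \<in> schwartz \<Longrightarrow> bessel_op m s f \<in> schwartz"
  unfolding bessel_op_def by (intro fourier_schwartz schwartz_bessel_symbol inv_fourier_schwartz)

text \<open>In frequency space the two symbols multiply to 1. The inner transform pair cancels
  because a symbol times a Schwartz function is again a Schwartz function.\<close>

lemma bessel_op_inverse:
  assumes "m \<noteq> 0" "f \<in> schwartz"
  shows "bessel_op m (- s) (bessel_op m s f) = f"
proof -
  have "inv_fourier (bessel_op m s f) p = of_real (bessel_symbol m s p) * inv_fourier f p" for p
    unfolding bessel_op_def
    by (intro inv_fourier_fourier schwartz_bessel_symbol inv_fourier_schwartz assms)
  then have "of_real (bessel_symbol m (- s) p) * inv_fourier (bessel_op m s f) p = inv_fourier f p" for p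
    using assms(1) by (simp add: mult.assoc[symmetric] bessel_symbol_mult bessel_symbol_zero flip: of_real_mult)
  then show ?thesis
    unfolding bessel_op_def[of m "- s"] using fourier_inv_fourier[OF assms(2)] by auto
qed

text \<open>The three functionals inside \<open>dist_bessel\<close> are restricted to Schwartz
  functions, and each is evaluated at one. Transposition reverses the order of the factors, which is
  why \<open>bessel_op\<close> starts with the inverse transform.\<close>

lemma dist_bessel_apply:
  assumes "m \<noteq> 0" "g \<in> schwartz"
  shows "dist_bessel m s T g = T (bessel_op m s g)"
  using assms inv_fourier_schwartz[of g] schwartz_bessel_symbol[of m "inv_fourier g" s]
  by (simp add: dist_bessel_def dist_inv_fourier_def dist_mult_def dist_fourier_def bessel_op_def)

text \<open>Exchanging the transform with its inverse reflects the frequency, and the symbol is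
  even.\<close>

lemma bessel_op_conv_inv:
  fixes f :: "'a::euclidean_space \<Rightarrow> complex"
  assumes [measurable]: "f \<in> borel_measurable borel"
  shows "bessel_op m s f = inv_fourier (\<lambda>p. of_real (bessel_symbol m s p) * fourier f p)"
proof
  fix x
  define v where "v p = complex_of_real (bessel_symbol m s p) * fourier f p" for p
  have [measurable]: "v \<in> borel_measurable borel"
    unfolding v_def using fourier_measurable[OF assms] bessel_symbol_measurable[of m s] by measurable
  have "bessel_op m s f x = fourier (\<lambda>p. v (- p)) x"
    unfolding bessel_op_def v_def by (simp add: bessel_symbol_uminus inv_fourier_conv_uminus)
  also have "\<dots> = inv_fourier v x"
    unfolding inv_fourier_conv_uminus by (rule fourier_reflect) measurable
  finally show "bessel_op m s f x = inv_fourier (\<lambda>p. of_real (bessel_symbol m s p) * fourier f p) x"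
    unfolding v_def .
qed

text \<open>Conjugation exchanges the two forms of the operator, which agree by
  \<open>bessel_op_conv_inv\<close>; on a real argument the operator therefore equals its own
  conjugate.\<close>

lemma bessel_op_real:
  fixes g :: "'a::euclidean_space \<Rightarrow> real"
  assumes "g \<in> borel_measurable borel"
  shows "Im (bessel_op m s (\<lambda>x. of_real (g x)) x) = 0"
proof -
  define f where "f x = complex_of_real (g x)" for x
  have f: "f \<in> borel_measurable borel" unfolding f_def using assms by measurable
  have "cnj (bessel_op m s f x) = inv_fourier (\<lambda>p. cnj (of_real (bessel_symbol m s p) * inv_fourier f p)) x"
    unfolding bessel_op_def by (subst inv_fourier_conv_cnj) simp
  also have "\<dots> = inv_fourier (\<lambda>p. of_real (bessel_symbol m s p) * fourier f p) x"
  proof -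
    have "(\<lambda>y. cnj (f y)) = f" by (simp add: f_def[abs_def])
    then show ?thesis by (simp add: inv_fourier_conv_cnj[of f])
  qed
  also have "\<dots> = bessel_op m s f x" by (simp add: bessel_op_conv_inv[OF f])
  finally show ?thesis unfolding f_def by (metis complex_cnj_cancel_iff Reals_cnj_iff complex_is_Real_iff)
qed

lemma bessel_op_add:
  assumes "m \<noteq> 0" "f \<in> schwartz" "g \<in> schwartz"
  shows "bessel_op m s (\<lambda>x. f x + g x) x = bessel_op m s f x + bessel_op m s g x"
proof -
  have i: "integrable lborel f" "integrable lborel g" using assms by (auto intro: schwartz_integrable)
  have "integrable lborel (\<lambda>p. of_real (bessel_symbol m s p) * inv_fourier h p)" if "h \<in> schwartz" for h :: "'a \<Rightarrow> complex"
    by (intro schwartz_integrable schwartz_bessel_symbol inv_fourier_schwartz that assms)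
  then show ?thesis
    unfolding bessel_op_def by (simp add: inv_fourier_add[OF i] distrib_left fourier_add assms)
qed

lemma bessel_op_cmult: "bessel_op m s (\<lambda>x. c * f x) x = c * bessel_op m s f x"
  unfolding bessel_op_def by (simp add: inv_fourier_cmult mult.left_commute[of _ c] fourier_cmult)

text \<open>With \<open>s = - \<beta>\<close> and \<open>r = - \<alpha>\<close> this is the operator
  \<open>A\<close>. It is real-valued because real distributions accept only real test functions;
  \<open>Re\<close> discards an imaginary part that is zero on Schwartz functions.\<close>

definition weighted_bessel :: "real \<Rightarrow> real \<Rightarrow> real \<Rightarrow> ('a::euclidean_space \<Rightarrow> real) \<Rightarrow> 'a \<Rightarrow> real"
  where "weighted_bessel m s r g x = Re (bessel_op m s (\<lambda>x. of_real (weight r x * g x)) x)"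

lemma schwartz_weight_real: "g \<in> schwartz \<Longrightarrow> (\<lambda>x. weight r x * g x :: real) \<in> schwartz"
  unfolding weight_eq_bessel_symbol
  using schwartz_moderate_scaleR[OF moderate.symbol[of 1 r], of g] by simp

lemma weighted_bessel_schwartz:
  assumes "m \<noteq> 0" "g \<in> schwartz"
  shows "weighted_bessel m s r g \<in> schwartz"
  unfolding weighted_bessel_def[abs_def]
  by (intro schwartz_Re bessel_op_schwartz schwartz_of_real schwartz_weight_real assms)

lemma of_real_weighted_bessel:
  assumes "g \<in> schwartz"
  shows "complex_of_real (weighted_bessel m s r g x) = bessel_op m s (\<lambda>x. of_real (weight r x * g x)) x"
proof -
  have "Im (bessel_op m s (\<lambda>x. of_real (weight r x * g x)) x) = 0"
    using schwartz_weight_real[OF assms] by (intro bessel_op_real schwartz_measurable)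
  then show ?thesis unfolding weighted_bessel_def by (simp add: complex_eq_iff)
qed

lemma weighted_bessel_add:
  assumes "m \<noteq> 0" "f \<in> schwartz" "g \<in> schwartz"
  shows "weighted_bessel m s r (\<lambda>x. f x + g x) x = weighted_bessel m s r f x + weighted_bessel m s r g x"
  unfolding weighted_bessel_def
  using bessel_op_add[OF assms(1) schwartz_of_real[OF schwartz_weight_real[OF assms(2), of r]]
      schwartz_of_real[OF schwartz_weight_real[OF assms(3), of r]], of s x]
  by (simp add: distrib_left)

lemma weighted_bessel_cmult:
  "weighted_bessel m s r (\<lambda>x. c * g x) x = c * weighted_bessel m s r g x"
  unfolding weighted_bessel_def
  using bessel_op_cmult[of m s "of_real c" "\<lambda>x. of_real (weight r x * g x)" x]
  by (simp add: mult.left_commute)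

text \<open>The complex operator acts on real and imaginary parts separately, which is the form in
  which \<open>complexify\<close> evaluates a functional.\<close>

lemma bessel_op_weight_complex:
  assumes "m \<noteq> 0" "g \<in> schwartz"
  shows "bessel_op m s (\<lambda>x. of_real (weight r x) * g x) x =
    Complex (weighted_bessel m s r (\<lambda>x. Re (g x)) x) (weighted_bessel m s r (\<lambda>x. Im (g x)) x)"
proof -
  have re: "(\<lambda>x. complex_of_real (weight r x * Re (g x))) \<in> schwartz"
    and im: "(\<lambda>x. complex_of_real (weight r x * Im (g x))) \<in> schwartz"
    by (intro schwartz_of_real schwartz_weight_real schwartz_Re schwartz_Im assms)+
  have "(\<lambda>x. of_real (weight r x) * g x) =
      (\<lambda>x. of_real (weight r x * Re (g x)) + \<i> * of_real (weight r x * Im (g x)))"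
    by (auto simp: fun_eq_iff complex_eq_iff)
  then have "bessel_op m s (\<lambda>x. of_real (weight r x) * g x) x =
      bessel_op m s (\<lambda>x. of_real (weight r x * Re (g x))) x + \<i> * bessel_op m s (\<lambda>x. of_real (weight r x * Im (g x))) x"
    by (simp only: bessel_op_add[OF assms(1) re schwartz_mult_complex[OF im]] bessel_op_cmult)
  then show ?thesis
    unfolding of_real_weighted_bessel[OF schwartz_Re[OF assms(2)], symmetric]
      of_real_weighted_bessel[OF schwartz_Im[OF assms(2)], symmetric]
    by (simp add: Complex_eq)
qed

section \<open>Square-integrable functions\<close>

lemma L2_measurable: "h \<in> L2 \<Longrightarrow> h \<in> borel_measurable borel"
  unfolding L2_def by simp

lemma L2_square_integrable: "h \<in> L2 \<Longrightarrow> integrable lborel (\<lambda>x. (h x)\<^sup>2)"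
  unfolding L2_def by simp

lemma L2_mult_integrable:
  assumes "f \<in> L2" "g \<in> L2"
  shows "integrable lborel (\<lambda>x. f x * g x)"
proof (rule Bochner_Integration.integrable_bound)
  show "integrable lborel (\<lambda>x. (f x)\<^sup>2 + (g x)\<^sup>2)"
    using assms by (intro Bochner_Integration.integrable_add L2_square_integrable)
  show "(\<lambda>x. f x * g x) \<in> borel_measurable lborel"
    using assms[THEN L2_measurable] by measurable
  show "AE x in lborel. norm (f x * g x) \<le> norm ((f x)\<^sup>2 + (g x)\<^sup>2)"
  proof (rule AE_I2)
    fix x
    have "2 * \<bar>f x\<bar> * \<bar>g x\<bar> \<le> (f x)\<^sup>2 + (g x)\<^sup>2"
      using sum_squares_bound[of "\<bar>f x\<bar>" "\<bar>g x\<bar>"] by simp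
    then have "\<bar>f x\<bar> * \<bar>g x\<bar> \<le> (f x)\<^sup>2 + (g x)\<^sup>2"
      using mult_nonneg_nonneg[of "\<bar>f x\<bar>" "\<bar>g x\<bar>"] by linarith
    then show "norm (f x * g x) \<le> norm ((f x)\<^sup>2 + (g x)\<^sup>2)" by (simp add: abs_mult)
  qed
qed

lemma L2_cmult:
  assumes "f \<in> L2"
  shows "(\<lambda>x. c * f x) \<in> L2"
  unfolding L2_def using L2_measurable[OF assms] L2_square_integrable[OF assms]
  by (auto simp: power_mult_distrib)

lemma L2_add:
  assumes "f \<in> L2" "g \<in> L2"
  shows "(\<lambda>x. f x + g x) \<in> L2"
proof -
  have "integrable lborel (\<lambda>x. (f x)\<^sup>2 + (g x)\<^sup>2 + 2 * (f x * g x))"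
    using assms
    by (intro Bochner_Integration.integrable_add integrable_mult_right L2_square_integrable L2_mult_integrable)
  then have "integrable lborel (\<lambda>x. (f x + g x)\<^sup>2)"
    by (simp add: power2_sum mult.assoc)
  then show ?thesis
    unfolding L2_def using assms[THEN L2_measurable] by auto
qed

lemma L2_zero: "(\<lambda>x. 0) \<in> L2"
  unfolding L2_def by simp

lemma L2_sum: "finite I \<Longrightarrow> (\<And>i. i \<in> I \<Longrightarrow> f i \<in> L2) \<Longrightarrow> (\<lambda>x. \<Sum>i\<in>I. f i x) \<in> L2"
  by (induction rule: finite_induct) (auto intro: L2_zero L2_add)

lemma schwartz_mult_integrable:
  fixes f g :: "'a::euclidean_space \<Rightarrow> 'b::{real_normed_field, banach, second_countable_topology}"
  assumes "f \<in> schwartz" "g \<in> schwartz"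
  shows "integrable lborel (\<lambda>x. f x * g x)"
proof -
  obtain C where C: "\<And>x. norm (f x) \<le> C"
    using schwartz_bound_norm[OF assms(1), of 0] by auto
  have "integrable lborel (\<lambda>x. C * norm (g x))"
    using schwartz_integrable[OF assms(2)] by auto
  then show ?thesis
  proof (rule Bochner_Integration.integrable_bound)
    show "(\<lambda>x. f x * g x) \<in> borel_measurable lborel"
      using assms[THEN schwartz_measurable] by measurable
    show "AE x in lborel. norm (f x * g x) \<le> norm (C * norm (g x))"
    proof (rule AE_I2)
      fix x
      have "norm (f x * g x) \<le> C * norm (g x)"
        unfolding norm_mult by (intro mult_right_mono C) auto
      then show "norm (f x * g x) \<le> norm (C * norm (g x))"
        using abs_ge_self[of "C * norm (g x)"] by (metis order_trans real_norm_def)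
    qed
  qed
qed

lemma schwartz_L2: "f \<in> schwartz \<Longrightarrow> f \<in> L2"
  unfolding L2_def using schwartz_mult_integrable[of f f] schwartz_measurable[of f]
  by (simp add: power2_eq_square)

text \<open>The squared norm of \<open>e i\<close> stays in the formula because the vectors may
  vanish.\<close>

lemma orthogonal_sum_inner:
  fixes e :: "nat \<Rightarrow> 'a::euclidean_space \<Rightarrow> real"
  assumes e: "\<And>i. e i \<in> L2" and "finite I"
    and orth: "\<And>i j. i \<noteq> j \<Longrightarrow> (\<integral>x. e i x * e j x \<partial>lborel) = 0"
  shows "(\<integral>x. e i x * (\<Sum>j\<in>I. c j * e j x) \<partial>lborel) =
    (if i \<in> I then c i * (\<integral>x. e i x * e i x \<partial>lborel) else 0)"
proof -
  have "(\<integral>x. e i x * (\<Sum>j\<in>I. c j * e j x) \<partial>lborel) = (\<integral>x. (\<Sum>j\<in>I. c j * (e i x * e j x)) \<partial>lborel)"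
    unfolding sum_distrib_left by (simp only: mult.left_commute)
  also have "\<dots> = (\<Sum>j\<in>I. (\<integral>x. c j * (e i x * e j x) \<partial>lborel))"
    by (intro Bochner_Integration.integral_sum integrable_mult_right L2_mult_integrable e)
  also have "\<dots> = (\<Sum>j\<in>I. if j = i then c i * (\<integral>x. e i x * e i x \<partial>lborel) else 0)"
    by (intro sum.cong refl) (auto simp: orth)
  finally show ?thesis using \<open>finite I\<close> by simp
qed

text \<open>Pythagoras; the bound on the norms turns the equality into an inequality.\<close>

lemma orthogonal_sum_square:
  fixes e :: "nat \<Rightarrow> 'a::euclidean_space \<Rightarrow> real"
  assumes e: "\<And>i. e i \<in> L2" and I: "finite I"
    and orth: "\<And>i j. i \<noteq> j \<Longrightarrow> (\<integral>x. e i x * e j x \<partial>lborel) = 0"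
    and nrm: "\<And>i. (\<integral>x. e i x * e i x \<partial>lborel) \<le> 1"
  shows "(\<integral>x. (\<Sum>j\<in>I. c j * e j x)\<^sup>2 \<partial>lborel) \<le> (\<Sum>i\<in>I. (c i)\<^sup>2)"
proof -
  define S where "S x = (\<Sum>j\<in>I. c j * e j x)" for x
  have S: "S \<in> L2" unfolding S_def by (intro L2_sum L2_cmult e I)
  have "(\<integral>x. (S x)\<^sup>2 \<partial>lborel) = (\<integral>x. (\<Sum>i\<in>I. c i * (e i x * S x)) \<partial>lborel)"
    unfolding power2_eq_square by (subst (1) S_def) (simp only: sum_distrib_right mult.assoc)
  also have "\<dots> = (\<Sum>i\<in>I. (\<integral>x. c i * (e i x * S x) \<partial>lborel))"
    by (intro Bochner_Integration.integral_sum integrable_mult_right L2_mult_integrable e S)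
  also have "\<dots> = (\<Sum>i\<in>I. (c i)\<^sup>2 * (\<integral>x. e i x * e i x \<partial>lborel))"
  proof (intro sum.cong refl)
    fix i assume "i \<in> I"
    moreover have "(\<integral>x. e i x * S x \<partial>lborel) = (if i \<in> I then c i * (\<integral>x. e i x * e i x \<partial>lborel) else 0)"
      unfolding S_def by (rule orthogonal_sum_inner) (use e I orth in auto)
    ultimately show "(\<integral>x. c i * (e i x * S x) \<partial>lborel) = (c i)\<^sup>2 * (\<integral>x. e i x * e i x \<partial>lborel)"
      by (simp add: power2_eq_square)
  qed
  also have "\<dots> \<le> (\<Sum>i\<in>I. (c i)\<^sup>2)"
    using nrm by (intro sum_mono mult_left_le) auto
  finally show ?thesis unfolding S_def .
qed

text \<open>Normalisation only up to \<open>\<le> 1\<close> lets the family contain zeros.\<close>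

lemma bessel_inequality:
  fixes e :: "nat \<Rightarrow> 'a::euclidean_space \<Rightarrow> real"
  assumes e: "\<And>i. e i \<in> L2" and k: "k \<in> L2"
    and orth: "\<And>i j. i \<noteq> j \<Longrightarrow> (\<integral>x. e i x * e j x \<partial>lborel) = 0"
    and nrm: "\<And>i. (\<integral>x. e i x * e i x \<partial>lborel) \<le> 1"
  shows "(\<Sum>i<n. (\<integral>x. k x * e i x \<partial>lborel)\<^sup>2) \<le> (\<integral>x. (k x)\<^sup>2 \<partial>lborel)"
proof -
  define c where "c i = (\<integral>x. k x * e i x \<partial>lborel)" for i
  define S where "S x = (\<Sum>i<n. c i * e i x)" for x
  have S: "S \<in> L2" unfolding S_def by (intro L2_sum L2_cmult e finite_lessThan)
  have kS: "(\<integral>x. k x * S x \<partial>lborel) = (\<Sum>i<n. (c i)\<^sup>2)"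
  proof -
    have "(\<integral>x. k x * S x \<partial>lborel) = (\<integral>x. (\<Sum>i<n. c i * (k x * e i x)) \<partial>lborel)"
      unfolding S_def sum_distrib_left by (simp only: mult.left_commute)
    also have "\<dots> = (\<Sum>i<n. (\<integral>x. c i * (k x * e i x) \<partial>lborel))"
      by (intro Bochner_Integration.integral_sum integrable_mult_right L2_mult_integrable e k)
    also have "\<dots> = (\<Sum>i<n. (c i)\<^sup>2)" by (simp add: c_def power2_eq_square)
    finally show ?thesis .
  qed
  have SS: "(\<integral>x. (S x)\<^sup>2 \<partial>lborel) \<le> (\<Sum>i<n. (c i)\<^sup>2)"
    unfolding S_def by (rule orthogonal_sum_square) (use e orth nrm in auto)
  \<comment> \<open>Expanding the square gives the claim: the mixed term contributes twice the sum
    of the squared coefficients with a minus sign, and \<open>S\<close> itself contributes at most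
    that sum once.\<close>
  have "0 \<le> (\<integral>x. (k x - S x)\<^sup>2 \<partial>lborel)" by simp
  also have "\<dots> = (\<integral>x. (k x)\<^sup>2 - 2 * (k x * S x) + (S x)\<^sup>2 \<partial>lborel)"
    by (simp add: power2_diff algebra_simps)
  also have "\<dots> = (\<integral>x. (k x)\<^sup>2 \<partial>lborel) - 2 * (\<integral>x. k x * S x \<partial>lborel) + (\<integral>x. (S x)\<^sup>2 \<partial>lborel)"
    using L2_square_integrable[OF k] L2_mult_integrable[OF k S] L2_square_integrable[OF S] by simp
  finally show ?thesis using kS SS unfolding c_def by linarith
qed

section \<open>The covariance\<close>

text \<open>Comparison with mass 1: the base is at least \<open>min 1 (m^2)\<close> times
  \<open>1 + |p|^2\<close>, and the negative exponent reverses the inequality.\<close>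

lemma integrable_bessel_symbol:
  assumes "m \<noteq> 0" and s: "s > real DIM('a::euclidean_space) / 2"
  shows "integrable lborel (bessel_symbol m (- s) :: 'a \<Rightarrow> real)"
proof -
  define c where "c = min 1 (m\<^sup>2)"
  have c: "c > 0" "c \<le> 1" "c \<le> m\<^sup>2" unfolding c_def using assms(1) by auto
  have s0: "s > 0" using s DIM_positive[where 'a='a]
    by (smt (verit) divide_nonneg_nonneg of_nat_0_le_iff)
  have "bessel_symbol m (- s) p \<le> c powr (- s) * weight (- s) p" for p :: 'a
  proof -
    have "c * (1 + (norm p)\<^sup>2) \<le> m\<^sup>2 + (norm p)\<^sup>2"
      using c mult_right_mono[of c 1 "(norm p)\<^sup>2"] by (simp add: distrib_left)
    moreover have "c * (1 + (norm p)\<^sup>2) > 0" using c by (simp add: add_pos_nonneg)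
    ultimately have "(m\<^sup>2 + (norm p)\<^sup>2) powr (- s) \<le> (c * (1 + (norm p)\<^sup>2)) powr (- s)"
      using s0 by (intro powr_mono2') auto
    then show ?thesis unfolding bessel_symbol_def weight_def using c by (simp add: powr_mult)
  qed
  moreover have "integrable lborel (\<lambda>p::'a. c powr (- s) * weight (- s) p)"
    by (intro integrable_mult_right integrable_weight s)
  ultimately show ?thesis
    using bessel_symbol_measurable[of m "- s"]
    by (elim Bochner_Integration.integrable_bound)
      (auto simp: bessel_symbol_nonneg weight_pos less_imp_le intro!: AE_I2)
qed

lemma inv_fourier_mult_formula:
  fixes f g :: "'a::euclidean_space \<Rightarrow> complex"
  assumes "integrable lborel f" and "integrable lborel g"
  shows "(\<integral>p. inv_fourier f p * g p \<partial>lborel) = (\<integral>x. f x * inv_fourier g x \<partial>lborel)"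
proof -
  have "(\<integral>p. inv_fourier f p * g p \<partial>lborel) = (\<integral>p. cnj (fourier (\<lambda>x. cnj (f x)) p * cnj (g p)) \<partial>lborel)"
    by (simp add: inv_fourier_conv_cnj)
  also have "\<dots> = cnj (\<integral>p. fourier (\<lambda>x. cnj (f x)) p * cnj (g p) \<partial>lborel)"
    by (rule Bochner_Integration.integral_cnj)
  also have "\<dots> = cnj (\<integral>x. cnj (f x) * fourier (\<lambda>p. cnj (g p)) x \<partial>lborel)"
    using assms by (subst fourier_mult_formula) auto
  also have "\<dots> = (\<integral>x. cnj (cnj (f x) * fourier (\<lambda>p. cnj (g p)) x) \<partial>lborel)"
    by (rule Bochner_Integration.integral_cnj[symmetric])
  finally show ?thesis by (simp add: inv_fourier_conv_cnj)
qed

text \<open>Parseval's identity, obtained from the multiplication formula: for a real function the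
  inverse transform is the conjugate of the transform, so pairing it with its image under the
  covariance operator gives a squared modulus in frequency space.\<close>

lemma covariance_weighted_bessel:
  fixes g :: "'a::euclidean_space \<Rightarrow> real" and \<beta> r :: real
  assumes m: "m \<noteq> 0" and g: "g \<in> schwartz"
  defines "f \<equiv> weighted_bessel m (- \<beta>) r g"
  shows "covariance m f f = 1/2 * (\<integral>p. bessel_symbol m (- (1/2 + 2 * \<beta>)) p *
    (norm (fourier (\<lambda>x. of_real (weight r x * g x)) p))\<^sup>2 \<partial>lborel)"
proof -
  define F where "F x = complex_of_real (f x)" for x
  define G where "G x = complex_of_real (weight r x * g x)" for x
  have G: "G \<in> schwartz" unfolding G_def by (intro schwartz_of_real schwartz_weight_real g)
  have F: "F \<in> schwartz" unfolding F_def f_def by (intro schwartz_of_real weighted_bessel_schwartz m g)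
  have "F = bessel_op m (- \<beta>) G"
    unfolding F_def G_def f_def using of_real_weighted_bessel[OF g] by auto
  also have "\<dots> = inv_fourier (\<lambda>p. of_real (bessel_symbol m (- \<beta>) p) * fourier G p)"
    by (intro bessel_op_conv_inv schwartz_measurable G)
  finally have fF: "fourier F p = of_real (bessel_symbol m (- \<beta>) p) * fourier G p" for p
    using fourier_inv_fourier[OF schwartz_bessel_symbol[OF m fourier_schwartz[OF G]]] by simp
  define v where "v p = complex_of_real (bessel_symbol m (- 1/2) p) * fourier F p" for p
  have v: "v \<in> schwartz" unfolding v_def by (intro schwartz_bessel_symbol m fourier_schwartz F)
  have iF: "inv_fourier F p = cnj (fourier F p)" for p
  proof -
    have "(\<lambda>y. cnj (F y)) = F" by (simp add: F_def[abs_def])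
    then show ?thesis by (simp add: inv_fourier_conv_cnj)
  qed
  have "f x * Re (fun_bessel m (- 1/2) F x) = Re (inv_fourier v x * F x)" for x
    unfolding fun_bessel_def v_def by (simp add: F_def)
  then have "(\<integral>x. f x * Re (fun_bessel m (- 1/2) F x) \<partial>lborel) = (\<integral>x. Re (inv_fourier v x * F x) \<partial>lborel)"
    by simp
  also have "\<dots> = Re (\<integral>x. inv_fourier v x * F x \<partial>lborel)"
    by (intro integral_Re schwartz_mult_integrable inv_fourier_schwartz v F)
  also have "(\<integral>x. inv_fourier v x * F x \<partial>lborel) = (\<integral>p. v p * cnj (fourier F p) \<partial>lborel)"
    by (subst inv_fourier_mult_formula) (auto intro: schwartz_integrable v F simp: iF)
  also have "\<dots> = (\<integral>p. complex_of_real (bessel_symbol m (- (1/2 + 2 * \<beta>)) p * (norm (fourier G p))\<^sup>2) \<partial>lborel)"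
  proof (intro Bochner_Integration.integral_cong refl)
    fix p :: 'a
    \<comment> \<open>The covariance contributes the exponent \<open>-1/2\<close>, and each of its
      two arguments contributes \<open>- \<beta>\<close>.\<close>
    have 1: "bessel_symbol m (- 1/2) p * (bessel_symbol m (- \<beta>) p * bessel_symbol m (- \<beta>) p) = bessel_symbol m (- (1/2 + 2 * \<beta>)) p"
      unfolding bessel_symbol_mult[OF m] by (simp add: algebra_simps)
    have "v p * cnj (fourier F p) = of_real (bessel_symbol m (- 1/2) p) * (fourier F p * cnj (fourier F p))"
      unfolding v_def by simp
    also have "fourier F p * cnj (fourier F p) = of_real ((bessel_symbol m (- \<beta>) p)\<^sup>2) * of_real ((norm (fourier G p))\<^sup>2)"
      unfolding complex_norm_square[symmetric] fF by (simp add: norm_mult power_mult_distrib bessel_symbol_nonneg)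
    finally show "v p * cnj (fourier F p) = of_real (bessel_symbol m (- (1/2 + 2 * \<beta>)) p * (norm (fourier G p))\<^sup>2)"
      unfolding 1[symmetric] by (simp add: power2_eq_square mult.assoc)
  qed
  also have "\<dots> = of_real (\<integral>p. bessel_symbol m (- (1/2 + 2 * \<beta>)) p * (norm (fourier G p))\<^sup>2 \<partial>lborel)"
    by (rule integral_complex_of_real)
  finally show ?thesis unfolding covariance_def F_def[symmetric] G_def by simp
qed

text \<open>The operator \<open>(m\<^sup>2 - \<Delta>)\<^bsup>-1/4-\<beta>\<^esup> (1 + x\<^sup>2)\<^bsup>-\<alpha>\<^esup>\<close> is Hilbert-Schmidt: its kernel is the product of a
  function of \<open>p\<close>, a function of \<open>x\<close> and a phase, and the two exponents are exactly what
  makes both factors square-integrable.\<close>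

lemma covariance_sum_bounded:
  fixes e :: "nat \<Rightarrow> 'a::euclidean_space \<Rightarrow> real"
  assumes m: "m \<noteq> 0" and \<alpha>: "\<alpha> > real DIM('a) / 4" and \<beta>: "\<beta> > (real DIM('a) - 1) / 4"
    and e: "\<And>i. e i \<in> schwartz"
    and orth: "\<And>i j. i \<noteq> j \<Longrightarrow> (\<integral>x. e i x * e j x \<partial>lborel) = 0"
    and nrm: "\<And>i. (\<integral>x. e i x * e i x \<partial>lborel) \<le> 1"
  obtains B where "\<And>n. (\<Sum>i<n. covariance m (weighted_bessel m (- \<beta>) (- \<alpha>) (e i)) (weighted_bessel m (- \<beta>) (- \<alpha>) (e i))) \<le> B"
proof -
  define c where "c = (2 * pi) powr (- real DIM('a) / 2)"
  define w where "w = (weight (- \<alpha>) :: 'a \<Rightarrow> real)"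
  define \<sigma> where "\<sigma> = (bessel_symbol m (- (1/2 + 2 * \<beta>)) :: 'a \<Rightarrow> real)"
  define W where "W = (\<integral>(x::'a). (w x)\<^sup>2 \<partial>lborel)"
  define H where "H i p = fourier (\<lambda>x. of_real (w x * e i x)) p" for i p
  have wm [measurable]: "w \<in> borel_measurable borel" unfolding w_def by (rule weight_measurable)
  have w2: "(w x)\<^sup>2 = weight (- (2 * \<alpha>)) x" for x
    unfolding w_def weight_def by (simp add: powr_power power2_eq_square flip: powr_add)
  \<comment> \<open>The integrability threshold \<open>2 * \<alpha> > d/2\<close> is the hypothesis
    on \<alpha>.\<close>
  have wint: "integrable lborel (\<lambda>x. (w x)\<^sup>2)"
    unfolding w2 using \<alpha> by (intro integrable_weight) auto
  \<comment> \<open>The integrability threshold \<open>1/2 + 2 * \<beta> > d/2\<close> is the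
    hypothesis on \<beta>.\<close>
  have \<sigma>int: "integrable lborel \<sigma>"
    unfolding \<sigma>_def using \<beta> by (intro integrable_bessel_symbol m) auto
  have H: "H i \<in> schwartz" for i
    unfolding H_def[abs_def] w_def by (intro fourier_schwartz schwartz_of_real schwartz_weight_real e)
  have Hint: "integrable lborel (\<lambda>p. \<sigma> p * (norm (H i p))\<^sup>2)" for i
  proof -
    obtain C where C: "\<And>p. norm (H i p) \<le> C" using schwartz_bound_norm[OF H, of 0] by auto
    have "integrable lborel (\<lambda>p. \<sigma> p * C\<^sup>2)" using \<sigma>int by auto
    then show ?thesis
    proof (rule Bochner_Integration.integrable_bound)
      show "(\<lambda>p. \<sigma> p * (norm (H i p))\<^sup>2) \<in> borel_measurable lborel"
        using schwartz_measurable[OF H[of i]] \<sigma>int by measurable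
      show "AE p in lborel. norm (\<sigma> p * (norm (H i p))\<^sup>2) \<le> norm (\<sigma> p * C\<^sup>2)"
        by (rule AE_I2) (auto simp: abs_mult intro!: mult_left_mono power_mono C)
    qed
  qed
  \<comment> \<open>For fixed \<open>p\<close> the values \<open>H i p\<close> are, up to
    \<open>c\<close>, the coefficients of the \<open>e i\<close> against \<open>w\<close> times a
    character. Bessel's inequality is applied to the cosine and sine parts separately, and
    \<open>cos^2 + sin^2 = 1\<close> makes the bound independent of \<open>p\<close> and
    \<open>n\<close>.\<close>
  have pt: "(\<Sum>i<n. (norm (H i p))\<^sup>2) \<le> c\<^sup>2 * W" for n p
  proof -
    define kc ks where "kc x = cos (p \<bullet> x) * w x" and "ks x = sin (p \<bullet> x) * w x" for x
    have [measurable]: "kc \<in> borel_measurable borel" "ks \<in> borel_measurable borel"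
      unfolding kc_def[abs_def] ks_def[abs_def] by measurable
    have kc: "kc \<in> L2" and ks: "ks \<in> L2"
      unfolding L2_def
      by (auto intro!: Bochner_Integration.integrable_bound[OF wint] AE_I2
          simp: kc_def ks_def power_mult_distrib mult_left_le_one_le abs_square_le_1)
    have Hi: "(norm (H i p))\<^sup>2 = c\<^sup>2 * ((\<integral>x. kc x * e i x \<partial>lborel)\<^sup>2 + (\<integral>x. ks x * e i x \<partial>lborel)\<^sup>2)" for i
    proof -
      define I where "I x = exp (- \<i> * of_real (p \<bullet> x)) * complex_of_real (w x * e i x)" for x
      have I: "integrable lborel I"
        unfolding I_def w_def by (intro integrable_exp_mult schwartz_integrable schwartz_of_real schwartz_weight_real e)
      have "Re (I x) = kc x * e i x" "Im (I x) = - (ks x * e i x)" for x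
        unfolding I_def kc_def ks_def by (simp_all add: Re_exp Im_exp)
      then have "Re (integral\<^sup>L lborel I) = (\<integral>x. kc x * e i x \<partial>lborel)"
        "Im (integral\<^sup>L lborel I) = - (\<integral>x. ks x * e i x \<partial>lborel)"
        using integral_Re[OF I] integral_Im[OF I] by simp_all
      then have "(norm (integral\<^sup>L lborel I))\<^sup>2 = (\<integral>x. kc x * e i x \<partial>lborel)\<^sup>2 + (\<integral>x. ks x * e i x \<partial>lborel)\<^sup>2"
        unfolding cmod_power2 by simp
      moreover have "H i p = of_real c * integral\<^sup>L lborel I"
        unfolding H_def fourier_def c_def I_def ..
      ultimately show ?thesis by (simp add: norm_mult power_mult_distrib)
    qed
    have "(\<Sum>i<n. (norm (H i p))\<^sup>2) = c\<^sup>2 * ((\<Sum>i<n. (\<integral>x. kc x * e i x \<partial>lborel)\<^sup>2) + (\<Sum>i<n. (\<integral>x. ks x * e i x \<partial>lborel)\<^sup>2))"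
      unfolding Hi by (simp only: sum_distrib_left[symmetric] sum.distrib)
    also have "\<dots> \<le> c\<^sup>2 * ((\<integral>x. (kc x)\<^sup>2 \<partial>lborel) + (\<integral>x. (ks x)\<^sup>2 \<partial>lborel))"
      using e orth nrm kc ks by (intro mult_left_mono add_mono bessel_inequality) (auto intro: schwartz_L2)
    also have "(\<integral>x. (kc x)\<^sup>2 \<partial>lborel) + (\<integral>x. (ks x)\<^sup>2 \<partial>lborel) = (\<integral>x. (kc x)\<^sup>2 + (ks x)\<^sup>2 \<partial>lborel)"
      using L2_square_integrable[OF kc] L2_square_integrable[OF ks] by simp
    also have "\<dots> = W"
      unfolding W_def kc_def ks_def power_mult_distrib distrib_right[symmetric] by (simp add: add.commute)
    finally show ?thesis .
  qed
  have "(\<Sum>i<n. covariance m (weighted_bessel m (- \<beta>) (- \<alpha>) (e i)) (weighted_bessel m (- \<beta>) (- \<alpha>) (e i)))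
      \<le> 1/2 * (\<integral>p. \<sigma> p * (c\<^sup>2 * W) \<partial>lborel)" for n
  proof -
    have "(\<Sum>i<n. covariance m (weighted_bessel m (- \<beta>) (- \<alpha>) (e i)) (weighted_bessel m (- \<beta>) (- \<alpha>) (e i)))
        = (\<Sum>i<n. 1/2 * (\<integral>p. \<sigma> p * (norm (H i p))\<^sup>2 \<partial>lborel))"
      unfolding covariance_weighted_bessel[OF m e] \<sigma>_def H_def w_def ..
    also have "\<dots> = 1/2 * (\<integral>p. (\<Sum>i<n. \<sigma> p * (norm (H i p))\<^sup>2) \<partial>lborel)"
      using Hint by (simp add: sum_distrib_left)
    also have "\<dots> \<le> 1/2 * (\<integral>p. \<sigma> p * (c\<^sup>2 * W) \<partial>lborel)"
    proof (intro mult_left_mono integral_mono)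
      show "integrable lborel (\<lambda>p. \<Sum>i<n. \<sigma> p * (norm (H i p))\<^sup>2)" using Hint by auto
      show "integrable lborel (\<lambda>p. \<sigma> p * (c\<^sup>2 * W))" using \<sigma>int by auto
      show "(\<Sum>i<n. \<sigma> p * (norm (H i p))\<^sup>2) \<le> \<sigma> p * (c\<^sup>2 * W)" for p
        unfolding sum_distrib_left[symmetric] by (intro mult_left_mono pt) (simp add: \<sigma>_def bessel_symbol_nonneg)
    qed auto
    finally show ?thesis .
  qed
  then show ?thesis using that by blast
qed

section \<open>Separability of the Schwartz space\<close>

lemma partial_deriv_diff:
  assumes "f \<in> schwartz" "g \<in> schwartz" "bs \<in> lists Basis"
  shows "partial_deriv bs (\<lambda>x. f x - g x) = (\<lambda>x. partial_deriv bs f x - partial_deriv bs g x)"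
  using assms(3)
proof (induction bs)
  case Nil
  then show ?case by simp
next
  case (Cons b bs)
  then have bs: "bs \<in> lists Basis" by auto
  note f' = schwartz_has_derivative[OF schwartz_partial_deriv[OF assms(1) bs]]
  note g' = schwartz_has_derivative[OF schwartz_partial_deriv[OF assms(2) bs]]
  show ?case
    unfolding partial_deriv.simps Cons.IH
    using frechet_derivative_at[OF has_derivative_diff[OF f' g']] by (simp add: fun_eq_iff)
qed

lemma schwartz_seminorm_upper:
  assumes "f \<in> schwartz" "bs \<in> lists Basis"
  shows "norm x ^ k * norm (partial_deriv bs f x) \<le> schwartz_seminorm k bs f"
proof -
  obtain C where "\<And>x. norm x ^ k * norm (partial_deriv bs f x) \<le> C"
    using schwartz_bound_norm[OF schwartz_partial_deriv[OF assms]] by blast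
  then have "bdd_above (range (\<lambda>x. norm x ^ k * norm (partial_deriv bs f x)))"
    by (intro bdd_aboveI2)
  then show ?thesis unfolding schwartz_seminorm_def by (rule cSUP_upper[OF UNIV_I])
qed

lemma schwartz_seminorm_leI:
  "(\<And>x. norm x ^ k * norm (partial_deriv bs f x) \<le> r) \<Longrightarrow> schwartz_seminorm k bs f \<le> r"
  unfolding schwartz_seminorm_def by (rule cSUP_least) auto

lemma schwartz_seminorm_triangle:
  assumes "f \<in> schwartz" "g \<in> schwartz" "h \<in> schwartz" "bs \<in> lists Basis"
  shows "schwartz_seminorm k bs (\<lambda>x. f x - h x) \<le>
    schwartz_seminorm k bs (\<lambda>x. f x - g x) + schwartz_seminorm k bs (\<lambda>x. g x - h x)"
proof (rule schwartz_seminorm_leI)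
  fix x
  let ?D = "\<lambda>f. partial_deriv bs f x"
  have "norm x ^ k * norm (?D (\<lambda>x. f x - h x)) = norm x ^ k * norm ((?D f - ?D g) + (?D g - ?D h))"
    using assms by (simp add: partial_deriv_diff)
  also have "\<dots> \<le> norm x ^ k * (norm (?D f - ?D g) + norm (?D g - ?D h))"
    by (intro mult_left_mono norm_triangle_ineq) auto
  also have "\<dots> = norm x ^ k * norm (?D (\<lambda>x. f x - g x)) + norm x ^ k * norm (?D (\<lambda>x. g x - h x))"
    using assms by (simp add: partial_deriv_diff distrib_left)
  also have "\<dots> \<le> schwartz_seminorm k bs (\<lambda>x. f x - g x) + schwartz_seminorm k bs (\<lambda>x. g x - h x)"
    using assms by (intro add_mono schwartz_seminorm_upper schwartz_diff)
  finally show "norm x ^ k * norm (?D (\<lambda>x. f x - h x)) \<le> \<dots>" .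
qed

lemma schwartz_seminorm_self:
  assumes "f \<in> schwartz" "bs \<in> lists Basis"
  shows "schwartz_seminorm k bs (\<lambda>x. f x - f x) = 0"
  unfolding schwartz_seminorm_def partial_deriv_diff[OF assms(1,1,2)] by simp

abbreviation schwartz_close :: "(nat \<times> 'a list) set \<Rightarrow> real \<Rightarrow>
    ('a::euclidean_space \<Rightarrow> 'b::real_normed_vector) \<Rightarrow> ('a \<Rightarrow> 'b) \<Rightarrow> bool"
  where "schwartz_close L r f g \<equiv> \<forall>(k, bs)\<in>L. schwartz_seminorm k bs (\<lambda>x. f x - g x) < r"

text \<open>Closeness in the graph topology of \<open>A\<close>, to precision \<open>r\<close> in
  the seminorms listed in \<open>L\<close>.\<close>

abbreviation schwartz_graph_close :: "(('a \<Rightarrow> 'b) \<Rightarrow> 'a \<Rightarrow> 'b) \<Rightarrow> (nat \<times> 'a list) set \<Rightarrow> real \<Rightarrow>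
    ('a::euclidean_space \<Rightarrow> 'b::real_normed_vector) \<Rightarrow> ('a \<Rightarrow> 'b) \<Rightarrow> bool"
  where "schwartz_graph_close A L r f g \<equiv> \<forall>(k, bs)\<in>L.
    schwartz_seminorm k bs (\<lambda>x. f x - g x) < r \<and> schwartz_seminorm k bs (\<lambda>x. A f x - A g x) < r"

lemma schwartz_close_mono:
  assumes "schwartz_close L r f g" "L' \<subseteq> L" "r \<le> r'"
  shows "schwartz_close L' r' f g"
proof
  fix q assume "q \<in> L'"
  with assms(2) have "q \<in> L" by blast
  from bspec[OF assms(1) this] show "case q of (k, bs) \<Rightarrow> schwartz_seminorm k bs (\<lambda>x. f x - g x) < r'"
    using assms(3) by (simp add: split_beta)
qed

text \<open>The generating sets are seminorm balls with arbitrary centres. By the triangle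
  inequality such a ball contains one centred at \<open>f\<close>, with the leftover radius; a
  finite intersection takes the union of the seminorms and the smaller radius.\<close>

lemma schwartz_topology_neighbourhood:
  assumes "openin schwartz_topology U" "f \<in> U" "f \<in> schwartz"
  shows "\<exists>L r. finite L \<and> L \<subseteq> UNIV \<times> lists Basis \<and> 0 < r \<and>
    (\<forall>g\<in>schwartz. (schwartz_close L r g f) \<longrightarrow> g \<in> U)"
proof -
  have "generate_topology_on {{g \<in> schwartz. schwartz_seminorm k bs (\<lambda>x. g x - f x) < r} | k bs f r.
       bs \<in> lists Basis \<and> f \<in> schwartz \<and> 0 < r} U"
    using assms(1) unfolding schwartz_topology_def openin_topology_generated_by_iff .
  then show ?thesis using assms(2)
  proof induction
    case Empty
    then show ?case by simp
  next
    case (Int a b)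
    then have "f \<in> a" "f \<in> b" by auto
    from Int.IH(1)[OF this(1)] obtain L r where *: "finite L" "L \<subseteq> UNIV \<times> lists Basis" "0 < r"
      "\<forall>g\<in>schwartz. schwartz_close L r g f \<longrightarrow> g \<in> a" by (elim exE conjE)
    from Int.IH(2)[OF \<open>f \<in> b\<close>] obtain L' r' where **: "finite L'" "L' \<subseteq> UNIV \<times> lists Basis" "0 < r'"
      "\<forall>g\<in>schwartz. schwartz_close L' r' g f \<longrightarrow> g \<in> b" by (elim exE conjE)
    show ?case
    proof (intro exI[of _ "L \<union> L'"] exI[of _ "min r r'"] conjI ballI impI)
      fix g assume g: "g \<in> schwartz" "schwartz_close (L \<union> L') (min r r') g f"
      from g(2) have "schwartz_close L r g f" by (rule schwartz_close_mono) auto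
      then have "g \<in> a" using bspec[OF *(4) g(1)] by (rule rev_mp)
      moreover from g(2) have "schwartz_close L' r' g f" by (rule schwartz_close_mono) auto
      then have "g \<in> b" using bspec[OF **(4) g(1)] by (rule rev_mp)
      ultimately show "g \<in> a \<inter> b" by simp
    qed (use * ** in auto)
  next
    case (UN K)
    then obtain a where "a \<in> K" "f \<in> a" by blast
    from UN.IH[OF this] obtain L r where *: "finite L" "L \<subseteq> UNIV \<times> lists Basis" "0 < r"
      "\<forall>g\<in>schwartz. schwartz_close L r g f \<longrightarrow> g \<in> a" by (elim exE conjE)
    show ?case
      using *(4) \<open>a \<in> K\<close> by (intro exI[of _ L] exI[of _ r] conjI *(1-3)) blast
  next
    case (Basis s)
    then obtain k bs f0 r where s: "s = {g \<in> schwartz. schwartz_seminorm k bs (\<lambda>x. g x - f0 x) < r}"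
      and *: "bs \<in> lists Basis" "f0 \<in> schwartz" by blast
    define d where "d = r - schwartz_seminorm k bs (\<lambda>x. f x - f0 x)"
    have "d > 0" using Basis.prems s by (simp add: d_def)
    moreover have "g \<in> s" if "g \<in> schwartz" "schwartz_seminorm k bs (\<lambda>x. g x - f x) < d" for g
      using schwartz_seminorm_triangle[OF that(1) assms(3) *(2,1), of k] that by (simp add: s d_def)
    ultimately show ?case using *
      by (intro exI[of _ "{(k, bs)}"] exI[of _ d]) auto
  qed
qed

lemma topspace_schwartz_topology: "topspace schwartz_topology = schwartz"
proof -
  have "f \<in> \<Union> {{g \<in> schwartz. schwartz_seminorm k bs (\<lambda>x. g x - f x) < r} | k bs f r.
       bs \<in> lists Basis \<and> f \<in> schwartz \<and> 0 < r}" if "f \<in> schwartz" for f :: "'a \<Rightarrow> 'b"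
  proof -
    have "f \<in> {g \<in> schwartz. schwartz_seminorm 0 [] (\<lambda>x. g x - f x) < 1}"
      using that schwartz_seminorm_self[OF that, of "[]" 0] by simp
    moreover have "([] :: 'a list) \<in> lists Basis" by simp
    ultimately show ?thesis using that zero_less_one by blast
  qed
  then show ?thesis unfolding schwartz_topology_def topology_generated_by_topspace by blast
qed

text \<open>Continuity in epsilon form. The seminorms and the radius depend on \<phi>, so density is
  needed for all finite families of seminorms.\<close>

lemma tempered_distribution_continuous:
  assumes "\<phi> \<in> tempered_distributions" "f \<in> schwartz" "0 < \<epsilon>"
  shows "\<exists>L r. finite L \<and> L \<subseteq> UNIV \<times> lists Basis \<and> 0 < r \<and>
    (\<forall>g\<in>schwartz. (schwartz_close L r g f) \<longrightarrow> \<bar>\<phi> g - \<phi> f\<bar> < \<epsilon>)"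
proof -
  have "openin schwartz_topology {g \<in> topspace schwartz_topology. \<phi> g \<in> ball (\<phi> f) \<epsilon>}"
    using assms(1) unfolding tempered_distributions_def
    by (intro openin_continuous_map_preimage[where Y = euclideanreal]) auto
  from schwartz_topology_neighbourhood[OF this _ assms(2)] assms(2,3)
  show ?thesis
    unfolding topspace_schwartz_topology by (simp add: dist_real_def abs_minus_commute)
qed

text \<open>Countable covers by sets of small diameter, as in the theorem of Arzela and Ascoli: on
  functions with a common Lipschitz constant and decay rate, the values on a finite grid, rounded
  to finite precision, determine a seminorm up to a small error.\<close>

lemma schwartz_countable_cover_seminorm:
  fixes r :: real
  assumes bs: "bs \<in> lists Basis" and r: "r > 0"
  shows "\<exists>\<U>. countable \<U> \<and> (schwartz :: ('a::euclidean_space \<Rightarrow> real) set) = \<Union> \<U> \<and>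
    (\<forall>U\<in>\<U>. \<forall>f\<in>U. \<forall>g\<in>U. schwartz_seminorm k bs (\<lambda>x. f x - g x) < r)"
proof -
  define D where "D f = partial_deriv bs f" for f :: "'a \<Rightarrow> real"
  \<comment> \<open>Every Schwartz function lies in some \<open>S R\<close>. The decay is one power
    better than the seminorm demands, so that the weighted values are uniformly small far
    out.\<close>
  define S where "S R = {f \<in> schwartz. (\<forall>x y. \<bar>D f x - D f y\<bar> \<le> real R * norm (x - y)) \<and>
    (\<forall>x. norm x ^ Suc k * \<bar>D f x\<bar> \<le> real R)}" for R
  have S_all: "f \<in> (\<Union>R. S R)" if f: "f \<in> schwartz" for f
  proof -
    have Df: "D f \<in> schwartz" unfolding D_def by (rule schwartz_partial_deriv[OF f bs])
    obtain C1 where C1: "C1 > 0" "\<And>x y. norm (D f x - D f y) \<le> C1 * norm (x - y)"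
      using schwartz_lipschitz[OF Df] by blast
    obtain C2 where C2: "\<And>x. norm x ^ Suc k * norm (D f x) \<le> C2"
      using schwartz_bound_norm[OF Df] by blast
    obtain R :: nat where R: "max C1 C2 \<le> R" by (meson real_arch_simple)
    have "\<bar>D f x - D f y\<bar> \<le> real R * norm (x - y)" for x y
    proof -
      have "\<bar>D f x - D f y\<bar> \<le> C1 * norm (x - y)" using C1(2)[of x y] by simp
      also have "\<dots> \<le> real R * norm (x - y)" using R by (intro mult_right_mono) auto
      finally show ?thesis .
    qed
    moreover have "norm x ^ Suc k * \<bar>D f x\<bar> \<le> real R" for x
      using C2[of x] R by simp
    ultimately show ?thesis unfolding S_def using f by blast
  qed
  have "\<exists>\<U>. countable \<U> \<and> S R = \<Union> \<U> \<and>
    (\<forall>U\<in>\<U>. \<forall>f\<in>U. \<forall>g\<in>U. schwartz_seminorm k bs (\<lambda>x. f x - g x) < r)" for R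
  proof -
    \<comment> \<open>Beyond radius \<open>l\<close> the weighted difference of two members of
      \<open>S R\<close> is at most \<open>2 * R / l\<close>, and this choice makes it at most
      \<open>r / 2\<close>.\<close>
    define l where "l = max 1 (4 * real R / r)"
    have l: "l \<ge> 1" "4 * real R / r \<le> l" unfolding l_def by auto
    \<comment> \<open>Mesh of the grid and rounding precision in one. Inside the ball the error is
      \<open>2 * R * \<delta>\<close> from moving to a grid point plus \<delta> from rounding, and
      \<delta> makes the weighted total equal to \<open>r / 2\<close>.\<close>
    define \<delta> where "\<delta> = r / (2 * l ^ k * (2 * real R + 1))"
    have \<delta>: "\<delta> > 0" unfolding \<delta>_def using r l by (auto intro!: divide_pos_pos mult_pos_pos)
    have \<delta>': "l ^ k * (2 * R * \<delta> + \<delta>) = r / 2"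
    proof -
      have *: "a * (b * (r / (2 * a * b))) = r / 2" if "a > 0" "b > 0" for a b :: real
        using that by simp
      have "2 * R * \<delta> + \<delta> = (2 * real R + 1) * \<delta>" by (simp add: distrib_right)
      then have "l ^ k * (2 * R * \<delta> + \<delta>) = l ^ k * ((2 * real R + 1) * \<delta>)" by (simp only:)
      also have "\<dots> = r / 2" unfolding \<delta>_def using l by (intro *) auto
      finally show ?thesis .
    qed
    obtain X where X: "finite X" "cball (0::'a) l \<subseteq> (\<Union>x\<in>X. ball x \<delta>)"
      using compact_cball[of "0::'a" l] \<delta> unfolding compact_eq_totally_bounded by blast
    \<comment> \<open>\<open>q\<close> records the values on the grid rounded down to multiples of
      \<delta>. There are countably many such tables, since the grid is finite and the entries are
      integers.\<close>
    define U where "U q = {f \<in> S R. \<forall>x\<in>X. \<lfloor>D f x / \<delta>\<rfloor> = q x}" for q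
    define Q where "Q = PiE X (\<lambda>_. UNIV :: int set)"
    have "countable (U ` Q)"
      unfolding Q_def using X(1) by (intro countable_image countable_PiE) auto
    moreover have "S R = \<Union> (U ` Q)"
    proof -
      have "f \<in> U (\<lambda>x\<in>X. \<lfloor>D f x / \<delta>\<rfloor>)" "(\<lambda>x\<in>X. \<lfloor>D f x / \<delta>\<rfloor>) \<in> Q" if "f \<in> S R" for f
        using that unfolding U_def Q_def by auto
      then show ?thesis unfolding U_def by blast
    qed
    moreover have "schwartz_seminorm k bs (\<lambda>x. f x - g x) < r" if "f \<in> U q" "g \<in> U q" for f g q
    proof -
      have fs: "f \<in> S R" "g \<in> S R" and eq: "\<And>x. x \<in> X \<Longrightarrow> \<lfloor>D f x / \<delta>\<rfloor> = \<lfloor>D g x / \<delta>\<rfloor>"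
        using that unfolding U_def by auto
      have "norm x ^ k * \<bar>D f x - D g x\<bar> \<le> r / 2" for x
      proof (cases "norm x \<le> l")
        case True
        then obtain x0 where x0: "x0 \<in> X" "dist x0 x < \<delta>" using X(2) by (auto simp: mem_ball)
        have "\<bar>D f x0 / \<delta> - D g x0 / \<delta>\<bar> < 1" using eq[OF x0(1)] by linarith
        then have "\<bar>D f x0 - D g x0\<bar> / \<delta> < 1"
          using \<delta> by (simp add: diff_divide_distrib[symmetric] abs_divide)
        then have 1: "\<bar>D f x0 - D g x0\<bar> \<le> \<delta>" using \<delta> by simp
        have "\<bar>D f x - D f x0\<bar> \<le> R * norm (x - x0)" "\<bar>D g x - D g x0\<bar> \<le> R * norm (x - x0)"
          using fs unfolding S_def by auto
        moreover have "R * norm (x - x0) \<le> R * \<delta>"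
          using x0 by (intro mult_left_mono) (auto simp: dist_norm norm_minus_commute)
        ultimately have "\<bar>D f x - D g x\<bar> \<le> 2 * R * \<delta> + \<delta>" using 1 by linarith
        then have "norm x ^ k * \<bar>D f x - D g x\<bar> \<le> l ^ k * (2 * R * \<delta> + \<delta>)"
          using True l by (intro mult_mono power_mono) auto
        then show ?thesis unfolding \<delta>' .
      next
        case False
        then have x: "norm x > l" "norm x > 0" using l by auto
        have "norm x * (norm x ^ k * \<bar>D f x - D g x\<bar>) \<le> norm x ^ Suc k * (\<bar>D f x\<bar> + \<bar>D g x\<bar>)"
          using abs_triangle_ineq4[of "D f x" "D g x"] x by (simp add: mult_left_mono)
        also have "\<dots> = norm x ^ Suc k * \<bar>D f x\<bar> + norm x ^ Suc k * \<bar>D g x\<bar>"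
          by (simp only: distrib_left)
        also have "\<dots> \<le> real R + real R"
          using fs unfolding S_def by (intro add_mono) blast+
        also have "\<dots> \<le> l * (r / 2)" using l(2) r by (simp add: field_simps)
        also have "\<dots> \<le> norm x * (r / 2)" using x r by (intro mult_right_mono) auto
        finally show ?thesis using x by simp
      qed
      \<comment> \<open>A seminorm is a supremum, so pointwise bounds give only a weak inequality;
        aiming at \<open>r / 2\<close> leaves room for the strict one.\<close>
      then have "schwartz_seminorm k bs (\<lambda>x. f x - g x) \<le> r / 2"
        using fs bs unfolding S_def D_def
        by (intro schwartz_seminorm_leI) (simp add: partial_deriv_diff)
      then show ?thesis using r by linarith
    qed
    ultimately show ?thesis by blast
  qed
  then obtain \<U> where \<U>: "\<And>R. countable (\<U> R)" "\<And>R. S R = \<Union> (\<U> R)"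
    "\<And>R U f g. U \<in> \<U> R \<Longrightarrow> f \<in> U \<Longrightarrow> g \<in> U \<Longrightarrow> schwartz_seminorm k bs (\<lambda>x. f x - g x) < r"
    by metis
  have "schwartz = \<Union> (\<Union>R. \<U> R)"
  proof
    show "schwartz \<subseteq> \<Union> (\<Union>R. \<U> R)" using S_all \<U>(2) by blast
    show "\<Union> (\<Union>R. \<U> R) \<subseteq> schwartz" using \<U>(2) unfolding S_def by blast
  qed
  then show ?thesis using \<U>(1,3) by (intro exI[of _ "\<Union>R. \<U> R"]) auto
qed

text \<open>Common refinements: intersecting the covers for the individual seminorms keeps them
  countable.\<close>

lemma schwartz_countable_cover:
  fixes r :: real
  assumes "finite L" "L \<subseteq> UNIV \<times> lists Basis" "r > 0"
  shows "\<exists>\<U>. countable \<U> \<and> (schwartz :: ('a::euclidean_space \<Rightarrow> real) set) = \<Union> \<U> \<and>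
    (\<forall>U\<in>\<U>. \<forall>f\<in>U. \<forall>g\<in>U. schwartz_close L r f g)"
  using assms
proof (induction L rule: finite_induct)
  case empty
  show ?case by (intro exI[of _ "{schwartz}"]) auto
next
  case (insert p L)
  obtain k bs where p: "p = (k, bs)" by (rule prod.exhaust)
  have bs: "bs \<in> lists Basis" and L: "L \<subseteq> UNIV \<times> lists Basis" using insert.prems(1) p by auto
  from insert.IH[OF L insert.prems(2)]
  obtain \<U> where U: "countable \<U>" "(schwartz :: ('a \<Rightarrow> real) set) = \<Union> \<U>"
    "\<forall>U\<in>\<U>. \<forall>f\<in>U. \<forall>g\<in>U. schwartz_close L r f g"
    by (elim exE conjE)
  from schwartz_countable_cover_seminorm[OF bs insert.prems(2), of k]
  obtain \<V> where V: "countable \<V>" "(schwartz :: ('a \<Rightarrow> real) set) = \<Union> \<V>"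
    "\<forall>U\<in>\<V>. \<forall>f\<in>U. \<forall>g\<in>U. schwartz_seminorm k bs (\<lambda>x. f x - g x) < r"
    by (elim exE conjE)
  let ?W = "(\<lambda>(U, V). U \<inter> V) ` (\<U> \<times> \<V>)"
  show ?case
  proof (intro exI[of _ ?W] conjI ballI)
    show "countable ?W" using U(1) V(1) by (intro countable_image countable_SIGMA)
    have eq: "\<Union> ?W = \<Union> \<U> \<inter> \<Union> \<V>" by auto
    show "schwartz = \<Union> ?W" unfolding eq U(2)[symmetric] V(2)[symmetric] by simp
    fix W f g q assume W: "W \<in> ?W" "f \<in> W" "g \<in> W" and q: "q \<in> insert p L"
    from W(1) obtain A B where W': "A \<in> \<U>" "B \<in> \<V>" "W = A \<inter> B" by auto
    have fg: "f \<in> A" "f \<in> B" "g \<in> A" "g \<in> B" using W W'(3) by auto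
    show "case q of (k, bs) \<Rightarrow> schwartz_seminorm k bs (\<lambda>x. f x - g x) < r"
    proof (cases "q = p")
      case True
      then show ?thesis unfolding p using bspec[OF bspec[OF bspec[OF V(3) W'(2)] fg(2)] fg(4)] by simp
    next
      case False
      then have "q \<in> L" using q by simp
      with bspec[OF bspec[OF bspec[OF U(3) W'(1)] fg(1)] fg(3)] show ?thesis by (rule bspec)
    qed
  qed
qed

text \<open>Applying the cover to \<open>f\<close> and \<open>A f\<close> together makes continuity of \<open>A\<close> unnecessary.\<close>

lemma schwartz_graph_separable:
  fixes A :: "('a::euclidean_space \<Rightarrow> real) \<Rightarrow> ('a \<Rightarrow> real)"
  assumes A: "\<And>f. f \<in> schwartz \<Longrightarrow> A f \<in> schwartz"
  shows "\<exists>D. countable D \<and> D \<subseteq> schwartz \<and>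
    (\<forall>f\<in>schwartz. \<forall>L r. finite L \<longrightarrow> L \<subseteq> UNIV \<times> lists Basis \<longrightarrow> 0 < r \<longrightarrow>
      (\<exists>g\<in>D. schwartz_graph_close A L r g f))"
proof -
  \<comment> \<open>There are only countably many finite sets of seminorms, and the precision is
    restricted to reciprocals of positive integers.\<close>
  define \<L> where "\<L> = {L. finite L \<and> L \<subseteq> (UNIV :: nat set) \<times> lists (Basis :: 'a set)} \<times> (UNIV :: nat set)"
  have \<L>: "countable \<L>"
    unfolding \<L>_def
    by (intro countable_SIGMA countable_Collect_finite_subset countable_lists countableI_type
        countable_finite[OF finite_Basis])
  define cover where "cover p \<U> \<longleftrightarrow> countable \<U> \<and> (schwartz :: ('a \<Rightarrow> real) set) = \<Union> \<U> \<and>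
    (\<forall>U\<in>\<U>. \<forall>f\<in>U. \<forall>g\<in>U. schwartz_close (fst p) (inverse (real (Suc (snd p)))) f g)"
    for p :: "(nat \<times> 'a list) set \<times> nat" and \<U>
  have "\<forall>p\<in>\<L>. \<exists>\<U>. cover p \<U>"
  proof
    fix p assume "p \<in> \<L>"
    then have "finite (fst p)" "fst p \<subseteq> UNIV \<times> lists Basis" unfolding \<L>_def by auto
    then show "\<exists>\<U>. cover p \<U>" unfolding cover_def by (rule schwartz_countable_cover) simp
  qed
  then obtain \<U> where cover: "\<forall>p\<in>\<L>. cover p (\<U> p)"
    by (rule bchoice[THEN exE])
  have U: "countable (\<U> p)" "(schwartz :: ('a \<Rightarrow> real) set) = \<Union> (\<U> p)" if "p \<in> \<L>" for p
    using cover that unfolding cover_def by simp_all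
  have U3: "schwartz_close (fst p) (inverse (real (Suc (snd p)))) f g"
    if "p \<in> \<L>" "U \<in> \<U> p" "f \<in> U" "g \<in> U" for p U f g
  proof -
    have "\<forall>U\<in>\<U> p. \<forall>f\<in>U. \<forall>g\<in>U. schwartz_close (fst p) (inverse (real (Suc (snd p)))) f g"
      using cover that(1) unfolding cover_def by simp
    from bspec[OF bspec[OF bspec[OF this that(2)] that(3)] that(4)] show ?thesis .
  qed
  define good where "good U V f \<longleftrightarrow> f \<in> schwartz \<and> f \<in> U \<and> A f \<in> V" for U V f
  \<comment> \<open>One representative for each pair of cells that contains \<open>f\<close> and
    \<open>A f\<close> for some Schwartz function \<open>f\<close>; it is then close to every such
    \<open>f\<close>, in itself and in its image under \<open>A\<close>.\<close>
  define pick where "pick = (\<lambda>(U, V). SOME f. good U V f)"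
  define I where "I p = {(U, V) \<in> \<U> p \<times> \<U> p. \<exists>f. good U V f}" for p
  have pick: "good U V (pick (U, V))" if "(U, V) \<in> I p" for U V p
  proof -
    have "\<exists>f. good U V f" using that unfolding I_def by blast
    then show ?thesis unfolding pick_def by (simp add: someI_ex)
  qed
  define D where "D = (\<Union>p\<in>\<L>. pick ` I p)"
  have "countable (I p)" if "p \<in> \<L>" for p
  proof (rule countable_subset)
    show "I p \<subseteq> \<U> p \<times> \<U> p" unfolding I_def by blast
    show "countable (\<U> p \<times> \<U> p)" using U(1)[OF that] by (intro countable_SIGMA)
  qed
  then have d1: "countable D" unfolding D_def using \<L> by (intro countable_UN countable_image)
  have d2: "D \<subseteq> schwartz"
  proof
    fix g assume "g \<in> D"
    then obtain q U V where "(U, V) \<in> I q" "g = pick (U, V)" unfolding D_def by auto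
    then show "g \<in> schwartz" using pick unfolding good_def by blast
  qed
  have d3: "\<exists>g\<in>D. schwartz_graph_close A L r g f"
    if f: "f \<in> schwartz" and L: "finite L" "L \<subseteq> UNIV \<times> lists Basis" "r > 0" for f L r
  proof -
    obtain n where n: "inverse (Suc n) < r" using reals_Archimedean[OF L(3)] by blast
    have p: "(L, n) \<in> \<L>" unfolding \<L>_def using L by auto
    have "f \<in> \<Union> (\<U> (L, n))" "A f \<in> \<Union> (\<U> (L, n))"
      unfolding U(2)[OF p, symmetric] by (rule f, rule A[OF f])
    then obtain U V where UV: "U \<in> \<U> (L, n)" "f \<in> U" "V \<in> \<U> (L, n)" "A f \<in> V"
      by (elim UnionE)
    then have "(U, V) \<in> I (L, n)" unfolding I_def good_def using f by blast
    then have g: "good U V (pick (U, V))" "pick (U, V) \<in> D"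
      using pick[of U V "(L, n)"] p unfolding D_def by (simp, blast)
    then have g': "pick (U, V) \<in> U" "A (pick (U, V)) \<in> V" unfolding good_def by auto
    have 1: "schwartz_close L (inverse (Suc n)) (pick (U, V)) f"
      using U3[OF p UV(1) g'(1) UV(2)] by simp
    have 2: "schwartz_close L (inverse (Suc n)) (A (pick (U, V))) (A f)"
      using U3[OF p UV(3) g'(2) UV(4)] by simp
    have "schwartz_close L r (pick (U, V)) f" "schwartz_close L r (A (pick (U, V))) (A f)"
      by (rule schwartz_close_mono[OF 1 subset_refl less_imp_le[OF n]],
          rule schwartz_close_mono[OF 2 subset_refl less_imp_le[OF n]])
    then show ?thesis by (intro bexI[OF _ g(2)]) (simp add: split_beta)
  qed
  show ?thesis by (intro exI[of _ D] conjI ballI allI impI d1 d2 d3)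
qed

text \<open>The seminorms of order 0 and \<open>2 * d\<close> together bound
  \<open>(1 + |x|^2)^d * \<bar>f x\<bar>\<close> by \<open>2 * 4^d * r\<close>. Squaring leaves a
  multiple of \<open>weight (- 2*d)\<close>, which is integrable. The added 1 in the constant
  secures strict positivity.\<close>

lemma schwartz_L2_bound:
  "\<exists>C>0. \<forall>f\<in>(schwartz :: ('a::euclidean_space \<Rightarrow> real) set). \<forall>r. schwartz_seminorm 0 [] f < r \<longrightarrow>
      schwartz_seminorm (2 * DIM('a)) [] f < r \<longrightarrow> (\<integral>x. (f x)\<^sup>2 \<partial>lborel) \<le> C * r\<^sup>2"
proof -
  define n where "n = DIM('a)"
  define J where "J = (\<integral>(x::'a). weight (- real (2 * n)) x \<partial>lborel)"
  have wi: "integrable lborel (weight (- real (2 * n)) :: 'a \<Rightarrow> real)"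
    unfolding n_def by (intro integrable_weight) auto
  have "(\<integral>x. (f x)\<^sup>2 \<partial>lborel) \<le> ((2 * 4 ^ n)\<^sup>2 * J + 1) * r\<^sup>2"
    if f: "f \<in> schwartz" and s: "schwartz_seminorm 0 [] f < r" "schwartz_seminorm (2 * n) [] f < r"
    for f :: "'a \<Rightarrow> real" and r
  proof -
    have "(f x)\<^sup>2 \<le> (2 * 4 ^ n * r)\<^sup>2 * weight (- real (2 * n)) x" for x
    proof -
      have 1: "\<bar>f x\<bar> \<le> r" "norm x ^ (2 * n) * \<bar>f x\<bar> \<le> r"
        using schwartz_seminorm_upper[OF f, of "[]" x 0] schwartz_seminorm_upper[OF f, of "[]" x "2 * n"] s by auto
      have "(1 + (norm x)\<^sup>2) ^ n \<le> ((1 + norm x)\<^sup>2) ^ n"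
        by (intro power_mono) (auto simp: power2_sum)
      also have "\<dots> = (1 + norm x) ^ (2 * n)" by (simp add: power_mult)
      also have "\<dots> \<le> 2 ^ (2 * n) * (1 + norm x ^ (2 * n))" by (intro one_plus_power_le) auto
      also have "(2::real) ^ (2 * n) = 4 ^ n" by (simp add: power_mult)
      finally have "(1 + (norm x)\<^sup>2) ^ n * \<bar>f x\<bar> \<le> 4 ^ n * (1 + norm x ^ (2 * n)) * \<bar>f x\<bar>"
        by (intro mult_right_mono) auto
      also have "\<dots> = 4 ^ n * (\<bar>f x\<bar> + norm x ^ (2 * n) * \<bar>f x\<bar>)" by (simp add: algebra_simps)
      also have "\<dots> \<le> 4 ^ n * (r + r)" using 1 by (intro mult_left_mono add_mono) auto
      finally have "(1 + (norm x)\<^sup>2) ^ n * \<bar>f x\<bar> \<le> 2 * 4 ^ n * r" by simp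
      then have "((1 + (norm x)\<^sup>2) ^ n * \<bar>f x\<bar>)\<^sup>2 \<le> (2 * 4 ^ n * r)\<^sup>2"
        by (intro power_mono) auto
      then have "(1 + (norm x)\<^sup>2) ^ (2 * n) * (f x)\<^sup>2 \<le> (2 * 4 ^ n * r)\<^sup>2"
        by (simp add: power_mult_distrib power_mult[symmetric] mult.commute[of n])
      moreover have pos: "(1 + (norm x)\<^sup>2) ^ (2 * n) > 0" by (simp add: add_pos_nonneg)
      ultimately have "(f x)\<^sup>2 \<le> (2 * 4 ^ n * r)\<^sup>2 / (1 + (norm x)\<^sup>2) ^ (2 * n)"
        by (simp add: pos_le_divide_eq mult.commute)
      also have "\<dots> = (2 * 4 ^ n * r)\<^sup>2 * weight (- real (2 * n)) x"
        unfolding weight_def powr_minus by (subst powr_realpow) (auto simp: add_pos_nonneg divide_inverse)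
      finally show ?thesis .
    qed
    then have "(\<integral>x. (f x)\<^sup>2 \<partial>lborel) \<le> (\<integral>(x::'a). (2 * 4 ^ n * r)\<^sup>2 * weight (- real (2 * n)) x \<partial>lborel)"
      using L2_square_integrable[OF schwartz_L2[OF f]] integrable_mult_right[OF wi]
      by (intro integral_mono) simp_all
    also have "\<dots> = (2 * 4 ^ n)\<^sup>2 * J * r\<^sup>2" unfolding J_def by (simp add: power_mult_distrib)
    also have "\<dots> \<le> ((2 * 4 ^ n)\<^sup>2 * J + 1) * r\<^sup>2" by (simp add: distrib_right)
    finally show ?thesis .
  qed
  moreover have "J \<ge> 0" unfolding J_def by (intro integral_nonneg_AE) (simp add: weight_pos less_imp_le)
  then have "(2 * 4 ^ n)\<^sup>2 * J + 1 > 0" by (intro add_nonneg_pos mult_nonneg_nonneg) auto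
  ultimately show ?thesis unfolding n_def by blast
qed

section \<open>Orthonormal series\<close>

definition L2_inner :: "('a::euclidean_space \<Rightarrow> real) \<Rightarrow> ('a \<Rightarrow> real) \<Rightarrow> real"
  where "L2_inner f g = (\<integral>x. f x * g x \<partial>lborel)"

lemma L2_inner_commute: "L2_inner f g = L2_inner g f"
  unfolding L2_inner_def by (simp only: mult.commute)

lemma L2_inner_self_nonneg: "L2_inner f f \<ge> 0"
  unfolding L2_inner_def by simp

text \<open>Otherwise \<open>u\<close> would be nonzero on a ball, and balls have positive
  measure.\<close>

lemma continuous_AE_zero:
  fixes u :: "'a::euclidean_space \<Rightarrow> real"
  assumes "continuous_on UNIV u" "AE x in lborel. u x = 0"
  shows "u x = 0"
proof (rule ccontr)
  assume "u x \<noteq> 0"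
  have "open {x. u x \<noteq> 0}"
    using assms(1) by (intro open_Collect_neq continuous_on_const)
  then obtain r where r: "r > 0" "ball x r \<subseteq> {x. u x \<noteq> 0}"
    using \<open>u x \<noteq> 0\<close> unfolding open_contains_ball by blast
  have "AE y in lborel. y \<notin> ball x r"
    using assms(2) by eventually_elim (use r(2) in auto)
  then have "emeasure lborel (ball x r) = 0"
    by (subst (asm) AE_iff_measurable[of "ball x r"]) auto
  moreover have "unit_ball_vol (real DIM('a)) * r ^ DIM('a) > 0"
    using r(1) by (intro mult_pos_pos) auto
  ultimately show False using r(1) by (simp add: emeasure_ball)
qed

text \<open>Continuity upgrades vanishing almost everywhere to vanishing everywhere; Gram-Schmidt
  can then work with functions instead of equivalence classes.\<close>

lemma schwartz_norm_zero:
  assumes "f \<in> schwartz" "L2_inner f f = 0"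
  shows "f x = 0"
proof -
  have i: "integrable lborel (\<lambda>x. f x * f x)" by (intro schwartz_mult_integrable assms)
  have "AE x in lborel. f x * f x = 0"
    using assms(2) unfolding L2_inner_def
    by (subst (asm) integral_nonneg_eq_0_iff_AE[OF i]) auto
  then have "AE x in lborel. f x = 0" by simp
  then show ?thesis by (rule continuous_AE_zero[OF schwartz_continuous[OF assms(1)]])
qed

lemma L2_inner_cmult_left: "L2_inner (\<lambda>x. c * f x) g = c * L2_inner f g"
  unfolding L2_inner_def by (simp add: mult.assoc)

lemma L2_inner_diff_sum:
  assumes f: "f \<in> L2" and g: "g \<in> L2" and e: "\<And>k. k \<in> I \<Longrightarrow> e k \<in> L2" and I: "finite I"
  shows "L2_inner g (\<lambda>x. f x - (\<Sum>k\<in>I. c k * e k x)) = L2_inner g f - (\<Sum>k\<in>I. c k * L2_inner g (e k))"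
proof -
  have "L2_inner g (\<lambda>x. f x - (\<Sum>k\<in>I. c k * e k x)) =
      (\<integral>x. g x * f x - (\<Sum>k\<in>I. c k * (g x * e k x)) \<partial>lborel)"
    unfolding L2_inner_def right_diff_distrib sum_distrib_left by (simp only: mult.left_commute)
  also have "\<dots> = (\<integral>x. g x * f x \<partial>lborel) - (\<integral>x. (\<Sum>k\<in>I. c k * (g x * e k x)) \<partial>lborel)"
    by (intro Bochner_Integration.integral_diff Bochner_Integration.integrable_sum
        integrable_mult_right L2_mult_integrable f g e)
  also have "(\<integral>x. (\<Sum>k\<in>I. c k * (g x * e k x)) \<partial>lborel) = (\<Sum>k\<in>I. (\<integral>x. c k * (g x * e k x) \<partial>lborel))"
    by (intro Bochner_Integration.integral_sum integrable_mult_right L2_mult_integrable g e)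
  also have "\<dots> = (\<Sum>k\<in>I. c k * L2_inner g (e k))" by (simp add: L2_inner_def)
  finally show ?thesis by (simp add: L2_inner_def)
qed

text \<open>The table of the first \<open>n\<close> Gram-Schmidt vectors.  Division by a vanishing norm yields the
  zero function.\<close>

primrec gram_schmidt_upto :: "(nat \<Rightarrow> 'a::euclidean_space \<Rightarrow> real) \<Rightarrow> nat \<Rightarrow> nat \<Rightarrow> 'a \<Rightarrow> real"
  where
    "gram_schmidt_upto f 0 = (\<lambda>_ _. 0)"
  | "gram_schmidt_upto f (Suc n) =
      (let u = (\<lambda>x. f n x - (\<Sum>k<n. L2_inner (f n) (gram_schmidt_upto f n k) * gram_schmidt_upto f n k x))
       in (gram_schmidt_upto f n)(n := (\<lambda>x. inverse (sqrt (L2_inner u u)) * u x)))"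

definition gram_schmidt :: "(nat \<Rightarrow> 'a::euclidean_space \<Rightarrow> real) \<Rightarrow> nat \<Rightarrow> 'a \<Rightarrow> real"
  where "gram_schmidt f n = gram_schmidt_upto f (Suc n) n"

lemma gram_schmidt_upto_eq: "k < n \<Longrightarrow> gram_schmidt_upto f n k = gram_schmidt f k"
proof (induction n)
  case 0
  then show ?case by simp
next
  case (Suc n)
  show ?case
  proof (cases "k = n")
    case True
    then show ?thesis by (simp only: gram_schmidt_def)
  next
    case False
    then have "k < n" using Suc.prems by simp
    then show ?thesis using Suc.IH False by (simp add: Let_def)
  qed
qed

text \<open>The component of \<open>f n\<close> orthogonal to the earlier vectors, before
  normalisation.\<close>

definition gram_schmidt_residue :: "(nat \<Rightarrow> 'a::euclidean_space \<Rightarrow> real) \<Rightarrow> nat \<Rightarrow> 'a \<Rightarrow> real"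
  where "gram_schmidt_residue f n x = f n x - (\<Sum>k<n. L2_inner (f n) (gram_schmidt f k) * gram_schmidt f k x)"

lemma gram_schmidt_rec:
  "gram_schmidt f n =
    (\<lambda>x. inverse (sqrt (L2_inner (gram_schmidt_residue f n) (gram_schmidt_residue f n))) * gram_schmidt_residue f n x)"
proof -
  have "(\<lambda>x. f n x - (\<Sum>k<n. L2_inner (f n) (gram_schmidt_upto f n k) * gram_schmidt_upto f n k x))
      = gram_schmidt_residue f n"
    unfolding gram_schmidt_residue_def[abs_def] by (intro ext arg_cong2[of _ _ _ _ "(-)"] refl sum.cong)
      (simp_all add: gram_schmidt_upto_eq)
  then show ?thesis unfolding gram_schmidt_def by (simp add: Let_def)
qed

context
  fixes f :: "nat \<Rightarrow> 'a::euclidean_space \<Rightarrow> real"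
  assumes f: "\<And>n. f n \<in> schwartz"
begin

lemma gram_schmidt_schwartz: "gram_schmidt f n \<in> schwartz"
proof (induction n rule: less_induct)
  case (less n)
  then show ?case
    unfolding gram_schmidt_rec[of f n] gram_schmidt_residue_def[abs_def]
    by (intro schwartz_mult_real schwartz_diff f schwartz_sum) auto
qed

lemma gram_schmidt_residue_schwartz: "gram_schmidt_residue f n \<in> schwartz"
  unfolding gram_schmidt_residue_def[abs_def]
  by (intro schwartz_mult_real schwartz_diff f schwartz_sum gram_schmidt_schwartz) auto

lemma gram_schmidt_norm: "gram_schmidt f n = (\<lambda>x. 0) \<or> L2_inner (gram_schmidt f n) (gram_schmidt f n) = 1"
proof (cases "L2_inner (gram_schmidt_residue f n) (gram_schmidt_residue f n) = 0")
  case True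
  then show ?thesis by (simp add: gram_schmidt_rec[of f n])
next
  case False
  define q where "q = L2_inner (gram_schmidt_residue f n) (gram_schmidt_residue f n)"
  have q: "q > 0" using False L2_inner_self_nonneg[of "gram_schmidt_residue f n"] by (simp add: q_def)
  have "L2_inner (gram_schmidt f n) (gram_schmidt f n) = inverse (sqrt q) * (inverse (sqrt q) * q)"
    unfolding gram_schmidt_rec[of f n] q_def[symmetric] L2_inner_cmult_left
    by (subst L2_inner_commute) (simp only: L2_inner_cmult_left q_def)
  also have "\<dots> = 1" using q by (simp add: field_simps)
  finally show ?thesis by simp
qed

text \<open>The residue is always the square root of its squared norm times the Gram-Schmidt vector.
  If that norm vanishes, the residue is zero at every point, so replacing it by the zero function
  loses nothing.\<close>

lemma gram_schmidt_span: "\<exists>c. \<forall>x. f n x = (\<Sum>k\<le>n. c k * gram_schmidt f k x)"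
proof -
  define q where "q = L2_inner (gram_schmidt_residue f n) (gram_schmidt_residue f n)"
  have *: "gram_schmidt_residue f n x = sqrt q * gram_schmidt f n x" for x
  proof (cases "q = 0")
    case True
    then show ?thesis
      using schwartz_norm_zero[OF gram_schmidt_residue_schwartz, of n x] unfolding q_def by simp
  next
    case False
    then show ?thesis unfolding gram_schmidt_rec[of f n] q_def[symmetric] by simp
  qed
  define c where "c k = (if k = n then sqrt q else L2_inner (f n) (gram_schmidt f k))" for k
  have "f n x = (\<Sum>k\<le>n. c k * gram_schmidt f k x)" for x
  proof -
    have "(\<Sum>k\<le>n. c k * gram_schmidt f k x) = (\<Sum>k<n. c k * gram_schmidt f k x) + c n * gram_schmidt f n x"
      by (simp add: lessThan_Suc_atMost[symmetric])
    also have "(\<Sum>k<n. c k * gram_schmidt f k x) = (\<Sum>k<n. L2_inner (f n) (gram_schmidt f k) * gram_schmidt f k x)"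
      by (intro sum.cong refl) (simp add: c_def)
    also have "c n * gram_schmidt f n x = gram_schmidt_residue f n x" by (simp add: * c_def)
    finally show ?thesis by (simp add: gram_schmidt_residue_def)
  qed
  then show ?thesis by blast
qed

text \<open>By induction only the term \<open>k = j\<close> of the projection survives. It cancels
  the coefficient of \<open>f n\<close> when \<open>e j\<close> is a unit vector, and everything
  vanishes when it is zero.\<close>

lemma gram_schmidt_orthogonal_less: "j < n \<Longrightarrow> L2_inner (gram_schmidt f j) (gram_schmidt f n) = 0"
proof (induction n arbitrary: j rule: less_induct)
  case (less n)
  have e: "gram_schmidt f k \<in> L2" for k by (intro schwartz_L2 gram_schmidt_schwartz)
  have "L2_inner (gram_schmidt f j) (gram_schmidt_residue f n) =
      L2_inner (gram_schmidt f j) (f n) -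
      (\<Sum>k<n. L2_inner (f n) (gram_schmidt f k) * L2_inner (gram_schmidt f j) (gram_schmidt f k))"
    unfolding gram_schmidt_residue_def[abs_def] by (intro L2_inner_diff_sum schwartz_L2[OF f] e) simp
  also have "(\<Sum>k<n. L2_inner (f n) (gram_schmidt f k) * L2_inner (gram_schmidt f j) (gram_schmidt f k)) =
      (\<Sum>k<n. if k = j then L2_inner (f n) (gram_schmidt f j) * L2_inner (gram_schmidt f j) (gram_schmidt f j) else 0)"
  proof (intro sum.cong refl)
    fix k assume k: "k \<in> {..<n}"
    have "L2_inner (gram_schmidt f j) (gram_schmidt f k) = 0" if "k \<noteq> j"
    proof (cases "j < k")
      case True
      then show ?thesis using less.IH[of k j] k by simp
    next
      case False
      then show ?thesis using less.IH[of j k] less.prems that by (simp add: L2_inner_commute)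
    qed
    then show "L2_inner (f n) (gram_schmidt f k) * L2_inner (gram_schmidt f j) (gram_schmidt f k) =
      (if k = j then L2_inner (f n) (gram_schmidt f j) * L2_inner (gram_schmidt f j) (gram_schmidt f j) else 0)"
      by simp
  qed
  also have "\<dots> = L2_inner (f n) (gram_schmidt f j) * L2_inner (gram_schmidt f j) (gram_schmidt f j)"
    using less.prems by simp
  also have "L2_inner (gram_schmidt f j) (f n) - \<dots> = 0"
    using gram_schmidt_norm[of j]
  proof
    assume "gram_schmidt f j = (\<lambda>x. 0)"
    then show ?thesis by (simp add: L2_inner_def)
  next
    assume "L2_inner (gram_schmidt f j) (gram_schmidt f j) = 1"
    then show ?thesis by (simp add: L2_inner_commute[of "f n"])
  qed
  finally have "L2_inner (gram_schmidt_residue f n) (gram_schmidt f j) = 0"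
    by (simp add: L2_inner_commute)
  then have "L2_inner (gram_schmidt f n) (gram_schmidt f j) = 0"
    unfolding gram_schmidt_rec[of f n] L2_inner_cmult_left by simp
  then show ?case by (simp add: L2_inner_commute)
qed

lemma gram_schmidt_orthogonal: "i \<noteq> j \<Longrightarrow> L2_inner (gram_schmidt f i) (gram_schmidt f j) = 0"
  using gram_schmidt_orthogonal_less[of i j] gram_schmidt_orthogonal_less[of j i]
  by (cases "i < j") (simp_all add: L2_inner_commute)

end

section \<open>The Riesz-Fischer theorem\<close>

lemma sum_half_powers: "(\<Sum>k<K. (1/2::real) ^ k) \<le> 2"
proof -
  have "(\<Sum>k<K. (1/2::real) ^ k) = 2 - 2 * (1/2) ^ K" by (induction K) auto
  then show ?thesis by simp
qed

text \<open>The series is cut into blocks \<open>g k\<close> of geometrically decreasing energy. The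
  sum of the blocks then converges almost everywhere, and its partial sums have a common
  square-integrable majorant, so the coefficients pass to the limit by dominated
  convergence.\<close>

lemma riesz_fischer:
  fixes e :: "nat \<Rightarrow> 'a::euclidean_space \<Rightarrow> real"
  assumes e: "\<And>i. e i \<in> L2"
    and orth: "\<And>i j. i \<noteq> j \<Longrightarrow> (\<integral>x. e i x * e j x \<partial>lborel) = 0"
    and nrm: "\<And>i. (\<integral>x. e i x * e i x \<partial>lborel) \<le> 1"
    and c: "summable (\<lambda>i. (c i)\<^sup>2)"
  shows "\<exists>h\<in>L2. \<forall>j. (\<integral>x. e j x * h x \<partial>lborel) = c j * (\<integral>x. e j x * e j x \<partial>lborel)"
proof -
  define s where "s = (\<Sum>i. (c i)\<^sup>2)"
  have s: "(\<Sum>i\<in>I. (c i)\<^sup>2) \<le> s" if "finite I" for I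
    unfolding s_def by (intro sum_le_suminf c that) auto
  have s0: "s \<ge> 0" using s[of "{}"] by simp
  have "\<forall>k. \<exists>N. \<forall>m\<ge>N. \<forall>n. norm (\<Sum>i\<in>{m..<n}. (c i)\<^sup>2) < (1/8) ^ k"
    using c unfolding summable_Cauchy by simp
  then obtain N where N: "\<And>k m n. N k \<le> m \<Longrightarrow> norm (\<Sum>i\<in>{m..<n}. (c i)\<^sup>2) < (1/8) ^ k"
    by (rule choice[THEN exE]) blast
  \<comment> \<open>Block boundaries: nondecreasing, beyond \<open>N k\<close> at index
    \<open>Suc k\<close> so that the Cauchy estimate applies, and at least \<open>k\<close> so that
    every index is eventually reached.\<close>
  define M where "M k = k + (\<Sum>i<k. N i)" for k
  have M: "M 0 = 0" "N k \<le> M (Suc k)" "M k \<le> M (Suc k)" "k \<le> M k" for k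
    unfolding M_def by simp_all
  define g where "g k x = (\<Sum>i\<in>{M k..<M (Suc k)}. c i * e i x)" for k x
  have gL: "g k \<in> L2" for k
    unfolding g_def[abs_def] by (intro L2_sum L2_cmult e finite_atLeastLessThan)
  have gm [measurable]: "g k \<in> borel_measurable borel" for k by (rule L2_measurable[OF gL])
  have partial: "(\<Sum>k<K. g k x) = (\<Sum>i\<in>{0..<M K}. c i * e i x)" for K x
  proof (induction K)
    case 0
    then show ?case by (simp add: M)
  next
    case (Suc K)
    have "(\<Sum>k<Suc K. g k x) = (\<Sum>i\<in>{0..<M K}. c i * e i x) + (\<Sum>i\<in>{M K..<M (Suc K)}. c i * e i x)"
      unfolding sum.lessThan_Suc Suc.IH by (simp only: g_def)
    also have "\<dots> = (\<Sum>i\<in>{0..<M (Suc K)}. c i * e i x)"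
      by (rule sum.atLeastLessThan_concat[OF le0 M(3)])
    finally show ?case .
  qed
  \<comment> \<open>Block 0 is bounded by \<open>s\<close>. Block \<open>Suc l\<close> is bounded by
    \<open>(1/8)^l\<close>, which is 8 times \<open>(1/8)^(Suc l)\<close>; this is the origin of the
    8.\<close>
  define B where "B = s + 8"
  have gB: "(\<integral>x. (g k x)\<^sup>2 \<partial>lborel) \<le> B * (1/8) ^ k" for k
  proof -
    have "(\<integral>x. (g k x)\<^sup>2 \<partial>lborel) \<le> (\<Sum>i\<in>{M k..<M (Suc k)}. (c i)\<^sup>2)"
      unfolding g_def by (rule orthogonal_sum_square) (use e orth nrm in auto)
    also have "\<dots> \<le> B * (1/8) ^ k"
    proof (cases k)
      case 0
      then show ?thesis using s[of "{M k..<M (Suc k)}"] by (simp add: B_def)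
    next
      case (Suc l)
      have "(\<Sum>i\<in>{M k..<M (Suc k)}. (c i)\<^sup>2) \<le> (1/8) ^ l"
        using N[of l "M k" "M (Suc k)"] M(2)[of l] Suc by (simp add: sum_nonneg)
      also have "\<dots> = 8 * (1/8) ^ k" by (simp add: Suc)
      also have "\<dots> \<le> B * (1/8) ^ k" using s0 by (intro mult_right_mono) (auto simp: B_def)
      finally show ?thesis .
    qed
    finally show ?thesis .
  qed
  \<comment> \<open>The factor \<open>2^k\<close> still leaves summable integrals, of order
    \<open>(1/4)^k\<close>, and it is what makes the sum of the blocks converge pointwise.\<close>
  define Q where "Q k x = 2 ^ k * (g k x)\<^sup>2" for k x
  have Q0: "Q k x \<ge> 0" for k x by (simp add: Q_def)
  have Qi: "integrable lborel (Q k)" for k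
    unfolding Q_def[abs_def] by (intro integrable_mult_right L2_square_integrable gL)
  have Qm [measurable]: "Q k \<in> borel_measurable borel" for k using Qi[of k] by auto
  have QB: "(\<integral>x. Q k x \<partial>lborel) \<le> B * (1/4) ^ k" for k
  proof -
    have "(\<integral>x. Q k x \<partial>lborel) \<le> 2 ^ k * (B * (1/8) ^ k)"
      unfolding Q_def using gB[of k] by simp
    also have "\<dots> = B * (2 * (1/8)) ^ k" by (simp only: power_mult_distrib mult_ac)
    finally show ?thesis by simp
  qed
  have Qfin: "(\<integral>\<^sup>+x. (\<Sum>k. ennreal (Q k x)) \<partial>lborel) < \<infinity>"
  proof -
    have "(\<integral>\<^sup>+x. (\<Sum>k. ennreal (Q k x)) \<partial>lborel) = (\<Sum>k. (\<integral>\<^sup>+x. ennreal (Q k x) \<partial>lborel))"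
      by (rule nn_integral_suminf) measurable
    also have "\<dots> = (\<Sum>k. ennreal (\<integral>x. Q k x \<partial>lborel))"
      by (intro suminf_cong nn_integral_eq_integral Qi) (simp add: Q0)
    also have "\<dots> \<le> (\<Sum>k. ennreal (B * (1/4) ^ k))"
      by (intro suminf_le ennreal_leI QB) auto
    also have "\<dots> < \<infinity>"
      using s0 by (subst suminf_ennreal2) (auto simp: B_def intro!: summable_mult summable_geometric)
    finally show ?thesis .
  qed
  \<comment> \<open>Where the series diverges, \<open>enn2real\<close> returns 0; this happens only
    on the null set excluded by \<open>fin\<close>.\<close>
  define G where "G x = enn2real (\<Sum>k. ennreal (Q k x))" for x
  have fin: "AE x in lborel. (\<Sum>k. ennreal (Q k x)) \<noteq> \<infinity>"
    by (rule nn_integral_PInf_AE) (use Qfin in auto)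
  have Gi: "integrable lborel G"
  proof (rule integrableI_nonneg)
    show "G \<in> borel_measurable lborel" unfolding G_def[abs_def] by measurable
    have "(\<integral>\<^sup>+x. ennreal (G x) \<partial>lborel) \<le> (\<integral>\<^sup>+x. (\<Sum>k. ennreal (Q k x)) \<partial>lborel)"
      unfolding G_def by (intro nn_integral_mono) (simp add: ennreal_enn2real_if)
    also note Qfin
    finally show "(\<integral>\<^sup>+x. ennreal (G x) \<partial>lborel) < \<infinity>" .
  qed (simp add: G_def)
  define H where "H K x = (\<Sum>k<K. g k x)" for K x
  define h where "h x = (\<Sum>k. g k x)" for x
  have good: "(\<lambda>K. H K x) \<longlonglongrightarrow> h x" "(H K x)\<^sup>2 \<le> 2 * G x" if "(\<Sum>k. ennreal (Q k x)) \<noteq> \<infinity>" for K x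
  proof -
    have sQ: "summable (\<lambda>k. Q k x)"
      using that by (intro summable_suminf_not_top Q0) simp
    have GQ: "G x = (\<Sum>k. Q k x)"
      unfolding G_def by (simp add: suminf_ennreal2[OF Q0 sQ] suminf_nonneg[OF sQ Q0])
    \<comment> \<open>From \<open>y \<le> 1 + y^2\<close> with
      \<open>y = 2^k * \<bar>g k x\<bar>\<close>, divided by \<open>2^k\<close>.\<close>
    have gQ: "\<bar>g k x\<bar> \<le> (1/2) ^ k + Q k x" for k
    proof -
      define t :: real where "t = 2 ^ k"
      have t: "t > 0" unfolding t_def by simp
      have aux: "y \<le> 1 + y\<^sup>2" for y :: real
      proof -
        have "0 \<le> (y - 1)\<^sup>2 + y\<^sup>2 + 1" by simp
        also have "\<dots> = 2 * (1 + y\<^sup>2 - y)" by (simp add: power2_diff algebra_simps)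
        finally show ?thesis by simp
      qed
      have "t * \<bar>g k x\<bar> \<le> 1 + (t * \<bar>g k x\<bar>)\<^sup>2" by (rule aux)
      also have "\<dots> = t * (1 / t + t * (g k x)\<^sup>2)"
        using t by (simp add: field_simps power2_eq_square)
      finally have "\<bar>g k x\<bar> \<le> 1 / t + t * (g k x)\<^sup>2" using t by (simp only: mult_le_cancel_left_pos)
      then show ?thesis unfolding Q_def t_def by (simp add: power_one_over)
    qed
    have "summable (\<lambda>k. (1/2::real) ^ k + Q k x)"
      by (intro summable_add sQ summable_geometric) simp
    then have "summable (\<lambda>k. g k x)"
      using gQ by (intro summable_comparison_test[of "\<lambda>k. g k x" "\<lambda>k. (1/2::real) ^ k + Q k x"]) auto
    then show "(\<lambda>K. H K x) \<longlonglongrightarrow> h x"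
      unfolding H_def h_def by (rule summable_LIMSEQ)
    \<comment> \<open>Cauchy-Schwarz with weights \<open>(sqrt 2)^k\<close>: the inverse weights
      have square sum at most 2, and the other factor is a partial sum of
      \<open>G x\<close>.\<close>
    have "(H K x)\<^sup>2 = (\<Sum>k<K. (1 / sqrt 2) ^ k * (sqrt 2 ^ k * g k x))\<^sup>2"
      unfolding H_def by (simp add: power_one_over)
    also have "\<dots> \<le> (\<Sum>k<K. ((1 / sqrt 2) ^ k)\<^sup>2) * (\<Sum>k<K. (sqrt 2 ^ k * g k x)\<^sup>2)"
      by (rule Cauchy_Schwarz_ineq_sum)
    also have "(\<Sum>k<K. ((1 / sqrt 2) ^ k)\<^sup>2) = (\<Sum>k<K. (1/2) ^ k)"
      by (intro sum.cong refl) (simp add: power_mult[symmetric] mult.commute[of _ 2] power_mult power_divide)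
    also have "(\<Sum>k<K. (sqrt 2 ^ k * g k x)\<^sup>2) = (\<Sum>k<K. Q k x)"
      by (intro sum.cong refl) (simp add: Q_def power_mult_distrib power_mult[symmetric] mult.commute[of _ 2], simp add: power_mult)
    also have "(\<Sum>k<K. (1/2) ^ k) * (\<Sum>k<K. Q k x) \<le> 2 * G x"
      unfolding GQ by (intro mult_mono sum_half_powers sum_le_suminf sQ sum_nonneg) (auto simp: Q0)
    finally show "(H K x)\<^sup>2 \<le> 2 * G x" .
  qed
  have HL: "H K \<in> L2" for K unfolding H_def[abs_def] by (intro L2_sum gL finite_lessThan)
  have hm: "h \<in> borel_measurable borel" unfolding h_def[abs_def] by measurable
  have hG: "AE x in lborel. (h x)\<^sup>2 \<le> 2 * G x"
    using fin
  proof eventually_elim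
    case (elim x)
    have "(\<lambda>K. (H K x)\<^sup>2) \<longlonglongrightarrow> (h x)\<^sup>2" by (intro tendsto_power good(1) elim)
    then show ?case by (rule LIMSEQ_le_const2) (use good(2)[OF elim] in blast)
  qed
  have "integrable lborel (\<lambda>x. (h x)\<^sup>2)"
  proof (rule Bochner_Integration.integrable_bound)
    show "integrable lborel (\<lambda>x. 2 * G x)" using Gi by simp
    show "(\<lambda>x. (h x)\<^sup>2) \<in> borel_measurable lborel" using hm by simp
    show "AE x in lborel. norm ((h x)\<^sup>2) \<le> norm (2 * G x)"
      using hG by eventually_elim simp
  qed
  then have hL: "h \<in> L2" unfolding L2_def using hm by simp
  moreover have "(\<integral>x. e j x * h x \<partial>lborel) = c j * (\<integral>x. e j x * e j x \<partial>lborel)" for j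
  proof (rule LIMSEQ_unique)
    show "(\<lambda>K. \<integral>x. e j x * H K x \<partial>lborel) \<longlonglongrightarrow> (\<integral>x. e j x * h x \<partial>lborel)"
    proof (rule integral_dominated_convergence[where w = "\<lambda>x. (e j x)\<^sup>2 + 2 * G x"])
      show "integrable lborel (\<lambda>x. (e j x)\<^sup>2 + 2 * G x)"
        using L2_square_integrable[OF e[of j]] Gi by simp
      show "AE x in lborel. (\<lambda>K. e j x * H K x) \<longlonglongrightarrow> e j x * h x"
        using fin by eventually_elim (intro tendsto_mult_left good(1))
      show "AE x in lborel. norm (e j x * H K x) \<le> (e j x)\<^sup>2 + 2 * G x" for K
        using fin
      proof eventually_elim
        case (elim x)
        have "2 * \<bar>e j x\<bar> * \<bar>H K x\<bar> \<le> (e j x)\<^sup>2 + (H K x)\<^sup>2"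
          using sum_squares_bound[of "\<bar>e j x\<bar>" "\<bar>H K x\<bar>"] by simp
        then have "\<bar>e j x\<bar> * \<bar>H K x\<bar> \<le> (e j x)\<^sup>2 + (H K x)\<^sup>2"
          using mult_nonneg_nonneg[of "\<bar>e j x\<bar>" "\<bar>H K x\<bar>"] by linarith
        then show ?case using good(2)[OF elim, of K] by (simp add: abs_mult)
      qed
      show "(\<lambda>x. e j x * h x) \<in> borel_measurable lborel"
        "(\<lambda>x. e j x * H K x) \<in> borel_measurable lborel" for K
        using L2_mult_integrable[OF e[of j] hL] L2_mult_integrable[OF e[of j] HL[of K]] by auto
    qed
    \<comment> \<open>From \<open>K = Suc j\<close> on, the partial sum contains index
      \<open>j\<close>, and the coefficient no longer changes.\<close>
    have "(\<integral>x. e j x * H K x \<partial>lborel) = c j * (\<integral>x. e j x * e j x \<partial>lborel)" if "K \<ge> Suc j" for K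
    proof -
      have "j \<in> {0..<M K}" using that M(4)[of K] by simp
      then show ?thesis
        unfolding H_def partial by (subst orthogonal_sum_inner) (use e orth in auto)
    qed
    then show "(\<lambda>K. \<integral>x. e j x * H K x \<partial>lborel) \<longlonglongrightarrow> c j * (\<integral>x. e j x * e j x \<partial>lborel)"
      by (intro tendsto_eventually) (auto simp: eventually_sequentially)
  qed
  ultimately show ?thesis by blast
qed

section \<open>Tempered distributions given by square-integrable functions\<close>

lemma tempered_add:
  "\<phi> \<in> tempered_distributions \<Longrightarrow> f \<in> schwartz \<Longrightarrow> g \<in> schwartz \<Longrightarrow> \<phi> (\<lambda>x. f x + g x) = \<phi> f + \<phi> g"
  unfolding tempered_distributions_def by blast

lemma tempered_cmult:
  "\<phi> \<in> tempered_distributions \<Longrightarrow> f \<in> schwartz \<Longrightarrow> \<phi> (\<lambda>x. c * f x) = c * \<phi> f"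
  unfolding tempered_distributions_def by blast

lemma linear_functional_sum:
  fixes \<Lambda> :: "('a::euclidean_space \<Rightarrow> real) \<Rightarrow> real"
  assumes add: "\<And>f g. f \<in> schwartz \<Longrightarrow> g \<in> schwartz \<Longrightarrow> \<Lambda> (\<lambda>x. f x + g x) = \<Lambda> f + \<Lambda> g"
    and cmult: "\<And>c f. f \<in> schwartz \<Longrightarrow> \<Lambda> (\<lambda>x. c * f x) = c * \<Lambda> f"
    and e: "\<And>k. e k \<in> schwartz" and "finite I"
  shows "\<Lambda> (\<lambda>x. \<Sum>k\<in>I. c k * e k x) = (\<Sum>k\<in>I. c k * \<Lambda> (e k))"
  using \<open>finite I\<close>
proof (induction I rule: finite_induct)
  case empty
  show ?case using cmult[OF schwartz_zero, of 0] by simp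
next
  case (insert i I)
  have "\<Lambda> (\<lambda>x. c i * e i x + (\<Sum>k\<in>I. c k * e k x)) = \<Lambda> (\<lambda>x. c i * e i x) + \<Lambda> (\<lambda>x. \<Sum>k\<in>I. c k * e k x)"
    by (intro add schwartz_mult_real schwartz_sum e insert.hyps)
  then show ?case using insert by (simp add: cmult[OF e])
qed

text \<open>The deterministic half of the proof, for one fixed \<phi>. Riesz-Fischer produces
  \<open>h\<close> with the right coefficients; the representation passes from \<open>e\<close> to
  its linear combinations \<open>s n\<close>, and from these to all Schwartz functions by
  approximation in the graph topology.\<close>

lemma tempered_L2_representation:
  fixes A :: "('a::euclidean_space \<Rightarrow> real) \<Rightarrow> ('a \<Rightarrow> real)"
  assumes \<phi>: "\<phi> \<in> tempered_distributions"
    and A: "\<And>f. f \<in> schwartz \<Longrightarrow> A f \<in> schwartz"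
    and A_add: "\<And>f g. f \<in> schwartz \<Longrightarrow> g \<in> schwartz \<Longrightarrow> A (\<lambda>x. f x + g x) = (\<lambda>x. A f x + A g x)"
    and A_cmult: "\<And>c f. f \<in> schwartz \<Longrightarrow> A (\<lambda>x. c * f x) = (\<lambda>x. c * A f x)"
    and s: "\<And>n. s n \<in> schwartz"
    and dense: "\<And>f L r. f \<in> schwartz \<Longrightarrow> finite L \<Longrightarrow> L \<subseteq> UNIV \<times> lists Basis \<Longrightarrow> r > 0 \<Longrightarrow>
      \<exists>n. schwartz_graph_close A L r (s n) f"
    and summable: "summable (\<lambda>n. (\<phi> (A (gram_schmidt s n)))\<^sup>2)"
  shows "\<exists>h\<in>L2. \<forall>f\<in>schwartz. \<phi> (A f) = (\<integral>x. f x * h x \<partial>lborel)"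
proof -
  define e where "e = gram_schmidt s"
  define \<Lambda> where "\<Lambda> f = \<phi> (A f)" for f
  have eS: "e n \<in> schwartz" for n unfolding e_def by (rule gram_schmidt_schwartz[OF s])
  have eL: "e n \<in> L2" for n by (rule schwartz_L2[OF eS])
  have norm01: "e n = (\<lambda>x. 0) \<or> (\<integral>x. e n x * e n x \<partial>lborel) = 1" for n
    using gram_schmidt_norm[of s n, OF s] unfolding e_def L2_inner_def by simp
  have orth: "(\<integral>x. e i x * e j x \<partial>lborel) = 0" if "i \<noteq> j" for i j
    using gram_schmidt_orthogonal[of s i j, OF s that] unfolding e_def L2_inner_def .
  have nrm: "(\<integral>x. e n x * e n x \<partial>lborel) \<le> 1" for n
    using norm01[of n] by auto
  have \<Lambda>_add: "\<Lambda> (\<lambda>x. f x + g x) = \<Lambda> f + \<Lambda> g" if "f \<in> schwartz" "g \<in> schwartz" for f g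
    unfolding \<Lambda>_def A_add[OF that] by (rule tempered_add[OF \<phi> A[OF that(1)] A[OF that(2)]])
  have \<Lambda>_cmult: "\<Lambda> (\<lambda>x. c * f x) = c * \<Lambda> f" if "f \<in> schwartz" for c f
    unfolding \<Lambda>_def A_cmult[OF that] by (rule tempered_cmult[OF \<phi> A[OF that]])
  have sm: "summable (\<lambda>n. (\<Lambda> (e n))\<^sup>2)" using summable unfolding \<Lambda>_def e_def .
  have "\<exists>h\<in>L2. \<forall>j. (\<integral>x. e j x * h x \<partial>lborel) = \<Lambda> (e j) * (\<integral>x. e j x * e j x \<partial>lborel)"
    by (rule riesz_fischer[OF eL]) (fact orth nrm sm)+
  then obtain h where h: "h \<in> L2" "\<And>j. (\<integral>x. e j x * h x \<partial>lborel) = \<Lambda> (e j) * (\<integral>x. e j x * e j x \<partial>lborel)"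
    by blast
  have on_e: "(\<integral>x. e j x * h x \<partial>lborel) = \<Lambda> (e j)" for j
    using norm01[of j]
  proof
    assume 0: "e j = (\<lambda>x. 0)"
    \<comment> \<open>A vanishing vector satisfies the identity because \<Lambda> is linear;
      Riesz-Fischer yields only a multiple of its squared norm, which is zero.\<close>
    have "\<Lambda> (e j) = 0" unfolding 0 using \<Lambda>_cmult[OF schwartz_zero, of 0] by simp
    then show ?thesis by (simp add: 0)
  next
    assume "(\<integral>x. e j x * e j x \<partial>lborel) = 1"
    then show ?thesis by (simp add: h(2))
  qed
  have on_s: "\<Lambda> (s n) = (\<integral>x. s n x * h x \<partial>lborel)" for n
  proof -
    obtain c where c: "\<And>x. s n x = (\<Sum>k\<le>n. c k * e k x)"
      using gram_schmidt_span[of s n, OF s] unfolding e_def by blast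
    have sn: "s n = (\<lambda>x. \<Sum>k\<le>n. c k * e k x)" using c by blast
    have "\<Lambda> (s n) = (\<Sum>k\<le>n. c k * \<Lambda> (e k))"
      unfolding sn by (rule linear_functional_sum[where \<Lambda> = \<Lambda> and e = e, OF \<Lambda>_add \<Lambda>_cmult eS]) auto
    also have "\<dots> = (\<Sum>k\<le>n. (\<integral>x. c k * (e k x * h x) \<partial>lborel))"
      by (simp add: on_e)
    also have "\<dots> = (\<integral>x. (\<Sum>k\<le>n. c k * (e k x * h x)) \<partial>lborel)"
      by (intro Bochner_Integration.integral_sum[symmetric] integrable_mult_right L2_mult_integrable eL h(1))
    also have "\<dots> = (\<integral>x. s n x * h x \<partial>lborel)"
      unfolding c by (simp add: sum_distrib_right mult.assoc)
    finally show ?thesis .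
  qed
  obtain C where C: "C > 0"
    "\<And>(f :: 'a \<Rightarrow> real) r. f \<in> schwartz \<Longrightarrow> schwartz_seminorm 0 [] f < r \<Longrightarrow>
      schwartz_seminorm (2 * DIM('a)) [] f < r \<Longrightarrow> (\<integral>x. (f x)\<^sup>2 \<partial>lborel) \<le> C * r\<^sup>2"
    using schwartz_L2_bound by blast
  \<comment> \<open>The three summands are the errors per unit of \<epsilon>: 1 from the continuity
    of \<phi>, and the other two from estimating the L2 pairing.\<close>
  define K where "K = 1 + (\<integral>x. (h x)\<^sup>2 \<partial>lborel) + C"
  have K: "K > 0" unfolding K_def using C(1) by (intro add_nonneg_pos) auto
  have close: "\<bar>\<Lambda> f - (\<integral>x. f x * h x \<partial>lborel)\<bar> \<le> \<epsilon> * K" if f: "f \<in> schwartz" and \<epsilon>: "\<epsilon> > 0" for f \<epsilon>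
  proof -
    obtain L r where L: "finite L" "L \<subseteq> UNIV \<times> lists Basis" "0 < r"
      "\<forall>g\<in>schwartz. (schwartz_close L r g (A f)) \<longrightarrow> \<bar>\<phi> g - \<phi> (A f)\<bar> < \<epsilon>"
      using tempered_distribution_continuous[OF \<phi> A[OF f] \<epsilon>] by (elim exE conjE)
    \<comment> \<open>The seminorms that control \<phi> near \<open>A f\<close>, together with the
      two that control the L2 norm of the approximation error.\<close>
    define L' where "L' = {(0, []), (2 * DIM('a), [])} \<union> L"
    have L': "finite L'" "L' \<subseteq> UNIV \<times> lists Basis" unfolding L'_def using L(1,2) by auto
    have "min r \<epsilon> > 0" using L(3) \<epsilon> by simp
    from dense[OF f L' this] obtain n where
      n: "schwartz_graph_close A (L') (min r \<epsilon>) (s n) f" by (elim exE)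
    have "schwartz_close L' (min r \<epsilon>) (A (s n)) (A f)" using n by (simp add: split_beta)
    then have "schwartz_close L r (A (s n)) (A f)" by (rule schwartz_close_mono) (auto simp: L'_def)
    then have 1: "\<bar>\<Lambda> (s n) - \<Lambda> f\<bar> < \<epsilon>"
      unfolding \<Lambda>_def using bspec[OF L(4) A[OF s[of n]]] by (rule rev_mp)
    define d where "d x = s n x - f x" for x
    have dS: "d \<in> schwartz" unfolding d_def by (intro schwartz_diff s f)
    have dL: "d \<in> L2" by (rule schwartz_L2[OF dS])
    have "(0, []) \<in> L'" "(2 * DIM('a), []) \<in> L'" unfolding L'_def by auto
    from bspec[OF n this(1)] bspec[OF n this(2)]
    have "schwartz_seminorm 0 [] d < \<epsilon>" "schwartz_seminorm (2 * DIM('a)) [] d < \<epsilon>"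
      unfolding d_def by simp_all
    then have d2: "(\<integral>x. (d x)\<^sup>2 \<partial>lborel) \<le> C * \<epsilon>\<^sup>2" by (rule C(2)[OF dS])
    have int: "integrable lborel (\<lambda>x. \<epsilon> * (h x)\<^sup>2 + (d x)\<^sup>2 / \<epsilon>)"
      using L2_square_integrable[OF h(1)] L2_square_integrable[OF dL] by simp
    have "\<bar>\<integral>x. d x * h x \<partial>lborel\<bar> \<le> (\<integral>x. \<bar>d x * h x\<bar> \<partial>lborel)"
      by (rule integral_abs_bound)
    also have "\<dots> \<le> (\<integral>x. \<epsilon> * (h x)\<^sup>2 + (d x)\<^sup>2 / \<epsilon> \<partial>lborel)"
    proof (rule integral_mono[OF integrable_abs[OF L2_mult_integrable[OF dL h(1)]] int])
      fix x
      \<comment> \<open>Young's inequality, balanced so that both terms are of order \<epsilon>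
        after integration: the integral of \<open>d^2\<close> is of order \<epsilon> squared and
        gets divided by \<epsilon>.\<close>
      define a b where "a = sqrt \<epsilon> * \<bar>h x\<bar>" and "b = \<bar>d x\<bar> / sqrt \<epsilon>"
      have ab: "a * b = \<bar>d x * h x\<bar>" "a\<^sup>2 = \<epsilon> * (h x)\<^sup>2" "b\<^sup>2 = (d x)\<^sup>2 / \<epsilon>"
        using \<epsilon> unfolding a_def b_def by (simp_all add: abs_mult power_mult_distrib power_divide)
      have "0 \<le> a * b" unfolding ab by simp
      moreover have "2 * a * b \<le> a\<^sup>2 + b\<^sup>2" by (rule sum_squares_bound)
      ultimately have "a * b \<le> a\<^sup>2 + b\<^sup>2" by linarith
      then show "\<bar>d x * h x\<bar> \<le> \<epsilon> * (h x)\<^sup>2 + (d x)\<^sup>2 / \<epsilon>" unfolding ab .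
    qed
    also have "\<dots> = \<epsilon> * (\<integral>x. (h x)\<^sup>2 \<partial>lborel) + (\<integral>x. (d x)\<^sup>2 \<partial>lborel) / \<epsilon>"
      using L2_square_integrable[OF h(1)] L2_square_integrable[OF dL] by simp
    also have "\<dots> \<le> \<epsilon> * (\<integral>x. (h x)\<^sup>2 \<partial>lborel) + C * \<epsilon>"
      using d2 \<epsilon> by (simp add: divide_le_eq power2_eq_square mult.assoc)
    finally have 2: "\<bar>\<integral>x. d x * h x \<partial>lborel\<bar> \<le> \<epsilon> * (\<integral>x. (h x)\<^sup>2 \<partial>lborel) + C * \<epsilon>" .
    have "(\<integral>x. d x * h x \<partial>lborel) = (\<integral>x. s n x * h x \<partial>lborel) - (\<integral>x. f x * h x \<partial>lborel)"
      unfolding d_def left_diff_distrib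
      by (intro Bochner_Integration.integral_diff L2_mult_integrable schwartz_L2 s f h(1))
    then have "\<Lambda> f - (\<integral>x. f x * h x \<partial>lborel) = (\<integral>x. d x * h x \<partial>lborel) - (\<Lambda> (s n) - \<Lambda> f)"
      by (simp add: on_s)
    then have "\<bar>\<Lambda> f - (\<integral>x. f x * h x \<partial>lborel)\<bar> \<le> \<epsilon> * (\<integral>x. (h x)\<^sup>2 \<partial>lborel) + C * \<epsilon> + \<epsilon>"
      using 1 2 by linarith
    then show ?thesis unfolding K_def by (simp add: algebra_simps)
  qed
  have "\<phi> (A f) = (\<integral>x. f x * h x \<partial>lborel)" if f: "f \<in> schwartz" for f
  proof -
    have "\<bar>\<Lambda> f - (\<integral>x. f x * h x \<partial>lborel)\<bar> \<le> 0 + \<delta>" if "\<delta> > 0" for \<delta>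
      using close[OF f, of "\<delta> / K"] that K by simp
    then have "\<bar>\<Lambda> f - (\<integral>x. f x * h x \<partial>lborel)\<bar> \<le> 0" by (rule field_le_epsilon)
    then show ?thesis unfolding \<Lambda>_def by simp
  qed
  with h(1) show ?thesis by blast
qed

lemma dist_of_fun_apply:
  assumes h: "h \<in> L2" and g: "g \<in> schwartz"
  shows "dist_of_fun h g = Complex (\<integral>x. Re (g x) * h x \<partial>lborel) (\<integral>x. Im (g x) * h x \<partial>lborel)"
proof -
  have re: "integrable lborel (\<lambda>x. Re (g x) * h x)" and im: "integrable lborel (\<lambda>x. Im (g x) * h x)"
    by (intro L2_mult_integrable schwartz_L2 schwartz_Re schwartz_Im g h)+
  have "dist_of_fun h g = (\<integral>x. of_real (h x) * g x \<partial>lborel)"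
    using g by (simp add: dist_of_fun_def)
  also have "\<dots> = (\<integral>x. of_real (Re (g x) * h x) + \<i> * of_real (Im (g x) * h x) \<partial>lborel)"
    by (intro Bochner_Integration.integral_cong refl) (simp add: complex_eq_iff)
  also have "\<dots> = (\<integral>x. complex_of_real (Re (g x) * h x) \<partial>lborel) + (\<integral>x. \<i> * complex_of_real (Im (g x) * h x) \<partial>lborel)"
    by (intro Bochner_Integration.integral_add integrable_mult_right integrable_of_real re im)
  also have "\<dots> = of_real (\<integral>x. Re (g x) * h x \<partial>lborel) + \<i> * of_real (\<integral>x. Im (g x) * h x \<partial>lborel)"
    by (simp only: integral_mult_right_zero integral_complex_of_real)
  finally show ?thesis by (simp add: Complex_eq)
qed

text \<open>Transposing the operators turns the hypothesis into an identity of distributions. The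
  second form results from testing it against functions to which the inverse operators have already
  been applied.\<close>

lemma weighted_bessel_dist_of_fun:
  fixes \<phi> :: "('a::euclidean_space \<Rightarrow> real) \<Rightarrow> real"
  assumes m: "m \<noteq> 0" and h: "h \<in> L2"
    and rep: "\<And>f. f \<in> schwartz \<Longrightarrow> \<phi> (weighted_bessel m (- \<beta>) (- \<alpha>) f) = (\<integral>x. f x * h x \<partial>lborel)"
  shows "dist_mult (weight (- \<alpha>)) (dist_bessel m (- \<beta>) (complexify \<phi>)) = dist_of_fun h"
    and "complexify \<phi> = dist_bessel m \<beta> (dist_mult (weight \<alpha>) (dist_of_fun h))"
proof -
  have key: "complexify \<phi> (bessel_op m (- \<beta>) (\<lambda>x. of_real (weight (- \<alpha>) x) * g x)) = dist_of_fun h g"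
    if g: "g \<in> schwartz" for g
  proof -
    have S: "bessel_op m (- \<beta>) (\<lambda>x. of_real (weight (- \<alpha>) x) * g x) \<in> schwartz"
      by (intro bessel_op_schwartz schwartz_weight m g)
    show ?thesis
      unfolding complexify_def restrict_apply'[OF S] bessel_op_weight_complex[OF m g]
      by (simp add: rep schwartz_Re schwartz_Im g dist_of_fun_apply[OF h g])
  qed
  show "dist_mult (weight (- \<alpha>)) (dist_bessel m (- \<beta>) (complexify \<phi>)) = dist_of_fun h"
  proof
    fix g :: "'a \<Rightarrow> complex"
    show "dist_mult (weight (- \<alpha>)) (dist_bessel m (- \<beta>) (complexify \<phi>)) g = dist_of_fun h g"
    proof (cases "g \<in> schwartz")
      case True
      then show ?thesis
        using key[OF True] by (simp add: dist_mult_def dist_bessel_apply[OF m schwartz_weight])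
    next
      case False
      then show ?thesis by (simp add: dist_mult_def dist_of_fun_def)
    qed
  qed
  show "complexify \<phi> = dist_bessel m \<beta> (dist_mult (weight \<alpha>) (dist_of_fun h))"
  proof
    fix g :: "'a \<Rightarrow> complex"
    show "complexify \<phi> g = dist_bessel m \<beta> (dist_mult (weight \<alpha>) (dist_of_fun h)) g"
    proof (cases "g \<in> schwartz")
      case True
      have S: "bessel_op m \<beta> g \<in> schwartz" by (rule bessel_op_schwartz[OF m True])
      have w: "complex_of_real (weight (- \<alpha>) x) * of_real (weight \<alpha> x) = 1" for x :: 'a
        unfolding weight_eq_bessel_symbol of_real_mult[symmetric] bessel_symbol_mult[OF one_neq_zero]
        by (simp add: bessel_symbol_zero)
      have "dist_bessel m \<beta> (dist_mult (weight \<alpha>) (dist_of_fun h)) g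
          = dist_of_fun h (\<lambda>x. of_real (weight \<alpha> x) * bessel_op m \<beta> g x)"
        using S by (simp add: dist_bessel_apply[OF m True] dist_mult_def)
      \<comment> \<open>Here \<open>key\<close> is read backwards at the test function
        \<open>(1+x^2)^\<alpha> (m^2-\<Delta>)^\<beta> g\<close>; the weights cancel first, then the
        powers of \<open>m^2-\<Delta>\<close>.\<close>
      also have "\<dots> = complexify \<phi> (bessel_op m (- \<beta>) (\<lambda>x. of_real (weight (- \<alpha>) x) *
          (of_real (weight \<alpha> x) * bessel_op m \<beta> g x)))"
        by (rule key[OF schwartz_weight[OF S], symmetric])
      also have "\<dots> = complexify \<phi> g"
        unfolding mult.assoc[symmetric] w mult_1_left by (simp only: bessel_op_inverse[OF m True])
      finally show ?thesis by simp
    next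
      case False
      then show ?thesis by (simp add: complexify_def dist_bessel_def dist_inv_fourier_def)
    qed
  qed
qed

section \<open>The Gaussian measure\<close>

text \<open>Introduces the parameter \<open>t\<close> of the characteristic function of one
  evaluation: the defining identity of the measure is applied to \<open>t\<close> times
  \<open>f\<close>.\<close>

lemma covariance_cmult:
  "covariance m (\<lambda>x. c * f x) (\<lambda>x. c * f x) = c\<^sup>2 * covariance m f f"
proof -
  have "fun_bessel m s (\<lambda>y. of_real (c * f y)) x = of_real c * fun_bessel m s (\<lambda>y. of_real (f y)) x" for s x
    unfolding fun_bessel_def of_real_mult fourier_cmult mult.left_commute[of _ "complex_of_real c"]
    by (rule inv_fourier_cmult)
  then have "(\<integral>x. c * f x * Re (fun_bessel m (- 1/2) (\<lambda>y. of_real (c * f y)) x) \<partial>lborel)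
      = (\<integral>x. c\<^sup>2 * (f x * Re (fun_bessel m (- 1/2) (\<lambda>y. of_real (f y)) x)) \<partial>lborel)"
    by (simp add: power2_eq_square mult.assoc mult.left_commute)
  then show ?thesis unfolding covariance_def by simp
qed

lemma covariance_weighted_bessel_nonneg:
  assumes "m \<noteq> 0" "g \<in> schwartz"
  shows "covariance m (weighted_bessel m (- \<beta>) r g) (weighted_bessel m (- \<beta>) r g) \<ge> 0"
  unfolding covariance_weighted_bessel[OF assms] by (simp add: bessel_symbol_nonneg)

text \<open>Third-order Taylor remainder of the exponential. The constant \<open>1/6\<close> is
  relaxed to \<open>1/2\<close>, so that the factor \<open>2 / t^2\<close> leaves the constant
  1.\<close>

lemma cos_second_order:
  fixes x :: real
  assumes t: "t > 0"
  shows "\<bar>2 * (1 - cos (t * x)) / t\<^sup>2 - x\<^sup>2\<bar> \<le> t * \<bar>x\<bar> ^ 3"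
proof -
  define y where "y = t * x"
  define z where "z = iexp y - (\<Sum>k\<le>2. (\<i> * of_real y) ^ k / fact k)"
  have "norm z \<le> \<bar>y\<bar> ^ Suc 2 / fact (Suc 2)"
    unfolding z_def by (rule iexp_approx1)
  also have "\<dots> = \<bar>y\<bar> ^ 3 / 6" by (simp add: fact_numeral eval_nat_numeral)
  finally have "norm z \<le> \<bar>y\<bar> ^ 3 / 6" .
  moreover have "Re z = cos y - 1 + y\<^sup>2 / 2"
    unfolding z_def by (simp add: numeral_2_eq_2 Re_exp power2_eq_square)
  ultimately have "\<bar>cos y - 1 + y\<^sup>2 / 2\<bar> \<le> \<bar>y\<bar> ^ 3 / 6"
    using abs_Re_le_cmod[of z] by linarith
  then have 1: "\<bar>cos y - 1 + y\<^sup>2 / 2\<bar> \<le> \<bar>y\<bar> ^ 3 / 2" using zero_le_power[of "\<bar>y\<bar>" 3] by linarith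
  have "2 * (1 - cos (t * x)) / t\<^sup>2 - x\<^sup>2 = - 2 / t\<^sup>2 * (cos y - 1 + y\<^sup>2 / 2)"
    using t unfolding y_def by (simp add: field_simps power_mult_distrib)
  then have "\<bar>2 * (1 - cos (t * x)) / t\<^sup>2 - x\<^sup>2\<bar> = 2 / t\<^sup>2 * \<bar>cos y - 1 + y\<^sup>2 / 2\<bar>"
    by (simp only: abs_mult) simp
  also have "\<dots> \<le> 2 / t\<^sup>2 * (\<bar>y\<bar> ^ 3 / 2)" by (intro mult_left_mono 1) simp
  also have "\<dots> = t * \<bar>x\<bar> ^ 3"
    using t unfolding y_def by (simp add: abs_mult power_mult_distrib power2_eq_square power3_eq_cube)
  finally show ?thesis .
qed

context
  fixes m :: real and \<mu> :: "(('a::euclidean_space \<Rightarrow> real) \<Rightarrow> real) measure"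
  assumes gaussian: "centered_gaussian_measure (covariance m) \<mu>"
begin

lemma gaussian_space: "space \<mu> = tempered_distributions"
  using gaussian unfolding centered_gaussian_measure_def by blast

lemma gaussian_prob_space: "prob_space \<mu>"
  using gaussian unfolding centered_gaussian_measure_def by blast

lemma gaussian_eval_measurable:
  assumes "f \<in> schwartz"
  shows "(\<lambda>\<phi>. \<phi> f) \<in> borel_measurable \<mu>"
proof (rule measurableI)
  fix B :: "real set" assume B: "B \<in> sets borel"
  let ?G = "{{\<phi> \<in> tempered_distributions. \<phi> f \<in> B} | f B. f \<in> (schwartz :: ('a \<Rightarrow> real) set) \<and> B \<in> sets borel}"
  have "sets \<mu> = sets (sigma tempered_distributions ?G)"
    using gaussian unfolding centered_gaussian_measure_def tempered_algebra_def by blast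
  also have "\<dots> = sigma_sets tempered_distributions ?G"
    by (rule sets_measure_of) blast
  finally have sets: "sets \<mu> = sigma_sets tempered_distributions ?G" .
  have "(\<lambda>\<phi>. \<phi> f) -` B \<inter> space \<mu> = {\<phi> \<in> tempered_distributions. \<phi> f \<in> B}"
    unfolding gaussian_space by blast
  also have "\<dots> \<in> sets \<mu>"
    unfolding sets using assms B by (intro sigma_sets.Basic) blast
  finally show "(\<lambda>\<phi>. \<phi> f) -` B \<inter> space \<mu> \<in> sets \<mu>" .
qed simp

text \<open>Real part of the defining identity at \<open>t\<close> times \<open>f\<close>. Pulling
  \<open>t\<close> out of \<phi> uses linearity, which holds on the underlying space of the
  measure.\<close>

lemma gaussian_cos:
  assumes f: "f \<in> schwartz"
  shows "integrable \<mu> (\<lambda>\<phi>. cos (t * \<phi> f))"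
    and "(\<integral>\<phi>. cos (t * \<phi> f) \<partial>\<mu>) = exp (- (t\<^sup>2 * covariance m f f) / 2)"
proof -
  interpret prob_space \<mu> by (rule gaussian_prob_space)
  note [measurable] = gaussian_eval_measurable[OF f]
  show "integrable \<mu> (\<lambda>\<phi>. cos (t * \<phi> f))"
    by (rule integrable_const_bound[where B = 1]) auto
  have i: "integrable \<mu> (\<lambda>\<phi>. exp (\<i> * complex_of_real (t * \<phi> f)))"
    by (rule integrable_const_bound[where B = 1]) auto
  have "(\<integral>\<phi>. exp (\<i> * complex_of_real (t * \<phi> f)) \<partial>\<mu>) = (\<integral>\<phi>. exp (\<i> * of_real (\<phi> (\<lambda>x. t * f x))) \<partial>\<mu>)"
    by (intro Bochner_Integration.integral_cong refl)
      (simp only: gaussian_space tempered_cmult[OF _ f])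
  also have "\<dots> = complex_of_real (exp (- (1/2) * covariance m (\<lambda>x. t * f x) (\<lambda>x. t * f x)))"
    using gaussian schwartz_mult_real[OF f, of t] unfolding centered_gaussian_measure_def by blast
  finally have "Re (\<integral>\<phi>. exp (\<i> * complex_of_real (t * \<phi> f)) \<partial>\<mu>) = exp (- (t\<^sup>2 * covariance m f f) / 2)"
    unfolding covariance_cmult by simp
  moreover have "Re (\<integral>\<phi>. exp (\<i> * complex_of_real (t * \<phi> f)) \<partial>\<mu>) = (\<integral>\<phi>. cos (t * \<phi> f) \<partial>\<mu>)"
    using integral_Re[OF i] by (simp add: Re_exp)
  ultimately show "(\<integral>\<phi>. cos (t * \<phi> f) \<partial>\<mu>) = exp (- (t\<^sup>2 * covariance m f f) / 2)" by simp
qed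

text \<open>Fatou's lemma for the second difference quotients of the characteristic function at zero.\<close>

lemma gaussian_second_moment:
  assumes f: "f \<in> schwartz"
  shows "(\<integral>\<^sup>+\<phi>. ennreal ((\<phi> f)\<^sup>2) \<partial>\<mu>) \<le> ennreal (covariance m f f)"
proof -
  interpret prob_space \<mu> by (rule gaussian_prob_space)
  note [measurable] = gaussian_eval_measurable[OF f]
  define C where "C = covariance m f f"
  define t where "t n = inverse (real (Suc n))" for n
  have t: "t n > 0" for n unfolding t_def by simp
  have t0: "t \<longlonglongrightarrow> 0" unfolding t_def by (rule LIMSEQ_inverse_real_of_nat)
  \<comment> \<open>Nonnegative, as Fatou requires, and convergent to \<open>x^2\<close>; its
    expectation is known from the cosine transform.\<close>
  define q where "q n x = 2 * (1 - cos (t n * x)) / (t n)\<^sup>2" for n x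
  have q0: "q n x \<ge> 0" for n x unfolding q_def by simp
  have qlim: "(\<lambda>n. q n x) \<longlonglongrightarrow> x\<^sup>2" for x
  proof -
    have ev: "\<forall>\<^sub>F n in sequentially. norm (q n x - x\<^sup>2) \<le> t n * \<bar>x\<bar> ^ 3"
      unfolding q_def using cos_second_order[OF t] by (intro always_eventually allI) simp
    have "(\<lambda>n. t n * \<bar>x\<bar> ^ 3) \<longlonglongrightarrow> 0"
      using tendsto_mult_right[OF t0, of "\<bar>x\<bar> ^ 3"] by simp
    from Lim_null_comparison[OF ev this] show ?thesis by (rule LIM_zero_cancel)
  qed
  have bound: "(\<integral>\<^sup>+\<phi>. ennreal (q n (\<phi> f)) \<partial>\<mu>) \<le> ennreal C" for n
  proof -
    have i: "integrable \<mu> (\<lambda>\<phi>. q n (\<phi> f))"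
      unfolding q_def using gaussian_cos(1)[OF f, of "t n"] by simp
    have "(\<integral>\<^sup>+\<phi>. ennreal (q n (\<phi> f)) \<partial>\<mu>) = ennreal (\<integral>\<phi>. q n (\<phi> f) \<partial>\<mu>)"
      by (rule nn_integral_eq_integral[OF i]) (simp add: q0)
    also have "(\<integral>\<phi>. q n (\<phi> f) \<partial>\<mu>) = 2 * (1 - exp (- ((t n)\<^sup>2 * C) / 2)) / (t n)\<^sup>2"
      unfolding q_def C_def using gaussian_cos[OF f, of "t n"] by (simp add: prob_space)
    \<comment> \<open>By \<open>1 - exp (- y) \<le> y\<close>, which gives the covariance as a bound
      for every \<open>n\<close>, not only in the limit.\<close>
    also have "\<dots> \<le> 2 * ((t n)\<^sup>2 * C / 2) / (t n)\<^sup>2"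
    proof (intro divide_right_mono mult_left_mono)
      show "1 - exp (- ((t n)\<^sup>2 * C) / 2) \<le> (t n)\<^sup>2 * C / 2"
        using exp_ge_add_one_self[of "- ((t n)\<^sup>2 * C) / 2"] by simp
    qed auto
    also have "\<dots> = C" using t[of n] by simp
    finally show ?thesis by (simp add: ennreal_leI)
  qed
  have "(\<integral>\<^sup>+\<phi>. ennreal ((\<phi> f)\<^sup>2) \<partial>\<mu>) = (\<integral>\<^sup>+\<phi>. liminf (\<lambda>n. ennreal (q n (\<phi> f))) \<partial>\<mu>)"
  proof (intro nn_integral_cong)
    fix \<phi>
    have "liminf (\<lambda>n. ennreal (q n (\<phi> f))) = ennreal ((\<phi> f)\<^sup>2)"
      by (intro lim_imp_Liminf tendsto_ennrealI qlim) simp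
    then show "ennreal ((\<phi> f)\<^sup>2) = liminf (\<lambda>n. ennreal (q n (\<phi> f)))" by simp
  qed
  also have "\<dots> \<le> liminf (\<lambda>n. \<integral>\<^sup>+\<phi>. ennreal (q n (\<phi> f)) \<partial>\<mu>)"
    by (rule nn_integral_liminf) (simp add: q_def)
  also have "\<dots> \<le> liminf (\<lambda>n::nat. ennreal C)"
    by (intro Liminf_mono always_eventually allI bound)
  also have "\<dots> = ennreal C" by (simp add: Liminf_const)
  finally show ?thesis unfolding C_def .
qed

text \<open>Tonelli: the expectation of the sum is the sum of the second moments, and a nonnegative
  function with finite integral is finite almost everywhere.\<close>

lemma gaussian_AE_summable:
  assumes f: "\<And>n. f n \<in> schwartz" and nonneg: "\<And>n. covariance m (f n) (f n) \<ge> 0"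
    and bounded: "\<And>n. (\<Sum>i<n. covariance m (f i) (f i)) \<le> B"
  shows "AE \<phi> in \<mu>. summable (\<lambda>n. (\<phi> (f n))\<^sup>2)"
proof -
  note [measurable] = gaussian_eval_measurable[OF f]
  have "(\<integral>\<^sup>+\<phi>. (\<Sum>n. ennreal ((\<phi> (f n))\<^sup>2)) \<partial>\<mu>) = (\<Sum>n. (\<integral>\<^sup>+\<phi>. ennreal ((\<phi> (f n))\<^sup>2) \<partial>\<mu>))"
    by (rule nn_integral_suminf) measurable
  also have "\<dots> \<le> (\<Sum>n. ennreal (covariance m (f n) (f n)))"
    by (intro suminf_le gaussian_second_moment f) auto
  also have "\<dots> \<le> ennreal B"
  proof (rule suminf_le_const)
    show "(\<Sum>i<n. ennreal (covariance m (f i) (f i))) \<le> ennreal B" for n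
      using bounded[of n] by (subst sum_ennreal) (auto simp: nonneg intro: ennreal_leI)
  qed auto
  also have "\<dots> < \<infinity>" by simp
  finally have "AE \<phi> in \<mu>. (\<Sum>n. ennreal ((\<phi> (f n))\<^sup>2)) \<noteq> \<infinity>"
    by (intro nn_integral_PInf_AE) auto
  then show ?thesis
  proof eventually_elim
    case (elim \<phi>)
    then show ?case by (intro summable_suminf_not_top) auto
  qed
qed

end

text \<open>The two conjuncts express the support property as membership in the image and through
  the inverse operators. \<open>AE\<close> asks only for a null set containing the exceptions, so
  measurability of the image is not at issue.\<close>

theorem mainTheorem1:
  fixes m \<alpha> \<beta> :: real
    and \<mu> :: "(('a::euclidean_space \<Rightarrow> real) \<Rightarrow> real) measure"
  assumes "m \<noteq> 0"
    and "centered_gaussian_measure (covariance m) \<mu>"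
    and "\<alpha> > real DIM('a) / 4"
    and "\<beta> > (real DIM('a) - 1) / 4"
  shows "(AE \<phi> in \<mu>. \<phi> \<in> weighted_bessel_image m \<beta> \<alpha>) \<and>
    (AE \<phi> in \<mu>. dist_mult (weight (- \<alpha>)) (dist_bessel m (- \<beta>) (complexify \<phi>))
       \<in> dist_of_fun ` L2)"
proof -
  define A where "A = (weighted_bessel m (- \<beta>) (- \<alpha>) :: ('a \<Rightarrow> real) \<Rightarrow> 'a \<Rightarrow> real)"
  have A: "A f \<in> schwartz" if "f \<in> schwartz" for f
    unfolding A_def by (rule weighted_bessel_schwartz[OF assms(1) that])
  have A_add: "A (\<lambda>x. f x + g x) = (\<lambda>x. A f x + A g x)" if "f \<in> schwartz" "g \<in> schwartz" for f g
    unfolding A_def by (rule ext) (rule weighted_bessel_add[OF assms(1) that])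
  have A_cmult: "A (\<lambda>x. c * f x) = (\<lambda>x. c * A f x)" for c f
    unfolding A_def by (rule ext) (rule weighted_bessel_cmult)
  have "\<exists>D. countable D \<and> D \<subseteq> schwartz \<and>
    (\<forall>f\<in>schwartz. \<forall>L r. finite L \<longrightarrow> L \<subseteq> UNIV \<times> lists Basis \<longrightarrow> 0 < r \<longrightarrow>
      (\<exists>g\<in>D. schwartz_graph_close A L r g f))"
    by (rule schwartz_graph_separable) (fact A)
  then obtain D where D: "countable D" "D \<subseteq> schwartz" and
    D_dense: "\<forall>f\<in>schwartz. \<forall>L r. finite L \<longrightarrow> L \<subseteq> UNIV \<times> lists Basis \<longrightarrow> 0 < r \<longrightarrow>
      (\<exists>g\<in>D. schwartz_graph_close A L r g f)"
    by (elim exE conjE)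
  have D3: "\<exists>g\<in>D. schwartz_graph_close A L r g f"
    if "f \<in> schwartz" "finite L" "L \<subseteq> UNIV \<times> lists Basis" "r > 0" for f L r
    using bspec[OF D_dense that(1), THEN spec, THEN spec, THEN mp, THEN mp, THEN mp, OF that(2-4)] .
  \<comment> \<open>Density for the empty family of seminorms already provides an element;
    \<open>from_nat_into\<close> enumerates a nonempty set.\<close>
  have "D \<noteq> {}" using D3[OF schwartz_zero, of "{}" 1] by auto
  define s where "s = from_nat_into D"
  have range_s: "range s = D" unfolding s_def by (rule range_from_nat_into[OF \<open>D \<noteq> {}\<close> D(1)])
  have s: "s n \<in> schwartz" for n using D(2) range_s by blast
  have dense: "\<exists>n. schwartz_graph_close A L r (s n) f"
    if "f \<in> schwartz" "finite L" "L \<subseteq> UNIV \<times> lists Basis" "r > 0" for f L r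
  proof -
    from D3[OF that] obtain g where g: "g \<in> D" "schwartz_graph_close A L r g f"
      by (elim bexE)
    from g(1) obtain n where "g = s n" unfolding range_s[symmetric] by (elim rangeE)
    then show ?thesis using g(2) by (intro exI[of _ n]) (simp only:)
  qed
  define e where "e = gram_schmidt s"
  have e: "e n \<in> schwartz" for n unfolding e_def by (rule gram_schmidt_schwartz[OF s])
  have orth: "(\<integral>x. e i x * e j x \<partial>lborel) = 0" if "i \<noteq> j" for i j
    using gram_schmidt_orthogonal[of s i j, OF s that] unfolding e_def L2_inner_def .
  have nrm: "(\<integral>x. e n x * e n x \<partial>lborel) \<le> 1" for n
    using gram_schmidt_norm[of s n, OF s] unfolding e_def L2_inner_def by auto
  obtain B where B: "\<And>n. (\<Sum>i<n. covariance m (A (e i)) (A (e i))) \<le> B"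
    unfolding A_def by (rule covariance_sum_bounded[where e = e, OF assms(1,3,4) e orth nrm]) blast+
  have "AE \<phi> in \<mu>. summable (\<lambda>n. (\<phi> (A (e n)))\<^sup>2)"
    by (rule gaussian_AE_summable[where f = "\<lambda>n. A (e n)", OF assms(2) A[OF e] _ B])
      (simp add: A_def covariance_weighted_bessel_nonneg[OF assms(1) e])
  \<comment> \<open>The exceptional set is the divergence set of one series, so the quantifier over
    \<open>f\<close> can stand inside \<open>AE\<close>.\<close>
  then have "AE \<phi> in \<mu>. \<phi> \<in> tempered_distributions \<and>
      (\<exists>h\<in>L2. \<forall>f\<in>schwartz. \<phi> (A f) = (\<integral>x. f x * h x \<partial>lborel))"
    using AE_space
  proof eventually_elim
    case (elim \<phi>)
    then have \<phi>: "\<phi> \<in> tempered_distributions" by (simp add: gaussian_space[OF assms(2)])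
    have "\<exists>h\<in>L2. \<forall>f\<in>schwartz. \<phi> (A f) = (\<integral>x. f x * h x \<partial>lborel)"
      by (rule tempered_L2_representation[OF \<phi> A A_add A_cmult])
        (fact s dense elim(1)[unfolded e_def] | assumption)+
    then show ?case using \<phi> by (rule conjI[rotated])
  qed
  then have "AE \<phi> in \<mu>. \<phi> \<in> weighted_bessel_image m \<beta> \<alpha> \<and>
      dist_mult (weight (- \<alpha>)) (dist_bessel m (- \<beta>) (complexify \<phi>)) \<in> dist_of_fun ` L2"
  proof eventually_elim
    case (elim \<phi>)
    then obtain h where h: "h \<in> L2" and
      rep: "\<And>f. f \<in> schwartz \<Longrightarrow> \<phi> (weighted_bessel m (- \<beta>) (- \<alpha>) f) = (\<integral>x. f x * h x \<partial>lborel)"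
      unfolding A_def by blast
    have 1: "dist_mult (weight (- \<alpha>)) (dist_bessel m (- \<beta>) (complexify \<phi>)) = dist_of_fun h"
      by (rule weighted_bessel_dist_of_fun(1)[OF assms(1) h]) (rule rep)
    have 2: "complexify \<phi> = dist_bessel m \<beta> (dist_mult (weight \<alpha>) (dist_of_fun h))"
      by (rule weighted_bessel_dist_of_fun(2)[OF assms(1) h]) (rule rep)
    have "\<phi> \<in> weighted_bessel_image m \<beta> \<alpha>"
      unfolding weighted_bessel_image_def using elim h 2 by blast
    moreover have "dist_mult (weight (- \<alpha>)) (dist_bessel m (- \<beta>) (complexify \<phi>)) \<in> dist_of_fun ` L2"
      unfolding 1 using h by (rule imageI)
    ultimately show ?case ..
  qed
  then show ?thesis unfolding AE_conj_iff .
qed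

end
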